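(* Let $T = R_0 [x_1,\ldots,x_d,y_1,\ldots,y_c]$ be a bigraded ring over a commutative Noetherian ring $R_0$, where $\deg(x_i) = (0,f_i)$ with $f_i\ge 1$ for $1 \le i \le d$ and $\deg(y_j) = (1,d_j)$ with $d_j\ge 0$ for $1 \le j \le c$, and $d_1\le d_2\le \cdots\le d_c$. Let $\mathscr{L}$ be a finitely generated $\mathbb{Z}^2$-graded $T$-module. Set $\delta := \inf\{ j : y_j\notin\sqrt{\mathrm{ann}_T(\mathscr{L})}\}$. Set $R := R_0[x_1,\ldots,x_d]$, where $\deg(x_i) = f_i$ for $1 \le i \le d$. Denote $\mathscr{L}_{(n,* )} := \bigoplus_{l\in\mathbb{Z}} \mathscr{L}_{(n,l)}$ for each $n \in \mathbb{Z}$. Then $\mathscr{L}_{(n,* )}$ forms a $\mathbb{Z}$-graded $R$-module for each $n \in \mathbb{Z}$. Moreover, either $\mathscr{L}_{(n,* )} = 0$ for all $n\gg 0$, or $\mathscr{L}_{(n,* )} \neq 0$ for all $n\gg 0$. In the second case, $\delta$ is finite, and there exist $a_{\mathfrak{p}} \in \{ d_j : \delta \le j \le c \}$ and $b_1,b_2,b_{\mathfrak{p}} \in \mathbb{Z}$ such that (1) $\mathrm{indeg}\left( \mathscr{L}_{(n,* )} \right) = d_{\delta} \cdot n + b_1$ for all $n \gg 0$, (2) $v_{\mathfrak{p}}\left( \mathscr{L}_{(n,* )} \right) = a_{\mathfrak{p}} \cdot n + b_{\mathfrak{p}}$ for all $n \gg 0$, whenever $\mathfrak{p}\in\mathrm{Ass}_R\left(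 \mathscr{L}_{(n,* )} \right)$ for all $n\gg 0$, (3) $v\left( \mathscr{L}_{(n,* )} \right) = d_{\delta} \cdot n + b_2$ for all $n \gg 0$.
   Context: $T$ is a commutative ring, generated as an algebra over its degree-$(0,0)$ component $R_0$ by the listed homogeneous elements (not necessarily a polynomial ring), and $R$ is the subring generated over $R_0$ by the $x_i$. The infimum of the empty set is $\infty$. For a finitely generated $\mathbb{Z}$-graded $R$-module $L=\bigoplus_u L_u$: $\mathrm{indeg}(L) := \inf\{n : L_n\neq 0\}$, with $\mathrm{indeg}(0)=\infty$. For $\mathfrak{p}\in\mathrm{Ass}_R(L)$, the v-number of $L$ at $\mathfrak{p}$ is $v_{\mathfrak{p}}(L) := \inf\{ u : \text{there exists } x\in L_u \text{ such that } \mathfrak{p} = (0:_R x)\}$. The v-number of $L$ is $v(L) := \inf\{v_{\mathfrak{p}}(L) : \mathfrak{p}\in\mathrm{Ass}_R(L)\}$, with $v(0)=\infty$. *)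

theory Defs
  imports
    "HOL-Algebra.Algebra"
    "HOL-Library.Product_Plus"
    "HOL-Library.Extended_Nat"
    "HOL-Library.Extended_Real"
begin

section \<open>Graded rings and modules\<close>

text \<open>The additive group of \<open>G\<close> is the internal direct sum of the family \<open>A\<close>: every element has
  exactly one decomposition into finitely many nonzero components.\<close>

definition internal_direct_sum :: "('a, 'b) ring_scheme \<Rightarrow> ('i \<Rightarrow> 'a set) \<Rightarrow> bool" where
  "internal_direct_sum G A \<longleftrightarrow>
     (\<forall>i. additive_subgroup (A i) G) \<and>
     (\<forall>x\<in>carrier G. \<exists>!u. (\<forall>i. u i \<in> A i) \<and> finite {i. u i \<noteq> \<zero>\<^bsub>G\<^esub>} \<and>
        x = finsum G u {i. u i \<noteq> \<zero>\<^bsub>G\<^esub>})"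

locale graded_cring = cring R for R (structure) +
  fixes A :: "'i::ab_group_add \<Rightarrow> 'a set"
  assumes ring_decomp: "internal_direct_sum R A"
    and one_degree: "\<one> \<in> A 0"
    and mult_degree: "\<lbrakk>a \<in> A i; b \<in> A j\<rbrakk> \<Longrightarrow> a \<otimes> b \<in> A (i + j)"

locale graded_module = graded_cring R A + module R M
  for R (structure) and A :: "'i::ab_group_add \<Rightarrow> 'a set"
    and M :: "('a, 'm, 'n) module_scheme" (structure) +
  fixes B :: "'i \<Rightarrow> 'm set"
  assumes module_decomp: "internal_direct_sum M B"
    and smult_degree: "\<lbrakk>a \<in> A i; x \<in> B j\<rbrakk> \<Longrightarrow> a \<odot>\<^bsub>M\<^esub> x \<in> B (i + j)"

definition finitely_generated_module ::
    "('a, 'r) ring_scheme \<Rightarrow> ('a, 'm, 'n) module_scheme \<Rightarrow> bool" where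
  "finitely_generated_module R M \<longleftrightarrow>
     (\<exists>S \<subseteq> carrier M. finite S \<and> carrier M = \<Inter>{N. submodule N R M \<and> S \<subseteq> N})"

text \<open>The strand \<open>M\<^sub>(\<^sub>n\<^sub>,\<^sub>*\<^sub>)\<close>, i.e. the sum of all components of degree \<open>(n, l)\<close>; it keeps the operations
  of \<open>M\<close>, so it may be regarded as a module over any subring stabilizing it.\<close>

definition strand ::
    "('a, 'm, 'n) module_scheme \<Rightarrow> (int \<times> int \<Rightarrow> 'm set) \<Rightarrow> int \<Rightarrow> ('a, 'm, 'n) module_scheme" where
  "strand M B n = M\<lparr>carrier :=
     {finsum M u {l. u l \<noteq> \<zero>\<^bsub>M\<^esub>} | u. (\<forall>l. u l \<in> B (n, l)) \<and> finite {l. u l \<noteq> \<zero>\<^bsub>M\<^esub>}}\<rparr>"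

section \<open>Annihilators, radicals and associated primes\<close>

definition module_ann :: "('a, 'r) ring_scheme \<Rightarrow> ('a, 'm, 'n) module_scheme \<Rightarrow> 'a set" where
  "module_ann R M = {r \<in> carrier R. \<forall>x\<in>carrier M. r \<odot>\<^bsub>M\<^esub> x = \<zero>\<^bsub>M\<^esub>}"

definition elem_ann ::
    "('a, 'r) ring_scheme \<Rightarrow> ('a, 'm, 'n) module_scheme \<Rightarrow> 'm \<Rightarrow> 'a set" where
  "elem_ann R M x = {r \<in> carrier R. r \<odot>\<^bsub>M\<^esub> x = \<zero>\<^bsub>M\<^esub>}"

definition radical :: "('a, 'r) ring_scheme \<Rightarrow> 'a set \<Rightarrow> 'a set" where
  "radical R I = {r \<in> carrier R. \<exists>k::nat. r [^]\<^bsub>R\<^esub> k \<in> I}"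

definition Ass :: "('a, 'r) ring_scheme \<Rightarrow> ('a, 'm, 'n) module_scheme \<Rightarrow> 'a set set" where
  "Ass R M = {P. primeideal P R \<and> (\<exists>x\<in>carrier M. P = elem_ann R M x)}"

section \<open>Initial degree and v-numbers\<close>

text \<open>Infima of sets of integers are taken in the extended reals, so that the infimum of the empty
  set is \<open>\<infinity>\<close>. In all three definitions \<open>B\<close> is the \<open>\<int>\<close>-grading of the module.\<close>

definition indeg :: "('a, 'm, 'n) module_scheme \<Rightarrow> (int \<Rightarrow> 'm set) \<Rightarrow> ereal" where
  "indeg M B = (INF n\<in>{n. B n \<noteq> {\<zero>\<^bsub>M\<^esub>}}. ereal (real_of_int n))"

definition v_number_at ::
    "('a, 'r) ring_scheme \<Rightarrow> ('a, 'm, 'n) module_scheme \<Rightarrow> (int \<Rightarrow> 'm set) \<Rightarrow> 'a set \<Rightarrow> ereal" where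
  "v_number_at R M B P = (INF n\<in>{n. \<exists>x\<in>B n. P = elem_ann R M x}. ereal (real_of_int n))"

definition v_number ::
    "('a, 'r) ring_scheme \<Rightarrow> ('a, 'm, 'n) module_scheme \<Rightarrow> (int \<Rightarrow> 'm set) \<Rightarrow> ereal" where
  "v_number R M B = (INF P\<in>Ass R M. v_number_at R M B P)"

end

theory Submission
  imports Defs
begin

text \<open>Everything is read off from quotients \<open>Q = K / N\<close> of submodules of \<open>L\<close>: \<open>L\<close> itself for the
  initial degree, and for a prime \<open>P\<close> of \<open>R\<close> the \<open>R/P\<close>-module of elements of \<open>L\<close> killed by \<open>P\<close> modulo
  its torsion, whose nonzero elements are exactly the classes of those with annihilator \<open>P\<close>.
  Write \<open>Q\<^sub>n\<close> for the strand of \<open>Q\<close> at \<open>n\<close>. Since \<open>L\<close> is Noetherian, \<open>Q\<^bsub>n+1\<^esub>\<close> is generated by the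
  \<open>y\<^sub>j Q\<^bsub>n\<^esub>\<close> for large \<open>n\<close>, so every nonzero element comes from a long word in the \<open>y\<^sub>j\<close>
  in which the \<open>y\<^sub>j\<close> nilpotent on \<open>Q\<close> occur boundedly often.
  If \<open>D\<close> is the least degree of a \<open>y\<^sub>j\<close> not nilpotent on \<open>Q\<close>, this bounds \<open>l - D n\<close> from below on the
  support of \<open>Q\<close>, and for fixed \<open>e\<close> and large \<open>n\<close> the word must contain some \<open>y\<^sub>j\<close> of degree \<open>D\<close>;
  removing it shows that the nonvanishing of \<open>Q\<^bsub>(n, D n + e)\<^esub>\<close> is eventually constant in \<open>n\<close>.
  For the v-number itself one uses that only finitely many primes are associated and that iterating
  \<open>y\<^sub>\<delta>\<close> on a suitable element yields a prime whose slope is the least possible, \<open>d\<^sub>\<delta>\<close>.\<close>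

section \<open>Ascending chains and the Hilbert basis theorem\<close>

text \<open>Since \<open>T\<close> need not be a polynomial ring, nothing can be read off
  coefficients; all finiteness comes from chain conditions. They are stated for subsets stable under
  a set of scalars, so that \<open>L\<close> is regarded over \<open>R0\<close>, \<open>R\<close>
  and \<open>T\<close> in turn without changing its carrier. Quotients are never formed: a pair
  \<open>K\<close>, \<open>N\<close> stands for one, and a nonzero class is an element of
  \<open>K\<close> outside \<open>N\<close>. The delicate point for degrees is that multiplication
  by a \<open>y j\<close> may kill a class, so nonvanishing on a line \<open>l = D * n + e\<close>
  is not inherited upwards. It is inherited downwards for large \<open>n\<close>, which still leaves
  only two eventual behaviours for each \<open>e\<close>; and only finitely many intercepts lie
  between the lower bound and a line traced by powers of one \<open>y j\<close>. Two points concern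
  primes. Associated primes are annihilators of arbitrary elements while v-numbers ask for
  homogeneous ones, and the two must be matched. And \<open>L\<close> is in general not finitely
  generated over \<open>R\<close>, so finiteness of its associated primes is drawn from chains of
  \<open>T\<close>-submodules.\<close>

definition stable :: "('a, 'm, 'n) module_scheme \<Rightarrow> 'a set \<Rightarrow> 'm set \<Rightarrow> bool" where
  "stable M G N \<longleftrightarrow> N \<subseteq> carrier M \<and> \<zero>\<^bsub>M\<^esub> \<in> N \<and> (\<forall>x\<in>N. \<forall>y\<in>N. x \<oplus>\<^bsub>M\<^esub> y \<in> N) \<and>
     (\<forall>x\<in>N. \<ominus>\<^bsub>M\<^esub> x \<in> N) \<and> (\<forall>g\<in>G. \<forall>x\<in>N. g \<odot>\<^bsub>M\<^esub> x \<in> N)"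

text \<open>\<open>P\<close> bounds the chains. More scalars mean fewer stable sets, which is why
  the condition passes to larger \<open>G\<close> in \<open>acc_on_mono_scalars\<close>.\<close>

definition acc_on :: "('a, 'm, 'n) module_scheme \<Rightarrow> 'a set \<Rightarrow> 'm set \<Rightarrow> bool" where
  "acc_on M G P \<longleftrightarrow> (\<forall>f :: nat \<Rightarrow> 'm set.
     (\<forall>i. stable M G (f i) \<and> f i \<subseteq> P \<and> f i \<subseteq> f (Suc i)) \<longrightarrow> (\<exists>n. \<forall>m\<ge>n. f m = f n))"

lemma stableD:
  assumes "stable M G N"
  shows "N \<subseteq> carrier M" "\<zero>\<^bsub>M\<^esub> \<in> N" "\<And>x y. x \<in> N \<Longrightarrow> y \<in> N \<Longrightarrow> x \<oplus>\<^bsub>M\<^esub> y \<in> N"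
    "\<And>x. x \<in> N \<Longrightarrow> \<ominus>\<^bsub>M\<^esub> x \<in> N" "\<And>g x. g \<in> G \<Longrightarrow> x \<in> N \<Longrightarrow> g \<odot>\<^bsub>M\<^esub> x \<in> N"
    "\<And>x. x \<in> N \<Longrightarrow> x \<in> carrier M"
  using assms unfolding stable_def by auto

lemma stableI:
  assumes "N \<subseteq> carrier M" "\<zero>\<^bsub>M\<^esub> \<in> N" "\<And>x y. x \<in> N \<Longrightarrow> y \<in> N \<Longrightarrow> x \<oplus>\<^bsub>M\<^esub> y \<in> N"
    "\<And>x. x \<in> N \<Longrightarrow> \<ominus>\<^bsub>M\<^esub> x \<in> N" "\<And>g x. g \<in> G \<Longrightarrow> x \<in> N \<Longrightarrow> g \<odot>\<^bsub>M\<^esub> x \<in> N"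
  shows "stable M G N"
  using assms unfolding stable_def by auto

lemma stable_mono: "stable M G N \<Longrightarrow> H \<subseteq> G \<Longrightarrow> stable M H N"
  unfolding stable_def by blast

lemma acc_on_subset: "acc_on M G P \<Longrightarrow> Q \<subseteq> P \<Longrightarrow> acc_on M G Q"
  unfolding acc_on_def by (meson order_trans)

lemma acc_on_mono_scalars: "acc_on M G P \<Longrightarrow> G \<subseteq> H \<Longrightarrow> acc_on M H P"
  unfolding acc_on_def using stable_mono by (metis (no_types, lifting))

lemma chain_mono: "(\<And>i::nat. f i \<subseteq> f (Suc i)) \<Longrightarrow> i \<le> j \<Longrightarrow> f i \<subseteq> f j"
  by (rule lift_Suc_mono_le)

lemma acc_onD:
  assumes "acc_on M G P" "\<And>i. stable M G (f i)" "\<And>i. f i \<subseteq> P" "\<And>i. f i \<subseteq> f (Suc i)"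
  shows "\<exists>n :: nat. \<forall>m\<ge>n. f m = f n"
  using assms unfolding acc_on_def by simp

lemma acc_on_maximal:
  assumes acc: "acc_on M G P" and F: "\<And>N. N \<in> F \<Longrightarrow> stable M G N \<and> N \<subseteq> P" and ne: "F \<noteq> {}"
  shows "\<exists>N\<in>F. \<forall>N'\<in>F. N \<subseteq> N' \<longrightarrow> N' = N"
proof (rule ccontr)
  assume "\<not> ?thesis"
  then have *: "\<And>N. N \<in> F \<Longrightarrow> \<exists>N'. N' \<in> F \<and> N \<subset> N'" by blast
  obtain N0 where "N0 \<in> F" using ne by blast
  then obtain f where f: "\<And>i::nat. f i \<in> F \<and> f i \<subset> f (Suc i)"
    using dependent_nat_choice[of "\<lambda>_ N. N \<in> F" "\<lambda>_ N N'. N \<subset> N'"] * by metis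
  then have f': "stable M G (f i)" "f i \<subseteq> P" "f i \<subseteq> f (Suc i)" for i using F[of "f i"] by auto
  obtain n where "\<forall>m\<ge>n. f m = f n"
    using acc_onD[where f = f, OF acc f'] ..
  then have "f (Suc n) = f n" using le_SucI[OF order_refl] by blast
  then show False using f by blast
qed

section \<open>Stable subsets of a module, colons, and Hilbert's basis theorem for modules\<close>

context module
begin

lemma smult_left_commute:
  "a \<in> carrier R \<Longrightarrow> b \<in> carrier R \<Longrightarrow> x \<in> carrier M \<Longrightarrow> a \<odot>\<^bsub>M\<^esub> (b \<odot>\<^bsub>M\<^esub> x) = b \<odot>\<^bsub>M\<^esub> (a \<odot>\<^bsub>M\<^esub> x)"
  by (metis smult_assoc1 R.m_comm)

lemma stable_diff: "stable M G N \<Longrightarrow> x \<in> N \<Longrightarrow> y \<in> N \<Longrightarrow> x \<ominus>\<^bsub>M\<^esub> y \<in> N"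
  using stableD(3,4) by (metis M.minus_eq)

lemma stable_carrier: "G \<subseteq> carrier R \<Longrightarrow> stable M G (carrier M)"
  by (rule stableI) auto

lemma stable_zero: "G \<subseteq> carrier R \<Longrightarrow> stable M G {\<zero>\<^bsub>M\<^esub>}"
  by (rule stableI) auto

text \<open>The generated ring arises from \<open>G\<close> and \<open>\<one>\<close> by sums,
  negatives and products, each of which preserves stability. Submodules over \<open>Rc\<close> and
  \<open>T\<close> can therefore be tested on generators.\<close>

lemma stable_generate_ring:
  assumes N: "stable M G N" and G: "G \<subseteq> carrier R"
  shows "stable M (generate_ring R G) N"
proof (rule stableI)
  fix g x assume "g \<in> generate_ring R G" and x: "x \<in> N"
  then have "g \<in> carrier R \<and> (\<forall>x\<in>N. g \<odot>\<^bsub>M\<^esub> x \<in> N)"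
  proof (induction)
    case one then show ?case using stableD[OF N] by auto
  next
    case (incl h) then show ?case using stableD[OF N] G by auto
  next
    case (a_inv h) then show ?case using stableD[OF N] by (auto simp: smult_l_minus)
  next
    case (eng_add h1 h2) then show ?case using stableD[OF N] by (auto simp: smult_l_distr)
  next
    case (eng_mult h1 h2) then show ?case using stableD[OF N] by (auto simp: smult_assoc1)
  qed
  then show "g \<odot>\<^bsub>M\<^esub> x \<in> N" using x by blast
qed (use stableD[OF N] in auto)

lemma stable_submodule: "stable M (carrier R) N \<Longrightarrow> submodule N R M"
  by (rule submoduleI) (auto dest: stableD)

lemma stable_Int: "stable M G N \<Longrightarrow> stable M G N' \<Longrightarrow> stable M G (N \<inter> N')"
  unfolding stable_def by blast

text \<open>By commutativity, multiplication by \<open>a\<close> is linear over \<open>G\<close>.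
  Such colons turn the condition that a multiple of \<open>x\<close> avoids \<open>N\<close> into
  the condition that \<open>x\<close> itself avoids a stable set.\<close>

lemma stable_vimage:
  assumes N: "stable M G N" and a: "a \<in> carrier R" and G: "G \<subseteq> carrier R"
  shows "stable M G {x \<in> carrier M. a \<odot>\<^bsub>M\<^esub> x \<in> N}"
proof (rule stableI)
  fix g x assume "g \<in> G" "x \<in> {x \<in> carrier M. a \<odot>\<^bsub>M\<^esub> x \<in> N}"
  moreover from this have "a \<odot>\<^bsub>M\<^esub> (g \<odot>\<^bsub>M\<^esub> x) = g \<odot>\<^bsub>M\<^esub> (a \<odot>\<^bsub>M\<^esub> x)"
    using a G by (auto intro: smult_left_commute)
  ultimately show "g \<odot>\<^bsub>M\<^esub> x \<in> {x \<in> carrier M. a \<odot>\<^bsub>M\<^esub> x \<in> N}"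
    using G stableD[OF N] by auto
qed (use stableD[OF N] a in \<open>auto simp: smult_r_distr smult_r_minus\<close>)

text \<open>Elements of \<open>P[t]\<close> of degree less than \<open>k\<close>; distinct polynomials may have the same value.\<close>

fun poly_span :: "'a \<Rightarrow> 'c set \<Rightarrow> nat \<Rightarrow> 'c set" where
  "poly_span t P 0 = {\<zero>\<^bsub>M\<^esub>}"
| "poly_span t P (Suc k) = {(t [^] k) \<odot>\<^bsub>M\<^esub> p \<oplus>\<^bsub>M\<^esub> q | p q. p \<in> P \<and> q \<in> poly_span t P k}"

lemma poly_span_SucI:
  "p \<in> P \<Longrightarrow> q \<in> poly_span t P k \<Longrightarrow> (t [^] k) \<odot>\<^bsub>M\<^esub> p \<oplus>\<^bsub>M\<^esub> q \<in> poly_span t P (Suc k)"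
  by auto

context
  fixes G P t assumes P: "stable M G P" and t: "t \<in> carrier R" and G: "G \<subseteq> carrier R"
begin

lemma stable_poly_span: "stable M G (poly_span t P k)"
proof (induction k)
  case 0 then show ?case using stable_zero[OF G] by simp
next
  case (Suc k)
  note I = stableD[OF Suc] and P' = stableD[OF P]
  note c = P'(6) I(6) nat_pow_closed[OF t]
  show ?case
  proof (rule stableI)
    show "poly_span t P (Suc k) \<subseteq> carrier M" using c by auto
    have "(t [^] k) \<odot>\<^bsub>M\<^esub> \<zero>\<^bsub>M\<^esub> \<oplus>\<^bsub>M\<^esub> \<zero>\<^bsub>M\<^esub> \<in> poly_span t P (Suc k)"
      by (rule poly_span_SucI) (use P' I in auto)
    then show "\<zero>\<^bsub>M\<^esub> \<in> poly_span t P (Suc k)" using c by simp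
  next
    fix x y assume "x \<in> poly_span t P (Suc k)" "y \<in> poly_span t P (Suc k)"
    then obtain p q p' q' where x: "x = (t [^] k) \<odot>\<^bsub>M\<^esub> p \<oplus>\<^bsub>M\<^esub> q" "p \<in> P" "q \<in> poly_span t P k"
      and y: "y = (t [^] k) \<odot>\<^bsub>M\<^esub> p' \<oplus>\<^bsub>M\<^esub> q'" "p' \<in> P" "q' \<in> poly_span t P k"
      by auto
    have "x \<oplus>\<^bsub>M\<^esub> y = (t [^] k) \<odot>\<^bsub>M\<^esub> (p \<oplus>\<^bsub>M\<^esub> p') \<oplus>\<^bsub>M\<^esub> (q \<oplus>\<^bsub>M\<^esub> q')"
      using x y c by (simp add: smult_r_distr M.add.m_ac)
    then show "x \<oplus>\<^bsub>M\<^esub> y \<in> poly_span t P (Suc k)"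
      using poly_span_SucI x y P'(3) I(3) by metis
  next
    fix x assume "x \<in> poly_span t P (Suc k)"
    then obtain p q where x: "x = (t [^] k) \<odot>\<^bsub>M\<^esub> p \<oplus>\<^bsub>M\<^esub> q" "p \<in> P" "q \<in> poly_span t P k"
      by auto
    have "\<ominus>\<^bsub>M\<^esub> x = (t [^] k) \<odot>\<^bsub>M\<^esub> (\<ominus>\<^bsub>M\<^esub> p) \<oplus>\<^bsub>M\<^esub> (\<ominus>\<^bsub>M\<^esub> q)"
      using x c by (simp add: smult_r_minus M.minus_add)
    then show "\<ominus>\<^bsub>M\<^esub> x \<in> poly_span t P (Suc k)"
      using poly_span_SucI x P'(4) I(4) by metis
  next
    fix g x assume g: "g \<in> G" and "x \<in> poly_span t P (Suc k)"
    then obtain p q where x: "x = (t [^] k) \<odot>\<^bsub>M\<^esub> p \<oplus>\<^bsub>M\<^esub> q" "p \<in> P" "q \<in> poly_span t P k"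
      by auto
    have "g \<odot>\<^bsub>M\<^esub> x = (t [^] k) \<odot>\<^bsub>M\<^esub> (g \<odot>\<^bsub>M\<^esub> p) \<oplus>\<^bsub>M\<^esub> (g \<odot>\<^bsub>M\<^esub> q)"
      using x c g subsetD[OF G] by (simp add: smult_r_distr smult_left_commute[of g "t [^] k"])
    then show "g \<odot>\<^bsub>M\<^esub> x \<in> poly_span t P (Suc k)"
      using poly_span_SucI x P'(5) I(5) g by metis
  qed
qed

lemma poly_span_Suc_subset: "poly_span t P k \<subseteq> poly_span t P (Suc k)"
proof
  fix q assume q: "q \<in> poly_span t P k"
  then have "q \<in> carrier M" using stableD(6)[OF stable_poly_span] by blast
  then have "q = (t [^] k) \<odot>\<^bsub>M\<^esub> \<zero>\<^bsub>M\<^esub> \<oplus>\<^bsub>M\<^esub> q" using t by simp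
  then show "q \<in> poly_span t P (Suc k)" using poly_span_SucI q stableD(2)[OF P] by metis
qed

lemma poly_span_shift: "q \<in> poly_span t P k \<Longrightarrow> t \<odot>\<^bsub>M\<^esub> q \<in> poly_span t P (Suc k)"
proof (induction k arbitrary: q)
  case 0 then show ?case using t stableD(2)[OF stable_poly_span[of "Suc 0"]] by simp
next
  case (Suc k)
  then obtain p r where q: "q = (t [^] k) \<odot>\<^bsub>M\<^esub> p \<oplus>\<^bsub>M\<^esub> r" "p \<in> P" "r \<in> poly_span t P k" by auto
  have c: "p \<in> carrier M" "r \<in> carrier M" using q stableD(6)[OF P] stableD(6)[OF stable_poly_span] by auto
  have "t \<odot>\<^bsub>M\<^esub> q = (t [^] Suc k) \<odot>\<^bsub>M\<^esub> p \<oplus>\<^bsub>M\<^esub> t \<odot>\<^bsub>M\<^esub> r"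
    using q c t by (simp add: smult_r_distr smult_assoc1 smult_left_commute[of t "t [^] k"])
  then show ?case using poly_span_SucI q Suc.IH by metis
qed

text \<open>The coefficient modules of Hilbert's proof: top coefficients of elements of
  \<open>N\<close> at degree \<open>k\<close>. As representations are not unique, one representation
  with top coefficient \<open>p\<close> suffices.\<close>

definition leading :: "'c set \<Rightarrow> nat \<Rightarrow> 'c set" where
  "leading N k = {p \<in> P. \<exists>q\<in>poly_span t P k. (t [^] k) \<odot>\<^bsub>M\<^esub> p \<oplus>\<^bsub>M\<^esub> q \<in> N}"

lemma stable_leading:
  assumes N: "stable M G N"
  shows "stable M G (leading N k)"
proof (rule stableI)
  note I = stableD[OF stable_poly_span[of k]] and P' = stableD[OF P] and N' = stableD[OF N]
  note c = P'(6) I(6) nat_pow_closed[OF t]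
  show "leading N k \<subseteq> carrier M" using c by (auto simp: leading_def)
  have "(t [^] k) \<odot>\<^bsub>M\<^esub> \<zero>\<^bsub>M\<^esub> \<oplus>\<^bsub>M\<^esub> \<zero>\<^bsub>M\<^esub> = \<zero>\<^bsub>M\<^esub>" using c by simp
  then show "\<zero>\<^bsub>M\<^esub> \<in> leading N k" unfolding leading_def using P'(2) I(2) N'(2) by force
  fix p assume "p \<in> leading N k"
  then obtain q where p: "p \<in> P" "q \<in> poly_span t P k" "(t [^] k) \<odot>\<^bsub>M\<^esub> p \<oplus>\<^bsub>M\<^esub> q \<in> N"
    unfolding leading_def by auto
  have "\<ominus>\<^bsub>M\<^esub> ((t [^] k) \<odot>\<^bsub>M\<^esub> p \<oplus>\<^bsub>M\<^esub> q) = (t [^] k) \<odot>\<^bsub>M\<^esub> (\<ominus>\<^bsub>M\<^esub> p) \<oplus>\<^bsub>M\<^esub> (\<ominus>\<^bsub>M\<^esub> q)"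
    using p c by (simp add: smult_r_minus M.minus_add)
  then have "(t [^] k) \<odot>\<^bsub>M\<^esub> (\<ominus>\<^bsub>M\<^esub> p) \<oplus>\<^bsub>M\<^esub> (\<ominus>\<^bsub>M\<^esub> q) \<in> N" using N'(4) p by metis
  then show "\<ominus>\<^bsub>M\<^esub> p \<in> leading N k" unfolding leading_def using P'(4) I(4) p by blast
  { fix g assume g: "g \<in> G"
    have "g \<odot>\<^bsub>M\<^esub> ((t [^] k) \<odot>\<^bsub>M\<^esub> p \<oplus>\<^bsub>M\<^esub> q) = (t [^] k) \<odot>\<^bsub>M\<^esub> (g \<odot>\<^bsub>M\<^esub> p) \<oplus>\<^bsub>M\<^esub> (g \<odot>\<^bsub>M\<^esub> q)"
      using p c g subsetD[OF G] by (simp add: smult_r_distr smult_left_commute[of g "t [^] k"])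
    then have "(t [^] k) \<odot>\<^bsub>M\<^esub> (g \<odot>\<^bsub>M\<^esub> p) \<oplus>\<^bsub>M\<^esub> (g \<odot>\<^bsub>M\<^esub> q) \<in> N" using N'(5) p g by metis
    then show "g \<odot>\<^bsub>M\<^esub> p \<in> leading N k" unfolding leading_def using P'(5) I(5) p g by blast }
  fix p' assume "p' \<in> leading N k"
  then obtain q' where p': "p' \<in> P" "q' \<in> poly_span t P k" "(t [^] k) \<odot>\<^bsub>M\<^esub> p' \<oplus>\<^bsub>M\<^esub> q' \<in> N"
    unfolding leading_def by auto
  have "((t [^] k) \<odot>\<^bsub>M\<^esub> p \<oplus>\<^bsub>M\<^esub> q) \<oplus>\<^bsub>M\<^esub> ((t [^] k) \<odot>\<^bsub>M\<^esub> p' \<oplus>\<^bsub>M\<^esub> q') =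
      (t [^] k) \<odot>\<^bsub>M\<^esub> (p \<oplus>\<^bsub>M\<^esub> p') \<oplus>\<^bsub>M\<^esub> (q \<oplus>\<^bsub>M\<^esub> q')"
    using p p' c by (simp add: smult_r_distr M.add.m_ac)
  then have "(t [^] k) \<odot>\<^bsub>M\<^esub> (p \<oplus>\<^bsub>M\<^esub> p') \<oplus>\<^bsub>M\<^esub> (q \<oplus>\<^bsub>M\<^esub> q') \<in> N" using N'(3) p p' by metis
  then show "p \<oplus>\<^bsub>M\<^esub> p' \<in> leading N k" unfolding leading_def using P'(3) I(3) p p' by blast
qed

text \<open>Multiplication by \<open>t\<close> raises the degree by one and keeps the top
  coefficient.\<close>

lemma leading_Suc:
  assumes N: "stable M (insert t G) N"
  shows "leading N k \<subseteq> leading N (Suc k)"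
proof
  fix p assume "p \<in> leading N k"
  then obtain q where p: "p \<in> P" "q \<in> poly_span t P k" "(t [^] k) \<odot>\<^bsub>M\<^esub> p \<oplus>\<^bsub>M\<^esub> q \<in> N"
    unfolding leading_def by auto
  have c: "p \<in> carrier M" "q \<in> carrier M" using p stableD(6)[OF P] stableD(6)[OF stable_poly_span] by auto
  have "t \<odot>\<^bsub>M\<^esub> ((t [^] k) \<odot>\<^bsub>M\<^esub> p \<oplus>\<^bsub>M\<^esub> q) = (t [^] Suc k) \<odot>\<^bsub>M\<^esub> p \<oplus>\<^bsub>M\<^esub> t \<odot>\<^bsub>M\<^esub> q"
    using c t by (simp add: smult_r_distr smult_assoc1 smult_left_commute[of t "t [^] k"])
  then have "(t [^] Suc k) \<odot>\<^bsub>M\<^esub> p \<oplus>\<^bsub>M\<^esub> t \<odot>\<^bsub>M\<^esub> q \<in> N" using stableD(5)[OF N] p by (metis insertI1)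
  then show "p \<in> leading N (Suc k)" unfolding leading_def using p poly_span_shift by blast
qed

text \<open>Induction on the degree: an element of \<open>N'\<close> is matched with one of
  \<open>N\<close> having the same top coefficient, and the difference lies in \<open>N'\<close>
  with smaller degree.\<close>

lemma leading_eq_imp_eq:
  assumes N: "stable M G N" and N': "stable M G N'" and sub: "N \<subseteq> N'" "N' \<subseteq> (\<Union>k. poly_span t P k)"
    and eq: "\<And>k. leading N' k = leading N k"
  shows "N' = N"
proof -
  have "x \<in> N' \<Longrightarrow> x \<in> poly_span t P k \<Longrightarrow> x \<in> N" for x k
  proof (induction k arbitrary: x)
    case 0 then show ?case using stableD(2)[OF N] by simp
  next
    case (Suc k)
    then obtain p q where x: "x = (t [^] k) \<odot>\<^bsub>M\<^esub> p \<oplus>\<^bsub>M\<^esub> q" "p \<in> P" "q \<in> poly_span t P k" by auto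
    then have "p \<in> leading N' k" using Suc.prems unfolding leading_def by blast
    then obtain r where r: "r \<in> poly_span t P k" "(t [^] k) \<odot>\<^bsub>M\<^esub> p \<oplus>\<^bsub>M\<^esub> r \<in> N"
      unfolding eq unfolding leading_def by blast
    define y where "y = (t [^] k) \<odot>\<^bsub>M\<^esub> p \<oplus>\<^bsub>M\<^esub> r"
    have c: "p \<in> carrier M" "q \<in> carrier M" "r \<in> carrier M"
      using x r stableD(6)[OF P] stableD(6)[OF stable_poly_span] by auto
    have [simp]: "(t [^] k) \<odot>\<^bsub>M\<^esub> p \<in> carrier M" using c t by simp
    \<comment> \<open>Both elements were given the very same \<open>p\<close>, so the top terms
      cancel although representations are not unique.\<close>
    have xy: "x \<ominus>\<^bsub>M\<^esub> y = q \<ominus>\<^bsub>M\<^esub> r"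
      unfolding x y_def M.minus_eq using c
      by (simp add: M.minus_add M.add.m_ac M.r_neg1 M.r_neg)
    have "x \<ominus>\<^bsub>M\<^esub> y \<in> N'" using stable_diff[OF N'] Suc.prems(1) r sub y_def by blast
    moreover have "q \<ominus>\<^bsub>M\<^esub> r \<in> poly_span t P k" using stable_diff[OF stable_poly_span] x r by blast
    ultimately have "x \<ominus>\<^bsub>M\<^esub> y \<in> N" using Suc.IH xy by simp
    then have "(x \<ominus>\<^bsub>M\<^esub> y) \<oplus>\<^bsub>M\<^esub> y \<in> N" using r y_def stableD(3)[OF N] by blast
    moreover have "(x \<ominus>\<^bsub>M\<^esub> y) \<oplus>\<^bsub>M\<^esub> y = x"
      unfolding M.minus_eq using x c by (simp add: M.add.m_assoc y_def M.l_neg)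
    ultimately show ?case by simp
  qed
  then show ?thesis using sub by blast
qed

text \<open>\<open>leading\<close> grows both with the stage of the chain and with the degree. Its
  diagonal therefore settles all large degrees at once, and only finitely many small degrees remain,
  each with its own chain.\<close>

lemma hilbert_basis_step:
  assumes acc: "acc_on M G P"
  shows "acc_on M (insert t G) (\<Union>k. poly_span t P k)"
  unfolding acc_on_def
proof (intro allI impI)
  fix f :: "nat \<Rightarrow> 'c set"
  assume f: "\<forall>i. stable M (insert t G) (f i) \<and> f i \<subseteq> (\<Union>k. poly_span t P k) \<and> f i \<subseteq> f (Suc i)"
  have fG: "stable M G (f i)" for i using f stable_mono by blast
  have fm: "i \<le> j \<Longrightarrow> f i \<subseteq> f j" for i j by (rule chain_mono) (use f in auto)
  have l1: "leading (f i) k \<subseteq> leading (f j) k" if "i \<le> j" for i j k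
    using fm[OF that] unfolding leading_def by blast
  have l2: "leading (f i) k \<subseteq> leading (f i) m" if "k \<le> m" for i k m
    by (rule chain_mono[OF _ that]) (use leading_Suc f in blast)
  have P': "leading N k \<subseteq> P" for N k unfolding leading_def by blast
  have l3: "leading (f i) i \<subseteq> leading (f (Suc i)) (Suc i)" for i
    using l1[of i "Suc i" i] l2[of i "Suc i" "Suc i"] by simp
  obtain n where n: "\<And>m. m \<ge> n \<Longrightarrow> leading (f m) m = leading (f n) n"
    using acc_onD[where f = "\<lambda>i. leading (f i) i", OF acc stable_leading[OF fG] P' l3] by blast
  have "\<exists>n. \<forall>m\<ge>n. leading (f m) k = leading (f n) k" for k
    by (rule acc_onD[where f = "\<lambda>i. leading (f i) k", OF acc stable_leading[OF fG] P' l1]) simp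
  then obtain s where s: "\<And>k m. m \<ge> s k \<Longrightarrow> leading (f m) k = leading (f (s k)) k" by metis
  \<comment> \<open>\<open>n\<close> takes care of the degrees above \<open>n\<close>, and
    \<open>s k\<close> of each single degree \<open>k \<le> n\<close>.\<close>
  define u where "u = Max (insert n (s ` {..n}))"
  have un: "n \<le> u" and us: "k \<le> n \<Longrightarrow> s k \<le> u" for k
    unfolding u_def by (rule Max_ge; simp)+
  have "f m = f u" if m: "m \<ge> u" for m
  proof (rule leading_eq_imp_eq[OF fG fG fm[OF m]])
    show "f m \<subseteq> (\<Union>k. poly_span t P k)" using f by blast
    fix k show "leading (f m) k = leading (f u) k"
    proof (cases "k \<le> n")
      case True then show ?thesis using s us m by (metis order_trans)
    next
      case False
      \<comment> \<open>\<open>w\<close> dominates both the stage and the degree, so the set in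
        question is squeezed between two equal diagonal values.\<close>
      define w where "w = max k m"
      have "leading (f i) k = leading (f n) n" if "i \<ge> n" "i \<le> m" for i
      proof
        have w: "i \<le> w" "k \<le> w" "n \<le> w" using that unfolding w_def by auto
        have "leading (f i) k \<subseteq> leading (f w) w" using l1[OF w(1)] l2[OF w(2)] by blast
        then show "leading (f i) k \<subseteq> leading (f n) n" using n[OF w(3)] by simp
        show "leading (f n) n \<subseteq> leading (f i) k"
          using l1[of n i n] l2[of n k i] that False by auto
      qed
      then show ?thesis using m un by auto
    qed
  qed
  then show "\<exists>n. \<forall>m\<ge>n. f m = f n" by blast
qed

lemma stable_Union_poly_span: "stable M (insert t G) (\<Union>k. poly_span t P k)"
proof -
  have mono: "i \<le> j \<Longrightarrow> poly_span t P i \<subseteq> poly_span t P j" for i j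
    by (rule chain_mono) (rule poly_span_Suc_subset)
  show ?thesis
  proof (rule stableI)
    fix x y assume "x \<in> (\<Union>k. poly_span t P k)" "y \<in> (\<Union>k. poly_span t P k)"
    then obtain i j where "x \<in> poly_span t P i" "y \<in> poly_span t P j" by blast
    then have "x \<in> poly_span t P (max i j)" "y \<in> poly_span t P (max i j)"
      using mono[of i "max i j"] mono[of j "max i j"] by auto
    then show "x \<oplus>\<^bsub>M\<^esub> y \<in> (\<Union>k. poly_span t P k)" using stableD(3)[OF stable_poly_span] by blast
  next
    fix g x assume "g \<in> insert t G" "x \<in> (\<Union>k. poly_span t P k)"
    then show "g \<odot>\<^bsub>M\<^esub> x \<in> (\<Union>k. poly_span t P k)"
      using poly_span_shift stableD(5)[OF stable_poly_span] by blast
  qed (use stableD(2,4,6)[OF stable_poly_span] in auto)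
qed

lemma poly_span_base: "P \<subseteq> (\<Union>k. poly_span t P k)"
proof
  fix p assume p: "p \<in> P"
  then have "p = (t [^] (0::nat)) \<odot>\<^bsub>M\<^esub> p \<oplus>\<^bsub>M\<^esub> \<zero>\<^bsub>M\<^esub>" using stableD(6)[OF P] by simp
  then have "p \<in> poly_span t P (Suc 0)" using p poly_span_SucI[of p P "\<zero>\<^bsub>M\<^esub>" t 0] by simp
  then show "p \<in> (\<Union>k. poly_span t P k)" by blast
qed

end

text \<open>Only \<open>P \<subseteq> P'\<close> and stability are recorded: once \<open>P\<close>
  contains generators of a module, stability alone forces \<open>P'\<close> to be
  everything.\<close>

lemma hilbert_basis:
  assumes "finite S" "S \<subseteq> carrier R" "G \<subseteq> carrier R" "stable M G P" "acc_on M G P"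
  obtains P' where "P \<subseteq> P'" "stable M (G \<union> S) P'" "acc_on M (G \<union> S) P'"
proof -
  have "\<exists>P'. P \<subseteq> P' \<and> stable M (G \<union> S) P' \<and> acc_on M (G \<union> S) P'"
    using assms(1,2)
  proof (induction S)
    case empty then show ?case using assms by auto
  next
    case (insert t S)
    then obtain P' where P': "P \<subseteq> P'" "stable M (G \<union> S) P'" "acc_on M (G \<union> S) P'" by auto
    have t: "t \<in> carrier R" and GX: "G \<union> S \<subseteq> carrier R" using insert assms by auto
    have "P \<subseteq> (\<Union>k. poly_span t P' k)" using poly_span_base[OF P'(2) t GX] P'(1) by blast
    then show ?case
      using stable_Union_poly_span[OF P'(2) t GX] hilbert_basis_step[OF P'(2) t GX P'(3)]
      by auto
  qed
  then show thesis using that by blast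
qed

end

section \<open>The ring as a module over itself, and Noetherian coefficients\<close>

definition regular_module :: "('a, 'r) ring_scheme \<Rightarrow> ('a, 'a) module" where
  "regular_module R = \<lparr>carrier = carrier R, monoid.mult = monoid.mult R, one = \<one>\<^bsub>R\<^esub>,
     ring.zero = \<zero>\<^bsub>R\<^esub>, add = add R, smult = monoid.mult R\<rparr>"

lemma regular_module_simps [simp]:
  "carrier (regular_module R) = carrier R" "monoid.mult (regular_module R) = monoid.mult R"
  "\<one>\<^bsub>regular_module R\<^esub> = \<one>\<^bsub>R\<^esub>" "\<zero>\<^bsub>regular_module R\<^esub> = \<zero>\<^bsub>R\<^esub>"
  "add (regular_module R) = add R" "smult (regular_module R) = monoid.mult R"
  "a_inv (regular_module R) = a_inv R" "finsum (regular_module R) = finsum R"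
  by (auto simp: regular_module_def a_inv_def finsum_def m_inv_def finprod_def fun_eq_iff)

lemma (in cring) module_regular: "module R (regular_module R)"
proof (rule moduleI)
  show "abelian_group (regular_module R)"
    by (rule abelian_groupI) (auto simp: a_ac intro!: bexI[of _ "\<ominus> _"] l_neg)
qed (auto simp: l_distr r_distr m_assoc is_cring)

text \<open>Subsets of \<open>H\<close> stable under \<open>H\<close> are ideals of the subring with
  carrier \<open>H\<close>. The Noetherian property enters in the form that a nonempty chain of
  ideals contains its union.\<close>

lemma noetherian_acc_on:
  assumes T: "cring T" and noeth: "noetherian_ring (T\<lparr>carrier := H\<rparr>)" and H: "H \<subseteq> carrier T"
  shows "acc_on (regular_module T) H H"
  unfolding acc_on_def
proof (intro allI impI)
  fix f :: "nat \<Rightarrow> 'a set"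
  assume f: "\<forall>i. stable (regular_module T) H (f i) \<and> f i \<subseteq> H \<and> f i \<subseteq> f (Suc i)"
  interpret T: cring T by fact
  let ?Q = "T\<lparr>carrier := H\<rparr>"
  interpret Q: noetherian_ring ?Q by fact
  have "ideal (f i) ?Q" for i
  proof (rule idealI)
    have s: "stable (regular_module T) H (f i)" and sub: "f i \<subseteq> H" using f by auto
    note s = stableD[OF s, simplified]
    \<comment> \<open>The additive inverse is defined by a description over the carrier, so its
      value in the restricted ring has to be compared with the one in \<open>T\<close>.\<close>
    have inv: "\<ominus>\<^bsub>?Q\<^esub> x = \<ominus>\<^bsub>T\<^esub> x" if x: "x \<in> f i" for x
    proof -
      have "\<ominus>\<^bsub>T\<^esub> x \<in> H" "x \<in> H" "\<ominus>\<^bsub>T\<^esub> x \<oplus>\<^bsub>?Q\<^esub> x = \<zero>\<^bsub>?Q\<^esub>" using s x sub by (auto simp: T.l_neg)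
      then show ?thesis using Q.minus_equality by simp
    qed
    show "subgroup (f i) (add_monoid ?Q)"
    proof (rule group.subgroupI)
      fix x assume "x \<in> f i"
      then show "inv\<^bsub>add_monoid ?Q\<^esub> x \<in> f i" using inv s(4) unfolding a_inv_def[symmetric] by simp
    qed (use s sub Q.a_group in auto)
    fix a x assume ax: "a \<in> f i" "x \<in> carrier ?Q"
    then show "x \<otimes>\<^bsub>?Q\<^esub> a \<in> f i" using s by simp
    then show "a \<otimes>\<^bsub>?Q\<^esub> x \<in> f i" using ax s(6)[of a] H T.m_comm[of a x] by auto
  qed (rule Q.ring_axioms)
  moreover have mono: "i \<le> j \<Longrightarrow> f i \<subseteq> f j" for i j by (rule chain_mono) (use f in auto)
  ultimately have "subset.chain {I. ideal I ?Q} (range f)"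
    unfolding subset_chain_def by (auto, meson nat_le_linear subsetD)
  then have "\<Union>(range f) \<in> range f" using Q.ideal_chain_is_trivial[of "range f"] by simp
  then obtain n where "\<Union>(range f) = f n" by blast
  then have "\<forall>m\<ge>n. f m = f n" using mono by blast
  then show "\<exists>n. \<forall>m\<ge>n. f m = f n" by blast
qed

context module
begin

text \<open>The usual argument for extensions: a chain below the span of \<open>m\<close> and
  \<open>P\<close> is controlled by the ideals of its coefficients at \<open>m\<close> together with
  its traces on \<open>P\<close>.\<close>

lemma acc_on_adjoin:
  assumes R0: "R0 \<subseteq> carrier R" "stable (regular_module R) R0 R0" "\<one> \<in> R0"
    and acc0: "acc_on (regular_module R) R0 R0"
    and P: "stable M R0 P" "acc_on M R0 P" and m: "m \<in> carrier M"
  obtains P' where "insert m P \<subseteq> P'" "stable M R0 P'" "acc_on M R0 P'"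
proof -
  note r = stableD[OF R0(2), simplified] and p = stableD[OF P(1)]
  define P' where "P' = {a \<odot>\<^bsub>M\<^esub> m \<oplus>\<^bsub>M\<^esub> q | a q. a \<in> R0 \<and> q \<in> P}"
  have "\<one> \<odot>\<^bsub>M\<^esub> m \<oplus>\<^bsub>M\<^esub> \<zero>\<^bsub>M\<^esub> = m" "\<And>q. q \<in> P \<Longrightarrow> \<zero> \<odot>\<^bsub>M\<^esub> m \<oplus>\<^bsub>M\<^esub> q = q" using m p by auto
  then have sub: "insert m P \<subseteq> P'" unfolding P'_def using r(2) p(2) R0(3) by (smt (verit) insert_iff mem_Collect_eq subsetI)
  have add: "(a \<odot>\<^bsub>M\<^esub> m \<oplus>\<^bsub>M\<^esub> q) \<oplus>\<^bsub>M\<^esub> (b \<odot>\<^bsub>M\<^esub> m \<oplus>\<^bsub>M\<^esub> q') = (a \<oplus> b) \<odot>\<^bsub>M\<^esub> m \<oplus>\<^bsub>M\<^esub> (q \<oplus>\<^bsub>M\<^esub> q')"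
    if "a \<in> R0" "b \<in> R0" "q \<in> P" "q' \<in> P" for a b q q'
    using that r(6) p(6) m by (simp add: smult_l_distr M.add.m_ac)
  have neg: "\<ominus>\<^bsub>M\<^esub> (a \<odot>\<^bsub>M\<^esub> m \<oplus>\<^bsub>M\<^esub> q) = (\<ominus> a) \<odot>\<^bsub>M\<^esub> m \<oplus>\<^bsub>M\<^esub> (\<ominus>\<^bsub>M\<^esub> q)" if "a \<in> R0" "q \<in> P" for a q
    using that r(6) p(6) m by (simp add: smult_l_minus M.minus_add)
  have smul: "g \<odot>\<^bsub>M\<^esub> (a \<odot>\<^bsub>M\<^esub> m \<oplus>\<^bsub>M\<^esub> q) = (g \<otimes> a) \<odot>\<^bsub>M\<^esub> m \<oplus>\<^bsub>M\<^esub> (g \<odot>\<^bsub>M\<^esub> q)"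
    if "a \<in> R0" "q \<in> P" "g \<in> R0" for a q g
    using that r(6) p(6) m by (simp add: smult_r_distr smult_assoc1)
  have st: "stable M R0 P'"
  proof (rule stableI)
    show "P' \<subseteq> carrier M" unfolding P'_def using r(6) p(6) m by auto
    show "\<zero>\<^bsub>M\<^esub> \<in> P'" using sub p by auto
  next
    fix x y assume "x \<in> P'" "y \<in> P'"
    then show "x \<oplus>\<^bsub>M\<^esub> y \<in> P'" unfolding P'_def using r(3) p(3) add by (smt (verit) mem_Collect_eq)
  next
    fix x assume "x \<in> P'"
    then show "\<ominus>\<^bsub>M\<^esub> x \<in> P'" unfolding P'_def using r(4) p(4) neg by (smt (verit) mem_Collect_eq)
  next
    fix g x assume "g \<in> R0" "x \<in> P'"
    then show "g \<odot>\<^bsub>M\<^esub> x \<in> P'" unfolding P'_def using r(5) p(5) smul by (smt (verit) mem_Collect_eq)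
  qed
  have "acc_on M R0 P'"
    unfolding acc_on_def
  proof (intro allI impI)
    fix f :: "nat \<Rightarrow> 'c set"
    assume f: "\<forall>i. stable M R0 (f i) \<and> f i \<subseteq> P' \<and> f i \<subseteq> f (Suc i)"
    have fs: "stable M R0 (f i)" and fP: "f i \<subseteq> P'" for i using f by auto
    have mono: "i \<le> j \<Longrightarrow> f i \<subseteq> f j" for i j by (rule chain_mono) (use f in auto)
    \<comment> \<open>The coefficient at \<open>m\<close> is not unique, so \<open>g i\<close>
      collects every one that occurs in some representation; this is still an ideal of
      \<open>R0\<close>.\<close>
    define g where "g i = {a \<in> R0. \<exists>q\<in>P. a \<odot>\<^bsub>M\<^esub> m \<oplus>\<^bsub>M\<^esub> q \<in> f i}" for i
    have gs: "stable (regular_module R) R0 (g i)" for i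
    proof (rule stableI, simp_all)
      note s = stableD[OF fs[of i]]
      show "g i \<subseteq> carrier R" unfolding g_def using R0 by auto
      have "\<zero> \<odot>\<^bsub>M\<^esub> m \<oplus>\<^bsub>M\<^esub> \<zero>\<^bsub>M\<^esub> \<in> f i" using m s by simp
      then show "\<zero> \<in> g i" unfolding g_def using r(2) p(2) by blast
    next
      note s = stableD[OF fs[of i]]
      fix a b assume "a \<in> g i" "b \<in> g i"
      then obtain q q' where "a \<in> R0" "b \<in> R0" "q \<in> P" "q' \<in> P"
        "a \<odot>\<^bsub>M\<^esub> m \<oplus>\<^bsub>M\<^esub> q \<in> f i" "b \<odot>\<^bsub>M\<^esub> m \<oplus>\<^bsub>M\<^esub> q' \<in> f i" unfolding g_def by blast
      then show "a \<oplus> b \<in> g i" unfolding g_def using add s(3) r(3) p(3) by (smt (verit) mem_Collect_eq)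
    next
      note s = stableD[OF fs[of i]]
      fix a assume "a \<in> g i"
      then obtain q where q: "a \<in> R0" "q \<in> P" "a \<odot>\<^bsub>M\<^esub> m \<oplus>\<^bsub>M\<^esub> q \<in> f i" unfolding g_def by blast
      then show "\<ominus> a \<in> g i" unfolding g_def using neg s(4) r(4) p(4) by (smt (verit) mem_Collect_eq)
      fix c assume "c \<in> R0"
      then show "c \<otimes> a \<in> g i" unfolding g_def using q smul s(5) r(5) p(5) by (smt (verit) mem_Collect_eq)
    qed
    have g': "g i \<subseteq> R0" "g i \<subseteq> g (Suc i)" for i using f unfolding g_def by blast+
    obtain n where n: "\<forall>k\<ge>n. g k = g n"
      using acc_onD[where f = g, OF acc0 gs g'] ..
    have h: "stable M R0 (f i \<inter> P)" "f i \<inter> P \<subseteq> P" "f i \<inter> P \<subseteq> f (Suc i) \<inter> P" for i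
      using f stable_Int[OF _ P(1)] by auto
    obtain n' where n': "\<forall>k\<ge>n'. f k \<inter> P = f n' \<inter> P"
      using acc_onD[where f = "\<lambda>i. f i \<inter> P", OF P(2) h] ..
    define u where "u = max n n'"
    have "f k = f u" if k: "k \<ge> u" for k
    proof
      show "f u \<subseteq> f k" by (rule mono) fact
      show "f k \<subseteq> f u"
      proof
        fix x assume x: "x \<in> f k"
        then obtain a q where aq: "x = a \<odot>\<^bsub>M\<^esub> m \<oplus>\<^bsub>M\<^esub> q" "a \<in> R0" "q \<in> P" using fP unfolding P'_def by blast
        then have "a \<in> g k" using x unfolding g_def by blast
        moreover have "g k = g n" "g u = g n" using n k unfolding u_def by (meson max.bounded_iff max.cobounded1)+
        ultimately obtain q' where q': "q' \<in> P" "a \<odot>\<^bsub>M\<^esub> m \<oplus>\<^bsub>M\<^esub> q' \<in> f u" unfolding g_def by blast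
        \<comment> \<open>\<open>y\<close> shares the coefficient \<open>a\<close> with
          \<open>x\<close>, so the difference falls into the trace on \<open>P\<close>, which no
          longer changes after \<open>u\<close>.\<close>
        define y where "y = a \<odot>\<^bsub>M\<^esub> m \<oplus>\<^bsub>M\<^esub> q'"
        have c: "a \<odot>\<^bsub>M\<^esub> m \<in> carrier M" "q \<in> carrier M" "q' \<in> carrier M" using aq q' r p m by auto
        have xy: "x \<ominus>\<^bsub>M\<^esub> y = q \<ominus>\<^bsub>M\<^esub> q'"
          unfolding aq y_def M.minus_eq using c
          by (simp add: M.minus_add M.add.m_ac M.r_neg1 M.r_neg)
        have "x \<ominus>\<^bsub>M\<^esub> y \<in> f k" using stable_diff[OF fs] x q' mono[OF k] y_def by blast
        moreover have "x \<ominus>\<^bsub>M\<^esub> y \<in> P" unfolding xy using stable_diff[OF P(1)] aq q' by blast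
        ultimately have "x \<ominus>\<^bsub>M\<^esub> y \<in> f u"
          using n' k unfolding u_def by (metis IntD1 IntI max.bounded_iff max.cobounded2)
        then have "(x \<ominus>\<^bsub>M\<^esub> y) \<oplus>\<^bsub>M\<^esub> y \<in> f u" using q' y_def stableD(3)[OF fs] by blast
        moreover have "(x \<ominus>\<^bsub>M\<^esub> y) \<oplus>\<^bsub>M\<^esub> y = x"
          unfolding M.minus_eq using aq c by (simp add: M.add.m_assoc y_def M.l_neg)
        ultimately show "x \<in> f u" by simp
      qed
    qed
    then show "\<exists>n. \<forall>m\<ge>n. f m = f n" by blast
  qed
  then show thesis using that sub st by blast
qed

lemma acc_on_finite_span:
  assumes R0: "R0 \<subseteq> carrier R" "stable (regular_module R) R0 R0" "\<one> \<in> R0"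
    and acc0: "acc_on (regular_module R) R0 R0"
    and F: "finite F" "F \<subseteq> carrier M"
  obtains P where "F \<subseteq> P" "stable M R0 P" "acc_on M R0 P"
proof -
  have "\<exists>P. F \<subseteq> P \<and> stable M R0 P \<and> acc_on M R0 P"
    using F
  proof (induction F)
    case empty
    have "acc_on M R0 {\<zero>\<^bsub>M\<^esub>}" unfolding acc_on_def using stableD(2) by blast
    then show ?case using stable_zero[OF R0(1)] by blast
  next
    case (insert m F)
    then obtain P where P: "F \<subseteq> P" "stable M R0 P" "acc_on M R0 P" by auto
    obtain P' where "insert m P \<subseteq> P'" "stable M R0 P'" "acc_on M R0 P'"
      using acc_on_adjoin[OF R0 acc0 P(2,3), of m] insert.prems by blast
    then show ?case using P by blast
  qed
  then show thesis using that by blast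
qed

end

section \<open>Homogeneous components\<close>

lemma (in abelian_monoid) finsum_single:
  assumes "finite F" "i \<in> F" "f \<in> F \<rightarrow> carrier G" "\<And>j. j \<in> F \<Longrightarrow> j \<noteq> i \<Longrightarrow> f j = \<zero>"
  shows "finsum G f F = f i"
proof -
  have "finsum G f F = finsum G f {i}"
    by (rule add.finprod_mono_neutral_cong_right) (use assms in auto)
  then show ?thesis using assms by (simp add: finsum_insert Pi_def)
qed

lemma (in abelian_monoid) finsum_eq_zero: "(\<And>i. i \<in> F \<Longrightarrow> f i = \<zero>) \<Longrightarrow> finsum G f F = \<zero>"
  by (rule add.finprod_one_eqI)

definition component :: "('a, 'b) ring_scheme \<Rightarrow> ('i \<Rightarrow> 'a set) \<Rightarrow> 'a \<Rightarrow> 'i \<Rightarrow> 'a" where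
  "component G A x = (THE u. (\<forall>i. u i \<in> A i) \<and> finite {i. u i \<noteq> \<zero>\<^bsub>G\<^esub>} \<and>
     x = finsum G u {i. u i \<noteq> \<zero>\<^bsub>G\<^esub>})"

text \<open>Only the additive structure is involved, so the same facts serve the grading of
  \<open>T\<close> and that of \<open>L\<close>.\<close>

locale direct_sum_group = abelian_group G for G (structure) +
  fixes A :: "'i \<Rightarrow> 'a set"
  assumes direct_sum: "internal_direct_sum G A"
begin

abbreviation "cp \<equiv> component G A"
abbreviation "supp x \<equiv> {i. cp x i \<noteq> \<zero>}"

lemma summand_subgroup: "additive_subgroup (A i) G"
  using direct_sum unfolding internal_direct_sum_def by blast

lemma summand_carrier: "x \<in> A i \<Longrightarrow> x \<in> carrier G"
  using additive_subgroup.a_subset[OF summand_subgroup] by blast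

lemma summand_zero [simp]: "\<zero> \<in> A i"
  using additive_subgroup.zero_closed[OF summand_subgroup] .

lemma summand_add: "x \<in> A i \<Longrightarrow> y \<in> A i \<Longrightarrow> x \<oplus> y \<in> A i"
  using additive_subgroup.a_closed[OF summand_subgroup] .

lemma summand_minus: "x \<in> A i \<Longrightarrow> \<ominus> x \<in> A i"
  using additive_subgroup.a_inv_closed[OF summand_subgroup] .

lemma
  assumes "x \<in> carrier G"
  shows component_in: "cp x i \<in> A i"
    and finite_supp: "finite (supp x)"
    and sum_component: "finsum G (cp x) (supp x) = x"
proof -
  have "\<exists>!u. (\<forall>i. u i \<in> A i) \<and> finite {i. u i \<noteq> \<zero>} \<and> x = finsum G u {i. u i \<noteq> \<zero>}"
    using direct_sum assms unfolding internal_direct_sum_def by blast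
  from theI'[OF this] show "cp x i \<in> A i" "finite (supp x)" "finsum G (cp x) (supp x) = x"
    unfolding component_def by auto
qed

lemma component_carrier [simp]: "x \<in> carrier G \<Longrightarrow> cp x i \<in> carrier G"
  using component_in summand_carrier by blast

text \<open>\<open>F\<close> may exceed the support and \<open>u\<close> is arbitrary outside
  \<open>F\<close>; extending by zero gives a decomposition of the required shape, which is
  unique.\<close>

lemma component_unique:
  assumes "finite F" "\<And>i. i \<in> F \<Longrightarrow> u i \<in> A i" "x = finsum G u F"
  shows "cp x i = (if i \<in> F then u i else \<zero>)"
proof -
  define v where "v i = (if i \<in> F then u i else \<zero>)" for i
  have x: "x \<in> carrier G" unfolding assms(3) by (rule finsum_closed) (use assms summand_carrier in auto)
  have *: "\<exists>!u. (\<forall>i. u i \<in> A i) \<and> finite {i. u i \<noteq> \<zero>} \<and> x = finsum G u {i. u i \<noteq> \<zero>}"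
    using direct_sum x unfolding internal_direct_sum_def by blast
  have vA: "v i \<in> A i" for i unfolding v_def using assms by auto
  have vc: "v i \<in> carrier G" for i using vA summand_carrier by blast
  have sub: "{i. v i \<noteq> \<zero>} \<subseteq> F" unfolding v_def by auto
  have "finsum G u F = finsum G v F"
  proof (rule add.finprod_cong')
    show "v \<in> F \<rightarrow> carrier G" using vc by blast
  qed (simp_all add: v_def)
  also have "\<dots> = finsum G v {i. v i \<noteq> \<zero>}"
    by (rule add.finprod_mono_neutral_cong_right) (use assms sub vc in auto)
  finally have "x = finsum G v {i. v i \<noteq> \<zero>}" using assms by simp
  moreover have "finite {i. v i \<noteq> \<zero>}" using sub assms(1) finite_subset by blast
  ultimately have "cp x = v" unfolding component_def using vA by (intro the1_equality[OF *]) auto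
  then show ?thesis unfolding v_def by simp
qed

lemma sum_component_superset:
  assumes "x \<in> carrier G" "finite F" "supp x \<subseteq> F"
  shows "finsum G (cp x) F = x"
proof -
  have "finsum G (cp x) F = finsum G (cp x) (supp x)"
    by (rule add.finprod_mono_neutral_cong_right) (use assms in auto)
  then show ?thesis using sum_component assms by simp
qed

lemma component_homogeneous: "x \<in> A i \<Longrightarrow> cp x j = (if j = i then x else \<zero>)"
  using component_unique[of "{i}" "\<lambda>_. x" x j] summand_carrier by (auto simp: finsum_insert)

lemma component_zero [simp]: "cp \<zero> i = \<zero>"
  using component_homogeneous[of \<zero> i i] by simp

lemma component_add:
  assumes "x \<in> carrier G" "y \<in> carrier G"
  shows "cp (x \<oplus> y) i = cp x i \<oplus> cp y i"
proof -
  let ?F = "supp x \<union> supp y"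
  have fin: "finite ?F" using finite_supp assms by auto
  have "x \<oplus> y = finsum G (\<lambda>i. cp x i \<oplus> cp y i) ?F"
    using sum_component_superset[OF _ fin] assms by (simp add: finsum_addf Pi_def)
  then have "cp (x \<oplus> y) i = (if i \<in> ?F then cp x i \<oplus> cp y i else \<zero>)"
    by (intro component_unique[OF fin]) (use assms component_in summand_add in auto)
  then show ?thesis by auto
qed

lemma component_minus:
  assumes "x \<in> carrier G"
  shows "cp (\<ominus> x) i = \<ominus> cp x i"
proof -
  have "cp (\<ominus> x) i \<oplus> cp x i = \<zero>"
    using component_add[of "\<ominus> x" x i] assms by (simp add: l_neg)
  then show ?thesis using assms by (metis minus_equality component_carrier a_inv_closed)
qed

lemma component_eqI:
  assumes "x \<in> carrier G" "y \<in> carrier G" "\<And>i. cp x i = cp y i"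
  shows "x = y"
proof -
  have "cp x = cp y" using assms by auto
  then show ?thesis using sum_component assms by metis
qed

lemma component_finsum:
  assumes "finite F" "f \<in> F \<rightarrow> carrier G"
  shows "cp (finsum G f F) i = finsum G (\<lambda>k. cp (f k) i) F"
  using assms
proof (induction F)
  case (insert k F)
  then show ?case by (auto simp: finsum_insert Pi_def component_add)
qed simp

end

section \<open>Components of products, and gradings of substructures\<close>

lemma (in graded_cring) direct_sum_group_ring: "direct_sum_group R A"
  by unfold_locales (rule ring_decomp)

lemma (in graded_module) direct_sum_group_module: "direct_sum_group M B"
  by unfold_locales (rule module_decomp)

lemma (in module) finsum_smult_rdistr:
  assumes "finite F" "x \<in> carrier M" "f \<in> F \<rightarrow> carrier R"
  shows "finsum R f F \<odot>\<^bsub>M\<^esub> x = finsum M (\<lambda>i. f i \<odot>\<^bsub>M\<^esub> x) F"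
  using assms(1,3)
proof (induction F)
  case empty then show ?case using assms by simp
next
  case (insert k F)
  then show ?case using assms by (simp add: R.finsum_insert M.finsum_insert Pi_def smult_l_distr)
qed

text \<open>Makes the facts about components of \<open>a \<odot> x\<close> available for products in
  the ring itself.\<close>

lemma graded_module_regular:
  assumes "graded_cring T A"
  shows "graded_module T A (regular_module T) A"
proof -
  interpret graded_cring T A by fact
  interpret module T "regular_module T" by (rule module_regular)
  have "additive_subgroup (A i) (regular_module T)" for i
  proof -
    interpret Ai: additive_subgroup "A i" T
      using ring_decomp unfolding internal_direct_sum_def by blast
    show ?thesis
      unfolding additive_subgroup_def using Ai.a_subset Ai.zero_closed
      by (intro M.add.subgroupI) (auto simp: ex_in_conv[symmetric] intro: Ai.zero_closed)
  qed
  then have "internal_direct_sum (regular_module T) A"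
    using ring_decomp unfolding internal_direct_sum_def by simp
  then show ?thesis
    by unfold_locales (auto intro: mult_degree)
qed

context graded_module
begin

sublocale Rd: direct_sum_group R A by (rule direct_sum_group_ring)
sublocale Md: direct_sum_group M B by (rule direct_sum_group_module)

lemma component_smult_homogeneous:
  assumes a: "a \<in> A i" and x: "x \<in> carrier M"
  shows "component M B (a \<odot>\<^bsub>M\<^esub> x) j = a \<odot>\<^bsub>M\<^esub> component M B x (j - i)"
proof -
  have ac: "a \<in> carrier R" using a Rd.summand_carrier by blast
  let ?S = "{k. component M B x k \<noteq> \<zero>\<^bsub>M\<^esub>}"
  let ?F = "(\<lambda>k. k + i) ` ?S"
  have fin: "finite ?S" using Md.finite_supp[OF x] .
  have "a \<odot>\<^bsub>M\<^esub> x = a \<odot>\<^bsub>M\<^esub> finsum M (component M B x) ?S" using Md.sum_component[OF x] by simp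
  also have "\<dots> = finsum M (\<lambda>k. a \<odot>\<^bsub>M\<^esub> component M B x k) ?S"
    by (rule finsum_smult_ldistr) (use fin ac x in auto)
  also have "\<dots> = finsum M (\<lambda>k. (\<lambda>j. a \<odot>\<^bsub>M\<^esub> component M B x (j - i)) (k + i)) ?S" by simp
  also have "\<dots> = finsum M (\<lambda>j. a \<odot>\<^bsub>M\<^esub> component M B x (j - i)) ?F"
    by (rule M.finsum_reindex[symmetric]) (use ac x in \<open>auto simp: inj_on_def\<close>)
  finally have *: "a \<odot>\<^bsub>M\<^esub> x = finsum M (\<lambda>j. a \<odot>\<^bsub>M\<^esub> component M B x (j - i)) ?F" .
  have "component M B (a \<odot>\<^bsub>M\<^esub> x) j = (if j \<in> ?F then a \<odot>\<^bsub>M\<^esub> component M B x (j - i) else \<zero>\<^bsub>M\<^esub>)"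
  proof (rule Md.component_unique[OF _ _ *])
    show "finite ?F" using fin by simp
    fix k show "a \<odot>\<^bsub>M\<^esub> component M B x (k - i) \<in> B k"
      using smult_degree[OF a Md.component_in[OF x], of "k - i"] by simp
  qed
  moreover have "j \<in> ?F" if "component M B x (j - i) \<noteq> \<zero>\<^bsub>M\<^esub>"
    using that by (intro image_eqI[of _ _ "j - i"]) auto
  ultimately show ?thesis using ac by (cases "component M B x (j - i) = \<zero>\<^bsub>M\<^esub>") auto
qed

lemma component_smult:
  assumes a: "a \<in> carrier R" and x: "x \<in> carrier M" and F: "finite F" "{i. component R A a i \<noteq> \<zero>} \<subseteq> F"
  shows "component M B (a \<odot>\<^bsub>M\<^esub> x) j =
    finsum M (\<lambda>i. component R A a i \<odot>\<^bsub>M\<^esub> component M B x (j - i)) F"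
proof -
  have "a \<odot>\<^bsub>M\<^esub> x = finsum R (component R A a) F \<odot>\<^bsub>M\<^esub> x"
    using Rd.sum_component_superset[OF a F] by simp
  also have "\<dots> = finsum M (\<lambda>i. component R A a i \<odot>\<^bsub>M\<^esub> x) F"
    by (rule finsum_smult_rdistr) (use F a x in auto)
  finally have "component M B (a \<odot>\<^bsub>M\<^esub> x) j =
      finsum M (\<lambda>i. component M B (component R A a i \<odot>\<^bsub>M\<^esub> x) j) F"
    using F a x by (simp add: Md.component_finsum Pi_def)
  then show ?thesis
    using component_smult_homogeneous[OF Rd.component_in[OF a] x] by simp
qed

end

text \<open>A homogeneous \<open>v\<close> leaves one term of the convolution. Annihilators of
  homogeneous elements can thus be tested on homogeneous ring elements.\<close>

lemma (in graded_module) component_smult_right: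
  assumes a: "a \<in> carrier R" and v: "v \<in> B p"
  shows "component M B (a \<odot>\<^bsub>M\<^esub> v) u = component R A a (u - p) \<odot>\<^bsub>M\<^esub> v"
proof -
  have vc: "v \<in> carrier M" using v Md.summand_carrier by blast
  \<comment> \<open>\<open>u - p\<close> is inserted because it may lie outside the support of
    \<open>a\<close>.\<close>
  let ?F = "insert (u - p) {i. component R A a i \<noteq> \<zero>}"
  let ?f = "\<lambda>i. component R A a i \<odot>\<^bsub>M\<^esub> component M B v (u - i)"
  have F: "finite ?F" "{i. component R A a i \<noteq> \<zero>} \<subseteq> ?F" using Rd.finite_supp[OF a] by auto
  have "component M B (a \<odot>\<^bsub>M\<^esub> v) u = finsum M ?f ?F" by (rule component_smult[OF a vc F])
  also have "\<dots> = ?f (u - p)"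
  proof (rule M.finsum_single)
    fix j assume "j \<noteq> u - p"
    then have "u - j \<noteq> p" by (metis diff_diff_eq2 add_diff_cancel_left')
    then show "?f j = \<zero>\<^bsub>M\<^esub>" using Md.component_homogeneous[OF v] a by simp
  qed (use F a vc in auto)
  also have "\<dots> = component R A a (u - p) \<odot>\<^bsub>M\<^esub> v" using Md.component_homogeneous[OF v, of "u - (u - p)"] by simp
  finally show ?thesis .
qed

text \<open>\<open>finsum\<close> depends on the carrier, so a sum formed in a substructure must be
  compared with the original one.\<close>

lemma finsum_restrict_carrier:
  assumes "abelian_group G" "abelian_group (G\<lparr>carrier := H\<rparr>)" "H \<subseteq> carrier G" "finite F" "f \<in> F \<rightarrow> H"
  shows "finsum (G\<lparr>carrier := H\<rparr>) f F = finsum G f F"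
proof -
  interpret G: abelian_group G by fact
  interpret H: abelian_group "G\<lparr>carrier := H\<rparr>" by fact
  show ?thesis
    using assms(4,5)
  proof (induction F)
    case (insert k F)
    then have "f \<in> F \<rightarrow> carrier G" "f k \<in> carrier G" using assms(3) by auto
    then show ?case using insert by (simp add: H.finsum_insert G.finsum_insert Pi_def)
  qed simp
qed

text \<open>With the first degree fixed, \<open>Pair n\<close> reindexes the support by single
  integers. Applied to \<open>Rc\<close> with \<open>n = 0\<close> and to every strand.\<close>

lemma internal_direct_sum_slice:
  fixes A :: "'i \<times> 'j \<Rightarrow> 'a set"
  assumes dsg: "direct_sum_group G A" and H: "additive_subgroup H G"
    and comp: "\<And>h u. h \<in> H \<Longrightarrow> component G A h u \<in> H"
    and slice: "\<And>h u. h \<in> H \<Longrightarrow> fst u \<noteq> n \<Longrightarrow> component G A h u = \<zero>\<^bsub>G\<^esub>"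
  shows "internal_direct_sum (G\<lparr>carrier := H\<rparr>) (\<lambda>l. H \<inter> A (n, l))"
proof -
  interpret direct_sum_group G A by fact
  have sgH: "subgroup H (add_monoid G)" using H by (simp add: additive_subgroup_def)
  have HG: "H \<subseteq> carrier G" using additive_subgroup.a_subset[OF H] .
  have agH: "abelian_group (G\<lparr>carrier := H\<rparr>)"
  proof (rule comm_group_abelian_groupI)
    have "group (add_monoid (G\<lparr>carrier := H\<rparr>))"
      using subgroup.subgroup_is_group[OF sgH a_group] by simp
    then show "comm_group (add_monoid (G\<lparr>carrier := H\<rparr>))"
      by (rule group.group_comm_groupI) (use HG a_comm in auto)
  qed
  note fs = finsum_restrict_carrier[OF abelian_group_axioms agH HG]
  have inj: "inj_on (Pair n) S" for S by (simp add: inj_on_def)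
  show ?thesis
    unfolding internal_direct_sum_def
  proof (intro conjI allI ballI)
    fix l
    have "subgroup (H \<inter> A (n, l)) (add_monoid G)"
      using add.subgroups_Inter_pair[OF sgH] summand_subgroup[of "(n, l)"] by (simp add: additive_subgroup_def)
    then show "additive_subgroup (H \<inter> A (n, l)) (G\<lparr>carrier := H\<rparr>)"
      using add.subgroup_incl[OF _ sgH] by (simp add: additive_subgroup_def)
  next
    fix h assume "h \<in> carrier (G\<lparr>carrier := H\<rparr>)"
    then have h: "h \<in> H" "h \<in> carrier G" using HG by auto
    let ?P = "\<lambda>u. (\<forall>i. u i \<in> H \<inter> A (n, i)) \<and> finite {i. u i \<noteq> \<zero>\<^bsub>G\<lparr>carrier := H\<rparr>\<^esub>} \<and>
        h = finsum (G\<lparr>carrier := H\<rparr>) u {i. u i \<noteq> \<zero>\<^bsub>G\<lparr>carrier := H\<rparr>\<^esub>}"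
    let ?v = "\<lambda>l. component G A h (n, l)"
    have supp: "supp h = Pair n ` {i. ?v i \<noteq> \<zero>\<^bsub>G\<^esub>}"
    proof (rule Set.set_eqI)
      fix p show "p \<in> supp h \<longleftrightarrow> p \<in> Pair n ` {i. ?v i \<noteq> \<zero>\<^bsub>G\<^esub>}"
        using slice[OF h(1), of p] by (cases p) (auto simp: image_iff)
    qed
    show "\<exists>!u. ?P u"
    proof (rule ex1I[of _ ?v])
      have fin: "finite {i. ?v i \<noteq> \<zero>\<^bsub>G\<^esub>}"
        using finite_supp[OF h(2)] unfolding supp by (rule finite_imageD) (rule inj)
      have "h = finsum G (component G A h) (Pair n ` {i. ?v i \<noteq> \<zero>\<^bsub>G\<^esub>})"
        using sum_component[OF h(2)] supp by simp
      also have "\<dots> = finsum G ?v {i. ?v i \<noteq> \<zero>\<^bsub>G\<^esub>}"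
        by (rule finsum_reindex) (use inj h in auto)
      also have "\<dots> = finsum (G\<lparr>carrier := H\<rparr>) ?v {i. ?v i \<noteq> \<zero>\<^bsub>G\<^esub>}"
        by (rule fs[symmetric]) (use fin comp h in auto)
      finally show "?P ?v" using fin comp component_in h by auto
    next
      fix u assume u: "?P u"
      let ?S = "{i. u i \<noteq> \<zero>\<^bsub>G\<^esub>}"
      have "h = finsum (G\<lparr>carrier := H\<rparr>) u ?S" using u by simp
      also have "\<dots> = finsum G u ?S" by (rule fs) (use u in auto)
      also have "\<dots> = finsum G (\<lambda>i. (\<lambda>p. u (snd p)) (Pair n i)) ?S" by simp
      also have "\<dots> = finsum G (\<lambda>p. u (snd p)) (Pair n ` ?S)"
        by (rule finsum_reindex[symmetric]) (use u HG inj in auto)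
      finally have *: "h = finsum G (\<lambda>p. u (snd p)) (Pair n ` ?S)" .
      have "component G A h (n, l) = (if (n, l) \<in> Pair n ` ?S then u (snd (n, l)) else \<zero>\<^bsub>G\<^esub>)" for l
        by (rule component_unique[OF _ _ *]) (use u in auto)
      then show "u = ?v" by (auto simp: fun_eq_iff image_iff)
    qed
  qed
qed

section \<open>Finitely generated bigraded modules\<close>

locale bigraded_module = graded_module T T_deg L L_deg
  for T (structure) and T_deg :: "int \<times> int \<Rightarrow> 'a set"
    and L :: "('a, 'm, 'n) module_scheme" (structure) and L_deg +
  fixes d c :: nat and x y :: "nat \<Rightarrow> 'a" and xdeg ydeg :: "nat \<Rightarrow> int"
  assumes noetherian_R0: "noetherian_ring (T\<lparr>carrier := T_deg (0, 0)\<rparr>)"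
    and x_degree: "\<And>i. i \<in> {1..d} \<Longrightarrow> x i \<in> T_deg (0, xdeg i)"
    and xdeg_pos: "\<And>i. i \<in> {1..d} \<Longrightarrow> xdeg i \<ge> 1"
    and y_degree: "\<And>j. j \<in> {1..c} \<Longrightarrow> y j \<in> T_deg (1, ydeg j)"
    and ydeg_nonneg: "\<And>j. j \<in> {1..c} \<Longrightarrow> ydeg j \<ge> 0"
    and ydeg_mono: "\<And>i j. 1 \<le> i \<Longrightarrow> i \<le> j \<Longrightarrow> j \<le> c \<Longrightarrow> ydeg i \<le> ydeg j"
    and T_generated: "carrier T = generate_ring T (T_deg (0, 0) \<union> x ` {1..d} \<union> y ` {1..c})"
    and L_finitely_generated: "finitely_generated_module T L"
begin

abbreviation "tcp \<equiv> component T T_deg"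
abbreviation "lcp \<equiv> component L L_deg"
abbreviation "R0 \<equiv> T_deg (0, 0)"
abbreviation "gens \<equiv> R0 \<union> x ` {1..d} \<union> y ` {1..c}"

definition "Rc = generate_ring T (R0 \<union> x ` {1..d})"

text \<open>The carrier of the strand, by \<open>strand_eq\<close>; a vanishing condition on
  components is easier to check than the existence of a sum.\<close>

definition "slice n = {z \<in> carrier L. \<forall>u. fst u \<noteq> n \<longrightarrow> lcp z u = \<zero>\<^bsub>L\<^esub>}"

lemma gens_carrier: "gens \<subseteq> carrier T" "R0 \<union> x ` {1..d} \<subseteq> carrier T" "R0 \<subseteq> carrier T"
  using Rd.summand_carrier x_degree y_degree by blast+

lemma x_carrier: "i \<in> {1..d} \<Longrightarrow> x i \<in> carrier T" and y_carrier: "j \<in> {1..c} \<Longrightarrow> y j \<in> carrier T"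
  using gens_carrier by auto

lemma Rc_carrier: "Rc \<subseteq> carrier T"
  unfolding Rc_def using generate_ring_in_carrier[OF gens_carrier(2)] by blast

lemma one_R0: "\<one> \<in> R0"
  using one_degree by (simp add: zero_prod_def)

sublocale reg: graded_module T T_deg "regular_module T" T_deg
  by (rule graded_module_regular) (rule graded_cring_axioms)

lemma stable_R0: "stable (regular_module T) R0 R0"
proof (rule stableI, simp_all)
  fix g z assume "g \<in> R0" "z \<in> R0"
  then show "g \<otimes> z \<in> R0" using mult_degree[of g "(0,0)" z "(0,0)"] by simp
qed (use gens_carrier Rd.summand_add Rd.summand_minus in auto)

lemma acc_R0: "acc_on (regular_module T) R0 R0"
  using noetherian_acc_on[OF is_cring noetherian_R0 gens_carrier(3)] .

text \<open>Adjoining the \<open>x i\<close> to \<open>R0\<close> gives a set stable under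
  \<open>Rc\<close>; it contains \<open>\<one>\<close>, hence all of \<open>Rc\<close>.\<close>

lemma acc_Rc: "acc_on (regular_module T) Rc Rc"
proof -
  obtain P where P: "R0 \<subseteq> P" "stable (regular_module T) (R0 \<union> x ` {1..d}) P"
    "acc_on (regular_module T) (R0 \<union> x ` {1..d}) P"
    by (rule reg.hilbert_basis[OF _ _ gens_carrier(3) stable_R0 acc_R0, of "x ` {1..d}"])
      (use x_carrier in auto)
  have st: "stable (regular_module T) Rc P"
    unfolding Rc_def by (rule reg.stable_generate_ring[OF P(2) gens_carrier(2)])
  have "Rc \<subseteq> P"
  proof
    fix r assume r: "r \<in> Rc"
    then have "r \<otimes> \<one> \<in> P" using stableD(5)[OF st] P(1) one_R0 by auto
    then show "r \<in> P" using r Rc_carrier by auto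
  qed
  then have "acc_on (regular_module T) (R0 \<union> x ` {1..d}) Rc" using acc_on_subset P(3) by blast
  then show ?thesis by (rule acc_on_mono_scalars) (auto simp: Rc_def intro: generate_ring.incl)
qed

lemma stable_gens_iff: "stable L (carrier T) N \<longleftrightarrow> stable L gens N"
  using stable_generate_ring[of gens N] gens_carrier stable_mono[of L "carrier T" N gens] T_generated
  by auto

lemma generators:
  obtains F where "finite F" "F \<subseteq> carrier L" "\<forall>N. stable L gens N \<longrightarrow> F \<subseteq> N \<longrightarrow> N = carrier L"
proof -
  obtain F where F: "F \<subseteq> carrier L" "finite F" "carrier L = \<Inter>{N. submodule N T L \<and> F \<subseteq> N}"
    using L_finitely_generated unfolding finitely_generated_module_def by blast
  have "N = carrier L" if "stable L gens N" "F \<subseteq> N" for N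
  proof -
    have "submodule N T L" using stable_submodule that stable_gens_iff by blast
    then show ?thesis using F(3) that(2) stableD(1)[OF that(1)] by blast
  qed
  then show thesis using that F by blast
qed

text \<open>A set around the module generators with the chain condition over \<open>R0\<close>,
  enlarged by means of the \<open>x i\<close> and \<open>y j\<close>, becomes stable under
  \<open>gens\<close> and must be all of \<open>L\<close>.\<close>

lemma acc_L: "acc_on L gens (carrier L)"
proof -
  obtain F where F: "finite F" "F \<subseteq> carrier L" "\<forall>N. stable L gens N \<longrightarrow> F \<subseteq> N \<longrightarrow> N = carrier L"
    by (rule generators)
  obtain P where P: "F \<subseteq> P" "stable L R0 P" "acc_on L R0 P"
    by (rule acc_on_finite_span[OF gens_carrier(3) stable_R0 one_R0 acc_R0 F(1,2)])
  obtain P' where P': "P \<subseteq> P'" "stable L (R0 \<union> (x ` {1..d} \<union> y ` {1..c})) P'"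
    "acc_on L (R0 \<union> (x ` {1..d} \<union> y ` {1..c})) P'"
    by (rule hilbert_basis[OF _ _ gens_carrier(3) P(2,3), of "x ` {1..d} \<union> y ` {1..c}"])
      (use x_carrier y_carrier in auto)
  then have "P' = carrier L" using F(3)[rule_format, of P'] P(1) by (auto simp: Un_assoc)
  then show ?thesis using P' by (simp add: Un_assoc)
qed

lemma component_generator:
  assumes z: "z \<in> carrier L"
  shows "g \<in> R0 \<Longrightarrow> lcp (g \<odot>\<^bsub>L\<^esub> z) u = g \<odot>\<^bsub>L\<^esub> lcp z u"
    "i \<in> {1..d} \<Longrightarrow> lcp (x i \<odot>\<^bsub>L\<^esub> z) u = x i \<odot>\<^bsub>L\<^esub> lcp z (u - (0, xdeg i))"
    "j \<in> {1..c} \<Longrightarrow> lcp (y j \<odot>\<^bsub>L\<^esub> z) u = y j \<odot>\<^bsub>L\<^esub> lcp z (u - (1, ydeg j))"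
  using component_smult_homogeneous[OF _ z] x_degree y_degree by (auto simp: zero_prod_def[symmetric])

text \<open>All ring generators have second degree at least \<open>0\<close>, so the lowest second
  degree among the module generators is a bound, uniformly in \<open>n\<close>.\<close>

lemma degree_bounded_below:
  obtains C where "\<And>z n l. z \<in> carrier L \<Longrightarrow> l < C \<Longrightarrow> lcp z (n, l) = \<zero>\<^bsub>L\<^esub>"
proof -
  obtain F where F: "finite F" "F \<subseteq> carrier L" "\<forall>N. stable L gens N \<longrightarrow> F \<subseteq> N \<longrightarrow> N = carrier L"
    by (rule generators)
  define D where "D = snd ` (\<Union>f\<in>F. Md.supp f)"
  have finD: "finite D" unfolding D_def
    by (intro finite_imageI finite_UN_I F(1) Md.finite_supp) (use F in auto)
  obtain C where C: "\<And>l. l \<in> D \<Longrightarrow> C \<le> l"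
    using finD by (meson Min_le)
  define N where "N = {z \<in> carrier L. \<forall>n l. l < C \<longrightarrow> lcp z (n, l) = \<zero>\<^bsub>L\<^esub>}"
  have "F \<subseteq> N"
  proof
    fix f assume f: "f \<in> F"
    have "lcp f (n, l) = \<zero>\<^bsub>L\<^esub>" if "l < C" for n l
    proof (rule ccontr)
      assume "lcp f (n, l) \<noteq> \<zero>\<^bsub>L\<^esub>"
      then have "(n, l) \<in> (\<Union>f\<in>F. Md.supp f)" using f by blast
      then have "l \<in> D" unfolding D_def by (rule image_eqI[rotated]) simp
      then show False using C[of l] that by simp
    qed
    then show "f \<in> N" using f F unfolding N_def by auto
  qed
  moreover have "stable L gens N"
  proof (rule stableI)
    fix g z assume g: "g \<in> gens" and "z \<in> N"
    then have z: "z \<in> carrier L" "\<And>n l. l < C \<Longrightarrow> lcp z (n, l) = \<zero>\<^bsub>L\<^esub>" unfolding N_def by auto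
    have "lcp (g \<odot>\<^bsub>L\<^esub> z) (n, l) = \<zero>\<^bsub>L\<^esub>" if "l < C" for n l
      using g
    proof (elim UnE imageE)
      assume "g \<in> R0" then show ?thesis using component_generator(1)[OF z(1)] z that gens_carrier by auto
    next
      fix i assume i: "g = x i" "i \<in> {1..d}"
      then have "lcp z (n, l - xdeg i) = \<zero>\<^bsub>L\<^esub>" using z that xdeg_pos[of i] by auto
      then show ?thesis using component_generator(2)[OF z(1), of i] x_carrier i by auto
    next
      fix j assume j: "g = y j" "j \<in> {1..c}"
      then have "lcp z (n - 1, l - ydeg j) = \<zero>\<^bsub>L\<^esub>" using z that ydeg_nonneg[of j] by auto
      then show ?thesis using component_generator(3)[OF z(1), of j] y_carrier j by auto
    qed
    then show "g \<odot>\<^bsub>L\<^esub> z \<in> N" using g z gens_carrier unfolding N_def by auto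
  qed (auto simp: N_def Md.component_add Md.component_minus)
  ultimately have "N = carrier L" using F(3) by blast
  then show thesis using that unfolding N_def by blast
qed

section \<open>The subring \<open>Rc\<close> and the grading of the strands\<close>

lemma Rc_component:
  assumes r: "r \<in> Rc"
  shows "tcp r u \<in> Rc" "fst u \<noteq> 0 \<Longrightarrow> tcp r u = \<zero>"
proof -
  \<comment> \<open>\<open>H\<close> collects the elements with both properties. It contains
    \<open>\<one>\<close> and is stable under the generators of \<open>Rc\<close>, hence contains
    \<open>Rc\<close>.\<close>
  define H where "H = {r \<in> carrier T. \<forall>u. tcp r u \<in> Rc \<and> (fst u \<noteq> 0 \<longrightarrow> tcp r u = \<zero>)}"
  have incl: "g \<in> Rc" if "g \<in> R0 \<union> x ` {1..d}" for g
    unfolding Rc_def using that by (rule generate_ring.incl)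
  have zero: "\<zero> \<in> Rc" using incl Rd.summand_zero[of "(0,0)"] by blast
  have cp: "component (regular_module T) T_deg = tcp"
    by (simp add: component_def fun_eq_iff)
  have "stable (regular_module T) (R0 \<union> x ` {1..d}) H"
  proof (rule stableI, unfold regular_module_simps)
    show "H \<subseteq> carrier T" "\<zero> \<in> H" using zero unfolding H_def by auto
  next
    fix a b assume "a \<in> H" "b \<in> H"
    then show "a \<oplus> b \<in> H" unfolding H_def by (auto simp: Rd.component_add Rc_def intro: generate_ring.eng_add)
  next
    fix a assume "a \<in> H"
    then show "\<ominus> a \<in> H" unfolding H_def by (auto simp: Rd.component_minus Rc_def intro: generate_ring.a_inv)
  next
    fix g a assume g: "g \<in> R0 \<union> x ` {1..d}" and a: "a \<in> H"
    then obtain k where k: "g \<in> T_deg (0, k)" using x_degree by blast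
    have ac: "a \<in> carrier T" using a unfolding H_def by auto
    have gR: "g \<in> Rc" "g \<in> carrier T" using incl g Rc_carrier by auto
    have "tcp (g \<otimes> a) u = g \<otimes> tcp a (u - (0, k))" for u
      using reg.component_smult_homogeneous[OF k, of a u] ac by (simp add: cp)
    then show "g \<otimes> a \<in> H" using a ac gR unfolding H_def
      by (auto simp: Rc_def intro: generate_ring.eng_mult)
  qed
  then have st: "stable (regular_module T) Rc H"
    unfolding Rc_def by (rule reg.stable_generate_ring[OF _ gens_carrier(2)])
  have "tcp \<one> u = (if u = (0,0) then \<one> else \<zero>)" for u
    using Rd.component_homogeneous[OF one_R0] .
  then have "\<one> \<in> H" unfolding H_def using zero incl one_R0 by auto
  then have "r \<otimes> \<one> \<in> H" using stableD(5)[OF st r, of \<one>] by simp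
  then have "r \<in> H" using r Rc_carrier by auto
  then show "tcp r u \<in> Rc" "fst u \<noteq> 0 \<Longrightarrow> tcp r u = \<zero>"
    unfolding H_def by (simp_all del: split_paired_All)
qed

lemma Rc_subcring: "subcring Rc T"
  unfolding Rc_def
  by (rule subcringI') (use generate_ring_is_subring[OF gens_carrier(2)] is_cring in auto)

lemma cring_Rc: "cring (T\<lparr>carrier := Rc\<rparr>)"
  using subcring_iff[OF Rc_carrier] Rc_subcring by blast

lemma Rc_props:
  shows "\<zero> \<in> Rc" "\<one> \<in> Rc" "\<And>a b. a \<in> Rc \<Longrightarrow> b \<in> Rc \<Longrightarrow> a \<oplus> b \<in> Rc"
    "\<And>a b. a \<in> Rc \<Longrightarrow> b \<in> Rc \<Longrightarrow> a \<otimes> b \<in> Rc" "\<And>a. a \<in> Rc \<Longrightarrow> \<ominus> a \<in> Rc"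
    "\<And>a. a \<in> Rc \<Longrightarrow> a \<in> carrier T"
  using Rc_carrier generate_ring.incl[of \<zero> "R0 \<union> x ` {1..d}" T] Rd.summand_zero[of "(0,0)"]
  by (auto simp: Rc_def intro: generate_ring.intros)

lemma slice_smult:
  assumes r: "r \<in> Rc" and z: "z \<in> slice n"
  shows "r \<odot>\<^bsub>L\<^esub> z \<in> slice n"
proof -
  have c: "r \<in> carrier T" "z \<in> carrier L" using r z Rc_carrier unfolding slice_def by auto
  have "lcp (r \<odot>\<^bsub>L\<^esub> z) u = \<zero>\<^bsub>L\<^esub>" if u: "fst u \<noteq> n" for u
  proof -
    have "tcp r i \<odot>\<^bsub>L\<^esub> lcp z (u - i) = \<zero>\<^bsub>L\<^esub>" for i
    proof (cases "fst i = 0")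
      case True
      then have "lcp z (u - i) = \<zero>\<^bsub>L\<^esub>" using z u unfolding slice_def by (simp del: split_paired_All)
      then show ?thesis using c by simp
    next
      case False then show ?thesis using Rc_component(2)[OF r] c by simp
    qed
    then show ?thesis using component_smult[OF c Rd.finite_supp[OF c(1)] subset_refl, of u] by simp
  qed
  then show ?thesis using c unfolding slice_def by auto
qed

lemma strand_eq: "strand L L_deg n = L\<lparr>carrier := slice n\<rparr>"
proof -
  have inj: "inj_on (Pair n) S" for S by (simp add: inj_on_def)
  have "{finsum L u {l. u l \<noteq> \<zero>\<^bsub>L\<^esub>} | u. (\<forall>l. u l \<in> L_deg (n, l)) \<and> finite {l. u l \<noteq> \<zero>\<^bsub>L\<^esub>}} = slice n"
  proof (intro equalityI subsetI)
    fix z assume "z \<in> {finsum L u {l. u l \<noteq> \<zero>\<^bsub>L\<^esub>} | u. (\<forall>l. u l \<in> L_deg (n, l)) \<and> finite {l. u l \<noteq> \<zero>\<^bsub>L\<^esub>}}"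
    then obtain u where u: "\<And>l. u l \<in> L_deg (n, l)" "finite {l. u l \<noteq> \<zero>\<^bsub>L\<^esub>}" "z = finsum L u {l. u l \<noteq> \<zero>\<^bsub>L\<^esub>}"
      by blast
    let ?S = "{l. u l \<noteq> \<zero>\<^bsub>L\<^esub>}"
    have uc: "u l \<in> carrier L" for l using u Md.summand_carrier by blast
    have "z = finsum L (\<lambda>i. (\<lambda>p. u (snd p)) (Pair n i)) ?S" using u by simp
    also have "\<dots> = finsum L (\<lambda>p. u (snd p)) (Pair n ` ?S)"
      by (rule M.finsum_reindex[symmetric]) (use uc inj in auto)
    finally have *: "z = finsum L (\<lambda>p. u (snd p)) (Pair n ` ?S)" .
    have "lcp z p = (if p \<in> Pair n ` ?S then u (snd p) else \<zero>\<^bsub>L\<^esub>)" for p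
      by (rule Md.component_unique[OF _ _ *]) (use u in auto)
    moreover have "z \<in> carrier L" unfolding u(3) by (rule M.finsum_closed) (use uc in auto)
    ultimately show "z \<in> slice n" unfolding slice_def by auto
  next
    fix z assume "z \<in> slice n"
    then have z: "z \<in> carrier L" "\<And>u. fst u \<noteq> n \<Longrightarrow> lcp z u = \<zero>\<^bsub>L\<^esub>" unfolding slice_def by auto
    let ?v = "\<lambda>l. lcp z (n, l)"
    have supp: "Md.supp z = Pair n ` {i. ?v i \<noteq> \<zero>\<^bsub>L\<^esub>}"
    proof (rule Set.set_eqI)
      fix p show "p \<in> Md.supp z \<longleftrightarrow> p \<in> Pair n ` {i. ?v i \<noteq> \<zero>\<^bsub>L\<^esub>}"
        using z(2)[of p] by (cases p) (auto simp: image_iff)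
    qed
    have fin: "finite {i. ?v i \<noteq> \<zero>\<^bsub>L\<^esub>}"
      using Md.finite_supp[OF z(1)] unfolding supp by (rule finite_imageD) (rule inj)
    have "z = finsum L (lcp z) (Pair n ` {i. ?v i \<noteq> \<zero>\<^bsub>L\<^esub>})"
      using Md.sum_component[OF z(1)] supp by simp
    also have "\<dots> = finsum L ?v {i. ?v i \<noteq> \<zero>\<^bsub>L\<^esub>}"
      by (rule M.finsum_reindex) (use inj z in auto)
    finally show "z \<in> {finsum L u {l. u l \<noteq> \<zero>\<^bsub>L\<^esub>} | u. (\<forall>l. u l \<in> L_deg (n, l)) \<and> finite {l. u l \<noteq> \<zero>\<^bsub>L\<^esub>}}"
      using fin Md.component_in[OF z(1)] by blast
  qed
  then show ?thesis unfolding strand_def by simp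
qed

lemma homogeneous_in_slice: "z \<in> L_deg (n, l) \<Longrightarrow> z \<in> slice n"
  unfolding slice_def using Md.summand_carrier Md.component_homogeneous[of z "(n, l)"] by auto

lemma component_in_slice:
  assumes "z \<in> slice n"
  shows "lcp z u \<in> slice n"
proof (cases "fst u = n")
  case True
  then show ?thesis using homogeneous_in_slice[of "lcp z u" n "snd u"] Md.component_in[of z u] assms
    unfolding slice_def by auto
next
  case False
  then show ?thesis using assms Md.component_zero unfolding slice_def by (simp del: split_paired_All)
qed

lemma slice_subgroup: "additive_subgroup (slice n) L"
  unfolding additive_subgroup_def
  by (rule M.add.subgroupI)
    (auto simp: slice_def Md.component_add Md.component_minus intro!: exI[of _ "\<zero>\<^bsub>L\<^esub>"])

theorem graded_module_strand:
  "graded_module (T\<lparr>carrier := Rc\<rparr>) (\<lambda>l. Rc \<inter> T_deg (0, l)) (strand L L_deg n) (\<lambda>l. L_deg (n, l))"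
proof -
  let ?R = "T\<lparr>carrier := Rc\<rparr>"
  interpret R': cring ?R by (rule cring_Rc)
  have "additive_subgroup Rc T"
    unfolding additive_subgroup_def using subring.axioms(1)[OF subcring.axioms(1)[OF Rc_subcring]] .
  then have sum: "internal_direct_sum ?R (\<lambda>l. Rc \<inter> T_deg (0, l))"
    by (rule internal_direct_sum_slice[OF Rd.direct_sum_group_axioms]) (use Rc_component in auto)
  interpret R': graded_cring ?R "\<lambda>l. Rc \<inter> T_deg (0, l)"
  proof
    show "internal_direct_sum ?R (\<lambda>l. Rc \<inter> T_deg (0, l))" by (rule sum)
    show "\<one>\<^bsub>?R\<^esub> \<in> Rc \<inter> T_deg (0, 0)" using Rc_props one_R0 by simp
    fix a b i j assume "a \<in> Rc \<inter> T_deg (0, i)" "b \<in> Rc \<inter> T_deg (0, j)"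
    then show "a \<otimes>\<^bsub>?R\<^esub> b \<in> Rc \<inter> T_deg (0, i + j)"
      using mult_degree[of a "(0, i)" b "(0, j)"] Rc_props by simp
  qed
  have mL: "module ?R L"
    by (rule moduleI) (use R'.is_cring M.abelian_group_axioms Rc_carrier in
      \<open>auto simp: smult_l_distr smult_r_distr smult_assoc1 subset_iff\<close>)
  have "submodule (slice n) ?R L"
    unfolding submodule_def submodule_axioms_def
    using slice_subgroup[of n] slice_smult unfolding additive_subgroup_def by auto
  then have mod: "module ?R (strand L L_deg n)"
    unfolding strand_eq using submodule.submodule_is_module mL by blast
  have sl: "slice n \<inter> L_deg (n, l) = L_deg (n, l)" for l using homogeneous_in_slice by blast
  have "internal_direct_sum (L\<lparr>carrier := slice n\<rparr>) (\<lambda>l. slice n \<inter> L_deg (n, l))"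
    by (rule internal_direct_sum_slice[OF Md.direct_sum_group_axioms slice_subgroup])
      (use component_in_slice in \<open>auto simp: slice_def\<close>)
  then have sumL: "internal_direct_sum (strand L L_deg n) (\<lambda>l. L_deg (n, l))"
    unfolding sl strand_eq .
  show ?thesis
  proof (intro graded_module.intro graded_module_axioms.intro)
    show "graded_cring ?R (\<lambda>l. Rc \<inter> T_deg (0, l))" by (rule R'.graded_cring_axioms)
    fix a i z j assume "a \<in> Rc \<inter> T_deg (0, i)" "z \<in> L_deg (n, j)"
    then show "a \<odot>\<^bsub>strand L L_deg n\<^esub> z \<in> L_deg (n, i + j)"
      using smult_degree[of a "(0, i)" z "(n, j)"] by (simp add: strand_eq)
  qed (use mod sumL in auto)
qed

end

section \<open>Asymptotic linearity of the initial degree\<close>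

context bigraded_module
begin

text \<open>These notions concern the quotient \<open>K / (K \<inter> N)\<close>; neither submodule has to be homogeneous.\<close>

definition nonzero_at :: "'m set \<Rightarrow> 'm set \<Rightarrow> int \<Rightarrow> int \<Rightarrow> bool" where
  "nonzero_at K N n l \<longleftrightarrow> (\<exists>z \<in> K \<inter> L_deg (n, l). z \<notin> N)"

definition nilpotent_on :: "'m set \<Rightarrow> 'm set \<Rightarrow> nat \<Rightarrow> bool" where
  "nilpotent_on K N j \<longleftrightarrow> (\<exists>k::nat. \<forall>u. \<forall>z \<in> K \<inter> L_deg u. (y j [^] k) \<odot>\<^bsub>L\<^esub> z \<in> N)"

definition non_nilpotent :: "'m set \<Rightarrow> 'm set \<Rightarrow> nat set" where
  "non_nilpotent K N = {j \<in> {1..c}. \<not> nilpotent_on K N j}"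

lemma homogeneous_stable:
  assumes "stable L gens K"
  shows "stable L {} (K \<inter> L_deg u)"
  by (rule stableI) (use assms stableD[OF assms(1)] in
    \<open>auto intro: Md.summand_add Md.summand_minus\<close>)

lemma smult_shift: "a \<in> T_deg v \<Longrightarrow> z \<in> L_deg (u - v) \<Longrightarrow> a \<odot>\<^bsub>L\<^esub> z \<in> L_deg u"
  using smult_degree[of a v z "u - v"] by simp

lemma gens_cases:
  assumes "g \<in> gens"
  obtains l where "g \<in> T_deg (0, l)" | j where "j \<in> {1..c}" "g = y j" "g \<in> T_deg (1, ydeg j)"
  using assms x_degree y_degree by blast

text \<open>Generation of the next strand by the \<open>y j\<close> is expressed through arbitrary
  additive subgroups \<open>H\<close> instead of sums, because \<open>H\<close> will later be a
  colon of \<open>N\<close>.\<close>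

lemma eventually_generated:
  assumes K: "stable L gens K"
  obtains n0 where "\<And>n l H. n \<ge> n0 \<Longrightarrow> stable L {} H \<Longrightarrow>
      (\<forall>j\<in>{1..c}. \<forall>z \<in> K \<inter> L_deg (n, l - ydeg j). y j \<odot>\<^bsub>L\<^esub> z \<in> H) \<Longrightarrow> K \<inter> L_deg (n + 1, l) \<subseteq> H"
proof -
  \<comment> \<open>The additive subgroup of degree \<open>u\<close> generated by the products of
    the \<open>y j\<close> with elements of \<open>K\<close> one step lower.\<close>
  define Y where "Y u = \<Inter>{H. stable L {} H \<and>
    (\<forall>j\<in>{1..c}. \<forall>z \<in> K \<inter> L_deg (u - (1, ydeg j)). y j \<odot>\<^bsub>L\<^esub> z \<in> H)}" for u
  have Kc: "z \<in> K \<Longrightarrow> z \<in> carrier L" for z using stableD(6)[OF K] .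
  have Kg: "g \<in> gens \<Longrightarrow> z \<in> K \<Longrightarrow> g \<odot>\<^bsub>L\<^esub> z \<in> K" for g z using stableD(5)[OF K] .
  have Y_gen: "y j \<odot>\<^bsub>L\<^esub> z \<in> Y u" if "j \<in> {1..c}" "z \<in> K \<inter> L_deg (u - (1, ydeg j))" for j z u
    using that unfolding Y_def by blast
  have Y_sub: "Y u \<subseteq> K \<inter> L_deg u" for u
  proof -
    have "y j \<odot>\<^bsub>L\<^esub> z \<in> K \<inter> L_deg u" if "j \<in> {1..c}" "z \<in> K \<inter> L_deg (u - (1, ydeg j))" for j z
      using that Kg smult_shift[OF y_degree] by auto
    then show ?thesis unfolding Y_def using homogeneous_stable[OF K, of u] by blast
  qed
  have Y_zero: "\<zero>\<^bsub>L\<^esub> \<in> Y u" for u unfolding Y_def using stableD(2) by blast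
  have Y_add: "a \<oplus>\<^bsub>L\<^esub> b \<in> Y u" if "a \<in> Y u" "b \<in> Y u" for a b u
    unfolding Y_def by (intro InterI) (use that in \<open>auto simp: Y_def intro: stableD(3)\<close>)
  have Y_minus: "\<ominus>\<^bsub>L\<^esub> a \<in> Y u" if "a \<in> Y u" for a u
    unfolding Y_def by (intro InterI) (use that in \<open>auto simp: Y_def intro: stableD(4)\<close>)
  have Y_smult: "g \<odot>\<^bsub>L\<^esub> z \<in> Y u" if g: "g \<in> gens" "g \<in> T_deg v" and z: "z \<in> Y (u - v)" for g v z u
    unfolding Y_def
  proof (intro InterI, elim CollectE conjE)
    fix H assume H: "stable L {} H"
      "\<forall>j\<in>{1..c}. \<forall>z \<in> K \<inter> L_deg (u - (1, ydeg j)). y j \<odot>\<^bsub>L\<^esub> z \<in> H"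
    have gc: "g \<in> carrier T" using g gens_carrier by blast
    have "stable L {} {z \<in> carrier L. g \<odot>\<^bsub>L\<^esub> z \<in> H}"
      by (rule stable_vimage[OF H(1) gc]) simp
    moreover have "y j \<odot>\<^bsub>L\<^esub> z \<in> {z \<in> carrier L. g \<odot>\<^bsub>L\<^esub> z \<in> H}"
      if j: "j \<in> {1..c}" and z: "z \<in> K \<inter> L_deg (u - v - (1, ydeg j))" for j z
    proof -
      have "z \<in> L_deg ((u - (1, ydeg j)) - v)" using z by (simp add: algebra_simps)
      then have "g \<odot>\<^bsub>L\<^esub> z \<in> K \<inter> L_deg (u - (1, ydeg j))" using z Kg g smult_shift by auto
      then have "y j \<odot>\<^bsub>L\<^esub> (g \<odot>\<^bsub>L\<^esub> z) \<in> H" using H(2) j by blast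
      then have "g \<odot>\<^bsub>L\<^esub> (y j \<odot>\<^bsub>L\<^esub> z) \<in> H"
        using smult_left_commute[OF gc y_carrier[OF j]] Kc z by auto
      then show ?thesis using y_carrier[OF j] Kc z by auto
    qed
    ultimately have "Y (u - v) \<subseteq> {z \<in> carrier L. g \<odot>\<^bsub>L\<^esub> z \<in> H}" unfolding Y_def by blast
    then show "g \<odot>\<^bsub>L\<^esub> z \<in> H" using z by blast
  qed
  \<comment> \<open>\<open>V k\<close> keeps \<open>K\<close> up to first degree \<open>k\<close>
    and only what the \<open>y j\<close> produce beyond it. These submodules increase with
    \<open>k\<close>; once they stop, \<open>K\<close> agrees with \<open>Y\<close> in all higher
    first degrees.\<close>
  define U where "U k u = (if fst u \<le> int k then K \<inter> L_deg u else Y u)" for k u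
  define V where "V k = {z \<in> carrier L. \<forall>u. lcp z u \<in> U k u}" for k
  have U_sub: "U k u \<subseteq> K \<inter> L_deg u" for k u using Y_sub unfolding U_def by auto
  have U_zero: "\<zero>\<^bsub>L\<^esub> \<in> U k u" for k u using stableD(2)[OF K] Y_zero unfolding U_def by auto
  have V_st: "stable L gens (V k)" for k
  proof (rule stableI)
    fix g z assume g: "g \<in> gens" and "z \<in> V k"
    then have z: "z \<in> carrier L" "\<And>u. lcp z u \<in> U k u" unfolding V_def by auto
    \<comment> \<open>Generators of first degree \<open>0\<close> stay on their side of the
      threshold \<open>k\<close>. Only a \<open>y j\<close> can cross it, and then the product lies
      in \<open>Y u\<close> by construction.\<close>
    have step: "g \<odot>\<^bsub>L\<^esub> w \<in> U k u" if v: "g \<in> T_deg v" "fst v \<ge> 0" and w: "w \<in> U k (u - v)"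
      and yv: "fst v > 0 \<Longrightarrow> \<exists>j\<in>{1..c}. g = y j \<and> v = (1, ydeg j)" for v w u
    proof (cases "fst u \<le> int k")
      case True
      have "w \<in> K \<inter> L_deg (u - v)" using w U_sub by blast
      then have "g \<odot>\<^bsub>L\<^esub> w \<in> K \<inter> L_deg u" using Kg[OF g] smult_shift[OF v(1), of w u] by simp
      then show ?thesis using True unfolding U_def by simp
    next
      case False
      show ?thesis
      proof (cases "fst (u - v) \<le> int k")
        case True
        then obtain j where "j \<in> {1..c}" "g = y j" "v = (1, ydeg j)" using yv False by auto
        then show ?thesis using Y_gen w True False unfolding U_def by auto
      next
        case False
        then show ?thesis using Y_smult[OF g v(1)] w v(2) unfolding U_def by auto
      qed
    qed
    have "lcp (g \<odot>\<^bsub>L\<^esub> z) u \<in> U k u" for u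
      using g
    proof (cases rule: gens_cases)
      case (1 l)
      then show ?thesis using component_smult_homogeneous[OF 1 z(1)] z step[OF 1] by simp
    next
      case (2 j)
      show ?thesis
        unfolding component_smult_homogeneous[OF 2(3) z(1)]
        by (rule step[OF 2(3) _ z(2)]) (use 2 in auto)
    qed
    then show "g \<odot>\<^bsub>L\<^esub> z \<in> V k" unfolding V_def using g gens_carrier z by blast
  next
    fix a b assume ab: "a \<in> V k" "b \<in> V k"
    have "lcp (a \<oplus>\<^bsub>L\<^esub> b) u \<in> U k u" for u
    proof -
      have "lcp a u \<in> U k u" "lcp b u \<in> U k u" "a \<in> carrier L" "b \<in> carrier L"
        using ab unfolding V_def by blast+
      then show ?thesis
        using Y_add stableD(3)[OF homogeneous_stable[OF K, of u]]
        by (auto simp: Md.component_add U_def split: if_splits)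
    qed
    then show "a \<oplus>\<^bsub>L\<^esub> b \<in> V k" using ab unfolding V_def by (simp del: split_paired_All)
  next
    fix a assume a: "a \<in> V k"
    have "lcp (\<ominus>\<^bsub>L\<^esub> a) u \<in> U k u" for u
    proof -
      have "lcp a u \<in> U k u" "a \<in> carrier L" using a unfolding V_def by blast+
      then show ?thesis
        using Y_minus stableD(4)[OF homogeneous_stable[OF K, of u]]
        by (auto simp: Md.component_minus U_def split: if_splits)
    qed
    then show "\<ominus>\<^bsub>L\<^esub> a \<in> V k" using a unfolding V_def by (simp del: split_paired_All)
  qed (use U_zero in \<open>auto simp: V_def\<close>)
  have V_c: "V k \<subseteq> carrier L" for k unfolding V_def by blast
  have "U k u \<subseteq> U (Suc k) u" for k u using Y_sub unfolding U_def by auto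
  then have V_mono: "V k \<subseteq> V (Suc k)" for k unfolding V_def by blast
  obtain k0 where k0: "\<forall>k\<ge>k0. V k = V k0"
    using acc_onD[where f = V, OF acc_L V_st V_c V_mono] ..
  have eq: "K \<inter> L_deg (n, l) \<subseteq> Y (n, l)" if n: "n > int k0" for n l
  proof
    fix z assume z: "z \<in> K \<inter> L_deg (n, l)"
    have zc: "lcp z u = (if u = (n, l) then z else \<zero>\<^bsub>L\<^esub>)" for u
      using Md.component_homogeneous z by blast
    have "z \<in> U (nat n) (n, l)" using z n unfolding U_def by simp
    then have "lcp z u \<in> U (nat n) u" for u using zc U_zero by simp
    then have "z \<in> V (nat n)" unfolding V_def using z Kc by blast
    moreover have "nat n \<ge> k0" using n by linarith
    ultimately have "lcp z (n, l) \<in> U k0 (n, l)" using k0 unfolding V_def by blast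
    then have "z \<in> U k0 (n, l)" using zc by simp
    then show "z \<in> Y (n, l)" using n unfolding U_def by simp
  qed
  show thesis
  proof (rule that)
    fix n l H assume "n \<ge> int k0" "stable L {} H"
      "\<forall>j\<in>{1..c}. \<forall>z \<in> K \<inter> L_deg (n, l - ydeg j). y j \<odot>\<^bsub>L\<^esub> z \<in> H"
    then show "K \<inter> L_deg (n + 1, l) \<subseteq> H" using eq[of "n + 1" l] unfolding Y_def by auto
  qed
qed

section \<open>Words in the \<open>y j\<close> and paths to nonzero elements\<close>

definition yprod :: "nat list \<Rightarrow> 'a" where
  "yprod js = foldr (\<lambda>j t. y j \<otimes> t) js \<one>"

definition ysum :: "nat list \<Rightarrow> int" where
  "ysum js = sum_list (map ydeg js)"

lemma yprod_simps [simp]: "yprod [] = \<one>" "yprod (j # js) = y j \<otimes> yprod js"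
  by (simp_all add: yprod_def)

lemma ysum_simps [simp]: "ysum [] = 0" "ysum (j # js) = ydeg j + ysum js"
  by (simp_all add: ysum_def)

lemma yprod_carrier [simp]: "set js \<subseteq> {1..c} \<Longrightarrow> yprod js \<in> carrier T"
  by (induction js) (auto simp: y_carrier)

lemma yprod_remove1:
  "set js \<subseteq> {1..c} \<Longrightarrow> j \<in> set js \<Longrightarrow> yprod js = y j \<otimes> yprod (remove1 j js)"
proof (induction js)
  case (Cons i js)
  show ?case
  proof (cases "i = j")
    case False
    then have "set (remove1 j js) \<subseteq> {1..c}" using Cons.prems set_remove1_subset by fastforce
    then show ?thesis using Cons False
      by (auto simp: y_carrier intro!: m_lcomm)
  qed simp
qed simp

lemma ysum_remove1: "j \<in> set js \<Longrightarrow> ysum js = ydeg j + ysum (remove1 j js)"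
  unfolding ysum_def by (rule sum_list_map_remove1)

lemma yprod_filter:
  assumes "set js \<subseteq> {1..c}" "j \<in> {1..c}"
  shows "yprod js = (y j [^] count_list js j) \<otimes> yprod (filter (\<lambda>i. i \<noteq> j) js)"
  using assms(1)
proof (induction js)
  case (Cons i js)
  have c: "set (filter (\<lambda>i. i \<noteq> j) js) \<subseteq> {1..c}" using Cons.prems by auto
  note c' = yprod_carrier[OF c] nat_pow_closed[OF y_carrier[OF assms(2)]] y_carrier[OF assms(2)]
  show ?case
  proof (cases "i = j")
    case True
    then show ?thesis using Cons c' by (simp add: m_ac)
  next
    case False
    have "y i \<in> carrier T" using Cons.prems y_carrier by auto
    then show ?thesis using Cons c' False by (simp add: m_lcomm)
  qed
qed (simp add: y_carrier)

lemma yprod_degree: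
  assumes K: "stable L gens K" and "set js \<subseteq> {1..c}" "z \<in> K \<inter> L_deg (n, l)"
  shows "yprod js \<odot>\<^bsub>L\<^esub> z \<in> K \<inter> L_deg (n + int (length js), l + ysum js)"
  using assms(2)
proof (induction js)
  case Nil
  then show ?case using assms(3) stableD(6)[OF K] by auto
next
  case (Cons j js)
  then have j: "j \<in> {1..c}" and IH: "yprod js \<odot>\<^bsub>L\<^esub> z \<in> K \<inter> L_deg (n + int (length js), l + ysum js)" by auto
  have "y j \<odot>\<^bsub>L\<^esub> (yprod js \<odot>\<^bsub>L\<^esub> z) \<in> K \<inter> L_deg ((1, ydeg j) + (n + int (length js), l + ysum js))"
    using smult_degree[OF y_degree[OF j]] IH stableD(5)[OF K] j by blast
  moreover have "yprod (j # js) \<odot>\<^bsub>L\<^esub> z = y j \<odot>\<^bsub>L\<^esub> (yprod js \<odot>\<^bsub>L\<^esub> z)"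
    using Cons.prems y_carrier[OF j] assms(3) stableD(6)[OF K] by (auto simp: smult_assoc1)
  ultimately show ?case by (simp add: algebra_simps)
qed

text \<open>A class outside a colon of \<open>N\<close> forces one generator outside it, so each
  step yields a single letter and never a sum. The factor \<open>w\<close> accumulates the letters
  already found, which is why the induction varies it.\<close>

lemma path_from_generators:
  assumes N: "stable L gens N"
    and n0: "\<And>n l H. n \<ge> n0 \<Longrightarrow> stable L {} H \<Longrightarrow>
      (\<forall>j\<in>{1..c}. \<forall>z \<in> K \<inter> L_deg (n, l - ydeg j). y j \<odot>\<^bsub>L\<^esub> z \<in> H) \<Longrightarrow> K \<inter> L_deg (n + 1, l) \<subseteq> H"
    and z: "z \<in> K \<inter> L_deg (n0 + int m, l)" "w \<in> carrier T" "w \<odot>\<^bsub>L\<^esub> z \<notin> N"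
  shows "\<exists>js z'. set js \<subseteq> {1..c} \<and> length js = m \<and> z' \<in> K \<inter> L_deg (n0, l - ysum js) \<and>
    w \<odot>\<^bsub>L\<^esub> (yprod js \<odot>\<^bsub>L\<^esub> z') \<notin> N"
  using z
proof (induction m arbitrary: z l w)
  case 0
  then have "z \<in> carrier L" using Md.summand_carrier by blast
  then show ?case using 0 by (intro exI[of _ "[]"] exI[of _ z]) auto
next
  case (Suc m)
  define H where "H = {z \<in> carrier L. w \<odot>\<^bsub>L\<^esub> z \<in> N}"
  have H: "stable L {} H"
    unfolding H_def by (rule stable_vimage) (use Suc.prems N stable_mono in auto)
  have "z \<in> K \<inter> L_deg (n0 + int m + 1, l)" using Suc.prems(1) by (simp add: algebra_simps)
  moreover have "z \<notin> H" using Suc.prems unfolding H_def by simp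
  ultimately have "\<not> (\<forall>j\<in>{1..c}. \<forall>z \<in> K \<inter> L_deg (n0 + int m, l - ydeg j). y j \<odot>\<^bsub>L\<^esub> z \<in> H)"
    using n0[of "n0 + int m" H l] H by fastforce
  then obtain j z1 where j: "j \<in> {1..c}" and z1: "z1 \<in> K \<inter> L_deg (n0 + int m, l - ydeg j)"
    and "y j \<odot>\<^bsub>L\<^esub> z1 \<notin> H"
    by blast
  have c: "z1 \<in> carrier L" "y j \<in> carrier T" using z1 Md.summand_carrier y_carrier[OF j] by blast+
  then have "(w \<otimes> y j) \<odot>\<^bsub>L\<^esub> z1 \<notin> N"
    using \<open>y j \<odot>\<^bsub>L\<^esub> z1 \<notin> H\<close> Suc.prems(2) unfolding H_def by (simp add: smult_assoc1)
  then obtain js z' where js: "set js \<subseteq> {1..c}" "length js = m" "z' \<in> K \<inter> L_deg (n0, l - ydeg j - ysum js)"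
    "(w \<otimes> y j) \<odot>\<^bsub>L\<^esub> (yprod js \<odot>\<^bsub>L\<^esub> z') \<notin> N"
    using Suc.IH[OF z1, of "w \<otimes> y j"] Suc.prems(2) c by blast
  have "z' \<in> carrier L" using js Md.summand_carrier by blast
  then have "(w \<otimes> y j) \<odot>\<^bsub>L\<^esub> (yprod js \<odot>\<^bsub>L\<^esub> z') = w \<odot>\<^bsub>L\<^esub> (yprod (j # js) \<odot>\<^bsub>L\<^esub> z')"
    using js(1) c Suc.prems(2) by (simp add: smult_assoc1)
  then show ?case using js j by (intro exI[of _ "j # js"] exI[of _ z']) (simp add: algebra_simps)
qed

text \<open>Letters in \<open>Q\<close> contribute at least \<open>0\<close>, the others at least
  \<open>q\<close>. Here \<open>Q\<close> will be nilpotency on the subquotient, with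
  \<open>q\<close> first the least relevant degree \<open>D\<close> and then
  \<open>D + 1\<close>.\<close>

lemma ysum_lower_bound:
  assumes "set js \<subseteq> {1..c}" "\<forall>j\<in>set js. Q j \<or> q \<le> ydeg j" "q \<ge> 0"
  shows "q * (int (length js) - int (length (filter Q js))) \<le> ysum js"
  using assms(1,2)
proof (induction js)
  case (Cons j js)
  then have "q * (int (length js) - int (length (filter Q js))) \<le> ysum js" "0 \<le> ydeg j" "Q j \<or> q \<le> ydeg j"
    using ydeg_nonneg by auto
  then show ?case using assms(3) by (cases "Q j") (auto simp: algebra_simps)
qed simp

lemma finite_non_nilpotent: "finite (non_nilpotent K N)"
  unfolding non_nilpotent_def by simp

lemma stable_pow: "stable L gens N \<Longrightarrow> j \<in> {1..c} \<Longrightarrow> z \<in> N \<Longrightarrow> (y j [^] (k::nat)) \<odot>\<^bsub>L\<^esub> z \<in> N"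
proof (induction k)
  case 0
  then show ?case using stableD(6) by fastforce
next
  case (Suc k)
  have "(y j [^] Suc k) \<odot>\<^bsub>L\<^esub> z = y j \<odot>\<^bsub>L\<^esub> ((y j [^] k) \<odot>\<^bsub>L\<^esub> z)"
    using Suc.prems y_carrier[of j] stableD(6)[of L gens N z]
    by (simp add: smult_assoc1 smult_left_commute[of "y j" "y j [^] k"])
  then show ?case using Suc stableD(5)[of L gens N "y j"] by auto
qed

lemma smult_pow_add:
  "j \<in> {1..c} \<Longrightarrow> z \<in> carrier L \<Longrightarrow>
    (y j [^] (k::nat)) \<odot>\<^bsub>L\<^esub> ((y j [^] (m::nat)) \<odot>\<^bsub>L\<^esub> z) = (y j [^] (k + m)) \<odot>\<^bsub>L\<^esub> z"
  using y_carrier[of j] by (simp add: smult_assoc1[symmetric] nat_pow_mult)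

lemma nilpotent_uniform:
  assumes N: "stable L gens N"
  obtains k :: nat where "\<And>j u z. j \<in> {1..c} - non_nilpotent K N \<Longrightarrow> z \<in> K \<inter> L_deg u \<Longrightarrow>
    (y j [^] k) \<odot>\<^bsub>L\<^esub> z \<in> N"
proof -
  have "\<forall>j \<in> {1..c} - non_nilpotent K N. \<exists>k::nat. \<forall>u. \<forall>z \<in> K \<inter> L_deg u. (y j [^] k) \<odot>\<^bsub>L\<^esub> z \<in> N"
    unfolding non_nilpotent_def nilpotent_on_def by blast
  then obtain \<kappa> :: "nat \<Rightarrow> nat" where \<kappa>: "\<And>j u z. j \<in> {1..c} - non_nilpotent K N \<Longrightarrow> z \<in> K \<inter> L_deg u \<Longrightarrow>
    (y j [^] \<kappa> j) \<odot>\<^bsub>L\<^esub> z \<in> N"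
    by metis
  \<comment> \<open>The sum serves as a common upper bound for the finitely many exponents.\<close>
  define k where "k = (\<Sum>j\<in>{1..c}. \<kappa> j)"
  have "(y j [^] k) \<odot>\<^bsub>L\<^esub> z \<in> N" if j: "j \<in> {1..c} - non_nilpotent K N" and z: "z \<in> K \<inter> L_deg u" for j u z
  proof -
    have "\<kappa> j \<le> k" unfolding k_def using j by (intro member_le_sum) auto
    then have "k = (k - \<kappa> j) + \<kappa> j" by simp
    then have "(y j [^] k) \<odot>\<^bsub>L\<^esub> z = (y j [^] (k - \<kappa> j)) \<odot>\<^bsub>L\<^esub> ((y j [^] \<kappa> j) \<odot>\<^bsub>L\<^esub> z)"
      using smult_pow_add[of j z] j z Md.summand_carrier by (metis DiffD1 IntD2)
    then show ?thesis using stable_pow[OF N _ \<kappa>[OF j z]] j by auto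
  qed
  then show thesis using that by blast
qed

text \<open>\<open>k\<close> steps with the same \<open>y\<^sub>j\<close> already annihilate \<open>K / N\<close> when \<open>y\<^sub>j\<close> is nilpotent on it, so only
  boundedly many factors of a path to a nonzero element can be nilpotent.\<close>

lemma nonzero_path:
  assumes K: "stable L gens K" and N: "stable L gens N"
  obtains n0 :: int and q :: nat and C :: int where
    "\<forall>m l. nonzero_at K N (n0 + int m) l \<longrightarrow> (\<exists>js l' z. set js \<subseteq> {1..c} \<and> length js = m \<and>
      z \<in> K \<inter> L_deg (n0, l') \<and> yprod js \<odot>\<^bsub>L\<^esub> z \<notin> N \<and> l = l' + ysum js \<and> C \<le> l' \<and>
      length (filter (\<lambda>j. j \<notin> non_nilpotent K N) js) \<le> q)"
proof -
  obtain n0 where n0: "\<And>n l H. n \<ge> n0 \<Longrightarrow> stable L {} H \<Longrightarrow>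
      (\<forall>j\<in>{1..c}. \<forall>z \<in> K \<inter> L_deg (n, l - ydeg j). y j \<odot>\<^bsub>L\<^esub> z \<in> H) \<Longrightarrow> K \<inter> L_deg (n + 1, l) \<subseteq> H"
    using eventually_generated[OF K] by blast
  obtain k :: nat where k: "\<And>j u z. j \<in> {1..c} - non_nilpotent K N \<Longrightarrow> z \<in> K \<inter> L_deg u \<Longrightarrow>
    (y j [^] k) \<odot>\<^bsub>L\<^esub> z \<in> N"
    using nilpotent_uniform[OF N] by blast
  obtain C where C: "\<And>z n l. z \<in> carrier L \<Longrightarrow> l < C \<Longrightarrow> lcp z (n, l) = \<zero>\<^bsub>L\<^esub>"
    using degree_bounded_below by blast
  have "\<exists>js l' z. set js \<subseteq> {1..c} \<and> length js = m \<and>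
      z \<in> K \<inter> L_deg (n0, l') \<and> yprod js \<odot>\<^bsub>L\<^esub> z \<notin> N \<and> l = l' + ysum js \<and> C \<le> l' \<and>
      length (filter (\<lambda>j. j \<notin> non_nilpotent K N) js) \<le> c * k"
    if "nonzero_at K N (n0 + int m) l" for m l
  proof -
    obtain z where z: "z \<in> K \<inter> L_deg (n0 + int m, l)" "z \<notin> N" using \<open>nonzero_at _ _ _ _\<close> unfolding nonzero_at_def by blast
    then have "\<one> \<odot>\<^bsub>L\<^esub> z \<notin> N" using stableD(6)[OF K] by auto
    with path_from_generators[OF N n0 z(1) one_closed] obtain js z' where
      js: "set js \<subseteq> {1..c}" "length js = m" "z' \<in> K \<inter> L_deg (n0, l - ysum js)"
      "\<one> \<odot>\<^bsub>L\<^esub> (yprod js \<odot>\<^bsub>L\<^esub> z') \<notin> N" by blast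
    have z'c: "z' \<in> carrier L" using js Md.summand_carrier by blast
    then have nz: "yprod js \<odot>\<^bsub>L\<^esub> z' \<notin> N" using js by simp
    \<comment> \<open>A starting degree below \<open>C\<close> would make \<open>z'\<close>, and
      with it the whole product, vanish.\<close>
    have "C \<le> l - ysum js"
    proof (rule ccontr)
      assume "\<not> C \<le> l - ysum js"
      then have "z' = \<zero>\<^bsub>L\<^esub>" using C[of z' "l - ysum js" n0] z'c js(3) Md.component_homogeneous[of z'] by auto
      then show False using nz js(1) stableD(2)[OF N] by simp
    qed
    moreover have "length (filter (\<lambda>j. j \<notin> non_nilpotent K N) js) \<le> c * k"
    proof -
      let ?js = "filter (\<lambda>j. j \<notin> non_nilpotent K N) js"
      let ?A = "{1..c} - non_nilpotent K N"
      have cl: "count_list ?js j \<le> k" if j: "j \<in> ?A" for j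
      proof (rule ccontr)
        assume "\<not> count_list ?js j \<le> k"
        moreover have "count_list ?js j = count_list js j" using j
          by (induction js) auto
        ultimately have ck: "count_list js j = (count_list js j - k) + k" by simp
        \<comment> \<open>The exponent \<open>k\<close> is only known to work on homogeneous
          elements of \<open>K\<close>, so the rest of the word must first be shown to give
          one.\<close>
        let ?w = "yprod (filter (\<lambda>i. i \<noteq> j) js) \<odot>\<^bsub>L\<^esub> z'"
        have fs: "set (filter (\<lambda>i. i \<noteq> j) js) \<subseteq> {1..c}" using js(1) by auto
        then have w: "?w \<in> K \<inter> L_deg (n0 + int (length (filter (\<lambda>i. i \<noteq> j) js)), l - ysum js + ysum (filter (\<lambda>i. i \<noteq> j) js))"
          using yprod_degree[OF K fs js(3)] by simp
        have "yprod js \<odot>\<^bsub>L\<^esub> z' = (y j [^] count_list js j) \<odot>\<^bsub>L\<^esub> ?w"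
          using yprod_filter[OF js(1), of j] j fs z'c y_carrier[of j] by (simp add: smult_assoc1)
        also have "\<dots> = (y j [^] (count_list js j - k)) \<odot>\<^bsub>L\<^esub> ((y j [^] k) \<odot>\<^bsub>L\<^esub> ?w)"
          using smult_pow_add[of j ?w "count_list js j - k" k] ck j fs z'c by simp
        also have "\<dots> \<in> N" using stable_pow[OF N _ k[OF j w]] j by blast
        finally show False using nz by simp
      qed
      have "set ?js \<subseteq> ?A" using js(1) by auto
      then have "length ?js = (\<Sum>j\<in>?A. count_list ?js j)" using sum_count_set[of ?js ?A] by simp
      also have "\<dots> \<le> of_nat (card ?A) * k" by (rule sum_bounded_above) (rule cl)
      also have "\<dots> = card ?A * k" by simp
      also have "\<dots> \<le> c * k" using card_mono[of "{1..c}" ?A] by (intro mult_right_mono) auto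
      finally show ?thesis .
    qed
    ultimately show ?thesis using js nz by (intro exI[of _ js] exI[of _ "l - ysum js"] exI[of _ z']) simp
  qed
  then show thesis using that by blast
qed

text \<open>If every \<open>y j\<close> is nilpotent on the subquotient, all letters of a path are
  counted by \<open>q\<close>, and no path is longer than \<open>q\<close>.\<close>

lemma eventually_zero:
  assumes "stable L gens K" "stable L gens N" "non_nilpotent K N = {}"
  shows "\<forall>\<^sub>F n in at_top. \<forall>l. \<not> nonzero_at K N n l"
proof -
  obtain n0 :: int and q :: nat and C :: int where path:
    "\<forall>m l. nonzero_at K N (n0 + int m) l \<longrightarrow> (\<exists>js l' z. set js \<subseteq> {1..c} \<and> length js = m \<and>
      z \<in> K \<inter> L_deg (n0, l') \<and> yprod js \<odot>\<^bsub>L\<^esub> z \<notin> N \<and> l = l' + ysum js \<and> C \<le> l' \<and>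
      length (filter (\<lambda>j. j \<notin> non_nilpotent K N) js) \<le> q)"
    by (rule nonzero_path[OF assms(1,2)])
  have "\<not> nonzero_at K N n l" if "n \<ge> n0 + int q + 1" for n l
    using path[rule_format, of "nat (n - n0)" l] that assms(3) by auto
  then show ?thesis unfolding eventually_at_top_linorder by blast
qed

text \<open>Non-nilpotency only gives a separate element for each exponent. The colons of
  \<open>N\<close> by powers of \<open>y j\<close> stop growing at some \<open>k0\<close>, so an
  element surviving the exponent \<open>k0\<close> survives all.\<close>

lemma persistent_element:
  assumes N: "stable L gens N" and j: "j \<in> non_nilpotent K N"
  obtains u z where "z \<in> K \<inter> L_deg u" "\<And>k::nat. (y j [^] k) \<odot>\<^bsub>L\<^esub> z \<notin> N"
proof -
  have j': "j \<in> {1..c}" using j unfolding non_nilpotent_def by blast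
  define V where "V k = {z \<in> carrier L. (y j [^] k) \<odot>\<^bsub>L\<^esub> z \<in> N}" for k :: nat
  have V_st: "stable L gens (V k)" for k
    unfolding V_def by (rule stable_vimage[OF N _ gens_carrier(1)]) (use y_carrier[OF j'] in auto)
  have V_c: "V k \<subseteq> carrier L" for k unfolding V_def by blast
  have V_le: "V k \<subseteq> V (m + k)" for k m
  proof
    fix z assume "z \<in> V k"
    then have z: "z \<in> carrier L" "(y j [^] k) \<odot>\<^bsub>L\<^esub> z \<in> N" unfolding V_def by auto
    then show "z \<in> V (m + k)"
      unfolding V_def using smult_pow_add[OF j' z(1), of m k] stable_pow[OF N j' z(2), of m] by simp
  qed
  have V_Suc: "V k \<subseteq> V (Suc k)" for k using V_le[of k 1] by simp
  obtain k0 where k0: "\<forall>k\<ge>k0. V k = V k0"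
    using acc_onD[where f = V, OF acc_L V_st V_c V_Suc] ..
  obtain u z where z: "z \<in> K \<inter> L_deg u" "(y j [^] k0) \<odot>\<^bsub>L\<^esub> z \<notin> N"
    using j unfolding non_nilpotent_def nilpotent_on_def by blast
  have "z \<notin> V k" for k
  proof
    assume "z \<in> V k"
    then have "z \<in> V (k0 + k)" using V_le by blast
    then have "z \<in> V k0" using k0 le_add1 by blast
    then show False using z unfolding V_def by blast
  qed
  then show thesis using that[OF z(1)] z Md.summand_carrier unfolding V_def by blast
qed

lemma pow_degree:
  assumes j: "j \<in> {1..c}" and K: "stable L gens K" and z: "z \<in> K \<inter> L_deg (n, l)"
  shows "(y j [^] k) \<odot>\<^bsub>L\<^esub> z \<in> K \<inter> L_deg (n + int k, l + ydeg j * int k)"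
proof (induction k)
  case 0
  then show ?case using z Md.summand_carrier by auto
next
  case (Suc k)
  have "z \<in> carrier L" using z Md.summand_carrier by blast
  then have "(y j [^] Suc k) \<odot>\<^bsub>L\<^esub> z = y j \<odot>\<^bsub>L\<^esub> ((y j [^] k) \<odot>\<^bsub>L\<^esub> z)"
    using y_carrier[OF j] by (simp add: smult_assoc1 smult_left_commute[of "y j" "y j [^] k"])
  moreover have "y j \<odot>\<^bsub>L\<^esub> ((y j [^] k) \<odot>\<^bsub>L\<^esub> z) \<in> K \<inter> L_deg ((1, ydeg j) + (n + int k, l + ydeg j * int k))"
    using smult_degree[OF y_degree[OF j]] Suc stableD(5)[OF K] j by blast
  ultimately show ?case by (simp add: algebra_simps)
qed

lemma eventually_least_degree:
  assumes K: "stable L gens K" and N: "stable L gens N" and ne: "non_nilpotent K N \<noteq> {}"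
  defines "D \<equiv> ydeg (Min (non_nilpotent K N))"
  obtains b where "\<forall>\<^sub>F n in at_top. nonzero_at K N n (D * n + b) \<and>
    (\<forall>l < D * n + b. \<not> nonzero_at K N n l)"
proof -
  let ?J = "non_nilpotent K N"
  have J: "?J \<subseteq> {1..c}" unfolding non_nilpotent_def by blast
  have MinJ: "Min ?J \<in> ?J" using finite_non_nilpotent ne by simp
  have D0: "D \<ge> 0" using ydeg_nonneg MinJ J unfolding D_def by blast
  have D_le: "D \<le> ydeg j" if "j \<in> ?J" for j
  proof -
    have "Min ?J \<le> j" using finite_non_nilpotent that by simp
    then show ?thesis unfolding D_def using ydeg_mono[of "Min ?J" j] subsetD[OF J that] subsetD[OF J MinJ] by simp
  qed
  obtain n0 :: int and q :: nat and C :: int where path: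
    "\<forall>m l. nonzero_at K N (n0 + int m) l \<longrightarrow> (\<exists>js l' z. set js \<subseteq> {1..c} \<and> length js = m \<and>
      z \<in> K \<inter> L_deg (n0, l') \<and> yprod js \<odot>\<^bsub>L\<^esub> z \<notin> N \<and> l = l' + ysum js \<and> C \<le> l' \<and>
      length (filter (\<lambda>j. j \<notin> non_nilpotent K N) js) \<le> q)"
    by (rule nonzero_path[OF K N])
  \<comment> \<open>A path from \<open>n0\<close> to \<open>n\<close> starts at degree at least
    \<open>C\<close>, and all but at most \<open>q\<close> of its \<open>n - n0\<close> letters have
    degree at least \<open>D\<close>.\<close>
  define emin where "emin = C - D * int q - D * n0"
  have lower: "D * n + emin \<le> l" if "n \<ge> n0" "nonzero_at K N n l" for n l
  proof -
    have "nonzero_at K N (n0 + int (nat (n - n0))) l" using that by simp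
    then obtain js l' where js: "set js \<subseteq> {1..c}" "length js = nat (n - n0)" "l = l' + ysum js" "C \<le> l'"
      "length (filter (\<lambda>j. j \<notin> ?J) js) \<le> q"
      using path by blast
    have "D * (int (length js) - int (length (filter (\<lambda>j. j \<notin> ?J) js))) \<le> ysum js"
      by (rule ysum_lower_bound) (use js D_le D0 in auto)
    moreover have "D * (n - n0 - int q) \<le> D * (int (length js) - int (length (filter (\<lambda>j. j \<notin> ?J) js)))"
      by (rule mult_left_mono) (use js D0 that in auto)
    ultimately show ?thesis using js unfolding emin_def by (simp add: algebra_simps)
  qed
  define P where "P e n \<longleftrightarrow> nonzero_at K N n (D * n + e)" for e n
  have down: "\<exists>\<nu>. \<forall>n\<ge>\<nu>. P e (n + 1) \<longrightarrow> P e n" for e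
  proof -
    \<comment> \<open>Without a letter of degree \<open>D\<close>, all but at most \<open>q\<close>
      letters would have degree at least \<open>D + 1\<close>; comparing with
      \<open>D * (n + 1) + e\<close> gives
      \<open>n + 1 \<le> (D + 1) * (n0 + int q) + e - C\<close>, which \<open>n \<ge> \<nu>\<close>
      rules out.\<close>
    define \<nu> where "\<nu> = max n0 ((D + 1) * (n0 + int q) + e - C)"
    have "P e n" if n: "n \<ge> \<nu>" and P: "P e (n + 1)" for n
    proof -
      have nn: "n \<ge> n0" using n unfolding \<nu>_def by simp
      define m where "m = nat (n + 1 - n0)"
      have m: "n + 1 = n0 + int m" using nn unfolding m_def by simp
      obtain js l' z where js: "set js \<subseteq> {1..c}" "length js = m" "z \<in> K \<inter> L_deg (n0, l')"
        "yprod js \<odot>\<^bsub>L\<^esub> z \<notin> N" "D * (n + 1) + e = l' + ysum js" "C \<le> l'"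
        "length (filter (\<lambda>j. j \<notin> ?J) js) \<le> q"
        using path P unfolding P_def m by blast
      have "\<exists>j \<in> set js. ydeg j = D \<and> j \<in> ?J"
      proof (rule ccontr)
        assume contra: "\<not> ?thesis"
        have "(D + 1) * (int (length js) - int (length (filter (\<lambda>j. j \<notin> ?J) js))) \<le> ysum js"
          by (rule ysum_lower_bound) (use js D_le D0 contra in force)+
        moreover have "(D + 1) * (int m - int q) \<le> (D + 1) * (int (length js) - int (length (filter (\<lambda>j. j \<notin> ?J) js)))"
          by (rule mult_left_mono) (use js D0 in auto)
        ultimately have "(D + 1) * (n + 1 - n0 - int q) \<le> D * (n + 1) + e - C" using js m by simp
        then have "n + 1 \<le> (D + 1) * (n0 + int q) + e - C" by (simp add: algebra_simps)
        then show False using n unfolding \<nu>_def by simp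
      qed
      then obtain j where j: "j \<in> set js" "ydeg j = D" "j \<in> {1..c}" using J by blast
      have rs: "set (remove1 j js) \<subseteq> {1..c}" using js(1) set_remove1_subset by fast
      let ?w = "yprod (remove1 j js) \<odot>\<^bsub>L\<^esub> z"
      have "?w \<in> K \<inter> L_deg (n0 + int (length (remove1 j js)), l' + ysum (remove1 j js))"
        by (rule yprod_degree[OF K rs js(3)])
      moreover have "n0 + int (length (remove1 j js)) = n"
      proof -
        have "length js > 0" using j(1) by (cases js) auto
        then show ?thesis using j js m by (simp add: length_remove1)
      qed
      moreover have "l' + ysum (remove1 j js) = D * n + e"
        using ysum_remove1[OF j(1)] j js(5) by (simp add: algebra_simps)
      moreover have "?w \<notin> N"
      proof
        assume "?w \<in> N"
        then have "y j \<odot>\<^bsub>L\<^esub> ?w \<in> N" using stableD(5)[OF N] j(3) by blast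
        moreover have "y j \<odot>\<^bsub>L\<^esub> ?w = yprod js \<odot>\<^bsub>L\<^esub> z"
          using yprod_remove1[OF js(1) j(1)] y_carrier[OF j(3)] yprod_carrier[OF rs]
            Md.summand_carrier[OF IntD2[OF js(3)]] by (simp add: smult_assoc1)
        ultimately show False using js(4) by simp
      qed
      ultimately show ?thesis unfolding P_def nonzero_at_def by metis
    qed
    then show ?thesis by blast
  qed
  \<comment> \<open>Beyond \<open>\<nu>\<close> truth passes downwards, so one failure entails
    failure at all later \<open>n\<close>.\<close>
  have stab: "(\<forall>\<^sub>F n in at_top. P e n) \<or> (\<forall>\<^sub>F n in at_top. \<not> P e n)" for e
  proof -
    obtain \<nu> where \<nu>: "\<And>n. n \<ge> \<nu> \<Longrightarrow> P e (n + 1) \<Longrightarrow> P e n" using down by blast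
    have dn: "P e n" if "P e m" "n \<le> m" "\<nu> \<le> n" for n m
      using that(2,1)
    proof (induction rule: int_ge_induct)
      case (step i) then show ?case using \<nu>[of i] that(3) by simp
    qed simp
    show ?thesis
    proof (cases "\<forall>n\<ge>\<nu>. P e n")
      case True then show ?thesis unfolding eventually_at_top_linorder by blast
    next
      case False
      then obtain n where "n \<ge> \<nu>" "\<not> P e n" by blast
      then have "\<forall>m\<ge>n. \<not> P e m" using dn by blast
      then show ?thesis unfolding eventually_at_top_linorder by blast
    qed
  qed
  obtain u z where z: "z \<in> K \<inter> L_deg u" "\<And>k::nat. (y (Min ?J) [^] k) \<odot>\<^bsub>L\<^esub> z \<notin> N"
    using persistent_element[OF N MinJ] by blast
  \<comment> \<open>The intercept of the line of slope \<open>D\<close> through \<open>u\<close>,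
    along which powers of \<open>y (Min ?J)\<close> carry the persistent \<open>z\<close>.\<close>
  define e0 where "e0 = snd u - D * fst u"
  have ev0: "P e0 n" if "n \<ge> fst u" for n
  proof -
    have "(y (Min ?J) [^] nat (n - fst u)) \<odot>\<^bsub>L\<^esub> z \<in> K \<inter> L_deg (fst u + int (nat (n - fst u)), snd u + D * int (nat (n - fst u)))"
      unfolding D_def by (rule pow_degree[OF _ K]) (use z MinJ J in auto)
    then have "(y (Min ?J) [^] nat (n - fst u)) \<odot>\<^bsub>L\<^esub> z \<in> K \<inter> L_deg (n, D * n + e0)"
      using that unfolding e0_def by (simp add: algebra_simps)
    then show ?thesis unfolding P_def nonzero_at_def using z(2) by blast
  qed
  then have ev0': "\<forall>\<^sub>F n in at_top. P e0 n" unfolding eventually_at_top_linorder by blast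
  have e0: "emin \<le> e0"
    using lower[of "max n0 (fst u)" "D * max n0 (fst u) + e0"] ev0[of "max n0 (fst u)"] unfolding P_def by simp
  \<comment> \<open>\<open>e0\<close> makes this set nonempty and the window makes it finite, so a
    least intercept exists.\<close>
  define S where "S = {e \<in> {emin..e0}. \<forall>\<^sub>F n in at_top. P e n}"
  define b where "b = Min S"
  have "S \<subseteq> {emin..e0}" unfolding S_def by blast
  then have "finite S" using finite_subset by blast
  have "e0 \<in> S" unfolding S_def using ev0' e0 by auto
  then have bS: "b \<in> S" unfolding b_def using Min_in \<open>finite S\<close> by blast
  \<comment> \<open>Intercepts below \<open>emin\<close> are excluded by \<open>lower\<close> for
    all \<open>n \<ge> n0\<close> at once; for the finitely many others the eventual failures can be
    combined.\<close>
  have "\<forall>\<^sub>F n in at_top. \<forall>e\<in>{emin..<b}. \<not> P e n"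
  proof (rule eventually_ball_finite)
    show "\<forall>e\<in>{emin..<b}. \<forall>\<^sub>F n in at_top. \<not> P e n"
    proof
      fix e assume e: "e \<in> {emin..<b}"
      then have "e \<notin> S" using Min_le[OF \<open>finite S\<close>, of e] unfolding b_def by auto
      then show "\<forall>\<^sub>F n in at_top. \<not> P e n" using stab[of e] e bS unfolding S_def by auto
    qed
  qed simp
  moreover have "\<forall>\<^sub>F n in at_top. P b n" using bS unfolding S_def by blast
  moreover have "\<forall>\<^sub>F n in at_top. n \<ge> n0" by (rule eventually_ge_at_top)
  ultimately have "\<forall>\<^sub>F n in at_top. nonzero_at K N n (D * n + b) \<and> (\<forall>l < D * n + b. \<not> nonzero_at K N n l)"
  proof eventually_elim
    case (elim n)
    have "\<not> nonzero_at K N n l" if "l < D * n + b" for l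
    proof
      assume nz: "nonzero_at K N n l"
      then have "l - D * n \<in> {emin..<b}" using lower[OF elim(3) nz] that by auto
      then have "\<not> P (l - D * n) n" using elim(1) by blast
      then show False using nz unfolding P_def by simp
    qed
    then show ?case using elim(2) unfolding P_def by blast
  qed
  then show thesis using that by blast
qed

end

section \<open>Associated primes\<close>

context bigraded_module
begin

definition annR :: "'m \<Rightarrow> 'a set" where
  "annR z = {r \<in> Rc. r \<odot>\<^bsub>L\<^esub> z = \<zero>\<^bsub>L\<^esub>}"

text \<open>Applied to annihilators, which are ideals anyway; for these it amounts to
  \<open>primeideal\<close>, by \<open>primeideal_annR\<close>.\<close>

definition prime_like :: "'a set \<Rightarrow> bool" where
  "prime_like P \<longleftrightarrow> \<one> \<notin> P \<and> (\<forall>a\<in>Rc. \<forall>b\<in>Rc. a \<otimes> b \<in> P \<longrightarrow> a \<in> P \<or> b \<in> P)"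

lemma annR_iff: "r \<in> Rc \<Longrightarrow> r \<in> annR z \<longleftrightarrow> r \<odot>\<^bsub>L\<^esub> z = \<zero>\<^bsub>L\<^esub>"
  unfolding annR_def by simp

lemma annR_sub: "annR z \<subseteq> Rc"
  unfolding annR_def by blast

lemma stable_annR: "z \<in> carrier L \<Longrightarrow> stable (regular_module T) Rc (annR z)"
  by (rule stableI) (use Rc_props in \<open>auto simp: annR_def smult_l_distr smult_l_minus smult_assoc1\<close>)

lemma annR_smult:
  assumes "t \<in> Rc" "w \<in> Rc" "z \<in> carrier L"
  shows "t \<in> annR (w \<odot>\<^bsub>L\<^esub> z) \<longleftrightarrow> t \<otimes> w \<in> annR z"
  using assms Rc_props(4,6) by (simp add: annR_iff smult_assoc1)

lemma annR_mono: "w \<in> carrier T \<Longrightarrow> z \<in> carrier L \<Longrightarrow> annR z \<subseteq> annR (w \<odot>\<^bsub>L\<^esub> z)"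
  unfolding annR_def using Rc_carrier by (auto simp: smult_left_commute[of _ w])

lemma annR_one: "z \<in> carrier L \<Longrightarrow> \<one> \<in> annR z \<longleftrightarrow> z = \<zero>\<^bsub>L\<^esub>"
  using annR_iff[OF Rc_props(2), of z] by simp

text \<open>The lowest component of a multiple of \<open>z\<close> with as few components as
  possible has the right annihilator. It is kept in the form of a component of a multiple so that
  \<open>persistent_prime\<close> can extract a homogeneous multiplier from it.\<close>

lemma homogeneous_part:
  assumes P: "prime_like P" "annR z = P" and z: "z \<in> slice n"
  shows "\<exists>w\<in>Rc. \<exists>l. annR (lcp (w \<odot>\<^bsub>L\<^esub> z) (n, l)) = P"
proof -
  have zc: "z \<in> carrier L" using z unfolding slice_def by blast
  have one: "\<one> \<in> Rc \<and> \<one> \<notin> P" using P(1) Rc_props unfolding prime_like_def by blast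
  \<comment> \<open>Multiplication by an element outside the prime does not change the annihilator,
    so a multiple with minimal support may be chosen.\<close>
  obtain w where w: "w \<in> Rc" "w \<notin> P" and
    min: "\<And>v. v \<in> Rc \<Longrightarrow> v \<notin> P \<Longrightarrow> card (Md.supp (w \<odot>\<^bsub>L\<^esub> z)) \<le> card (Md.supp (v \<odot>\<^bsub>L\<^esub> z))"
    using ex_has_least_nat[of "\<lambda>w. w \<in> Rc \<and> w \<notin> P" \<one> "\<lambda>w. card (Md.supp (w \<odot>\<^bsub>L\<^esub> z))"] one by blast
  define z' where "z' = w \<odot>\<^bsub>L\<^esub> z"
  have z'c: "z' \<in> carrier L" and z's: "z' \<in> slice n"
    using w zc Rc_props(6) slice_smult z unfolding z'_def by auto
  have annz': "annR z' = P"
  proof (intro equalityI subsetI)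
    fix r assume r: "r \<in> annR z'"
    then have "r \<in> Rc" using annR_sub by blast
    then show "r \<in> P" using r annR_smult[OF _ w(1) zc] P w unfolding z'_def prime_like_def by blast
  next
    fix r assume r: "r \<in> P"
    then show "r \<in> annR z'" using annR_mono[of w z] Rc_props(6)[OF w(1)] zc P(2) unfolding z'_def by blast
  qed
  define S where "S = {l. lcp z' (n, l) \<noteq> \<zero>\<^bsub>L\<^esub>}"
  have suppz': "Md.supp z' \<subseteq> Pair n ` S"
  proof
    fix u assume "u \<in> Md.supp z'"
    moreover from this have "fst u = n" using z's unfolding slice_def by blast
    ultimately show "u \<in> Pair n ` S" unfolding S_def by (cases u) auto
  qed
  have "Pair n ` S \<subseteq> Md.supp z'" unfolding S_def by auto
  then have "finite (Pair n ` S)" using Md.finite_supp[OF z'c] finite_subset by blast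
  then have finS: "finite S" by (rule finite_imageD) (simp add: inj_on_def)
  have "S \<noteq> {}"
  proof
    assume "S = {}"
    then have "u \<notin> Md.supp z'" for u using suppz' by blast
    then have "lcp z' u = lcp \<zero>\<^bsub>L\<^esub> u" for u by simp
    then have "z' = \<zero>\<^bsub>L\<^esub>" using Md.component_eqI[OF z'c] by blast
    then show False using annR_one[OF z'c] annz' one by simp
  qed
  define a where "a = Min S"
  have aS: "a \<in> S" and a_le: "\<And>l. l \<in> S \<Longrightarrow> a \<le> l" using finS \<open>S \<noteq> {}\<close> unfolding a_def by auto
  define v where "v = lcp z' (n, a)"
  have vL: "v \<in> L_deg (n, a)" and vc: "v \<in> carrier L"
    unfolding v_def using Md.component_in z'c by auto
  \<comment> \<open>Otherwise \<open>r \<otimes> w\<close> would be an admissible multiplier that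
    loses the component at \<open>(n, a)\<close>, against minimality.\<close>
  have kill: "r \<in> P" if r: "r \<in> Rc" "r \<in> T_deg (0, k)" and rv: "r \<odot>\<^bsub>L\<^esub> v = \<zero>\<^bsub>L\<^esub>" for r k
  proof (rule ccontr)
    assume "r \<notin> P"
    then have "r \<otimes> w \<in> Rc" "r \<otimes> w \<notin> P" using w r Rc_props(4) P(1) unfolding prime_like_def by blast+
    then have le: "card (Md.supp z') \<le> card (Md.supp (r \<odot>\<^bsub>L\<^esub> z'))"
      using min[of "r \<otimes> w"] w r Rc_props(6) zc unfolding z'_def by (simp add: smult_assoc1)
    have "Md.supp (r \<odot>\<^bsub>L\<^esub> z') \<subseteq> (\<lambda>u. u + (0, k)) ` (Md.supp z' - {(n, a)})"
    proof
      fix u assume "u \<in> Md.supp (r \<odot>\<^bsub>L\<^esub> z')"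
      then have "r \<odot>\<^bsub>L\<^esub> lcp z' (u - (0, k)) \<noteq> \<zero>\<^bsub>L\<^esub>"
        using component_smult_homogeneous[OF r(2) z'c] by simp
      then have "u - (0, k) \<in> Md.supp z' - {(n, a)}"
        using rv Rc_props(6)[OF r(1)] unfolding v_def by auto
      then show "u \<in> (\<lambda>u. u + (0, k)) ` (Md.supp z' - {(n, a)})"
        by (rule image_eqI[rotated]) simp
    qed
    then have "card (Md.supp (r \<odot>\<^bsub>L\<^esub> z')) \<le> card ((\<lambda>u. u + (0, k)) ` (Md.supp z' - {(n, a)}))"
      using Md.finite_supp[OF z'c] by (intro card_mono) auto
    also have "\<dots> \<le> card (Md.supp z' - {(n, a)})"
      using Md.finite_supp[OF z'c] by (intro card_image_le) auto
    also have "\<dots> < card (Md.supp z')"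
      using Md.finite_supp[OF z'c] aS unfolding S_def by (intro card_Diff1_less) auto
    finally show False using le by simp
  qed
  have zeroP: "\<zero> \<in> P" using annR_iff[OF Rc_props(1), of z] zc P(2) by simp
  have compz: "t \<odot>\<^bsub>L\<^esub> lcp z' u = \<zero>\<^bsub>L\<^esub>" if t: "t \<in> P" "t \<in> T_deg p" for t p u
  proof -
    have "t \<odot>\<^bsub>L\<^esub> z' = \<zero>\<^bsub>L\<^esub>" using t annz' unfolding annR_def by blast
    then show ?thesis using component_smult_homogeneous[OF t(2) z'c, of "u + p"] by simp
  qed
  \<comment> \<open>\<open>P\<close> is homogeneous. At the lowest bad degree \<open>m\<close>, look
    at the component of \<open>r \<odot> z' = 0\<close> in degree \<open>(n, a + m)\<close>: lower
    components of \<open>r\<close> lie in \<open>P\<close> and kill every component of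
    \<open>z'\<close>, higher ones meet degrees below \<open>a\<close>, so the product with
    \<open>v\<close> is left alone and must vanish.\<close>
  have Pk: "tcp r (0, k) \<in> P" if r: "r \<in> P" for r k
  proof (rule ccontr)
    assume neg: "tcp r (0, k) \<notin> P"
    have rR: "r \<in> Rc" "r \<in> carrier T" using r P(2) annR_sub Rc_props(6) by blast+
    define D where "D = {k. tcp r (0, k) \<notin> P}"
    have "Pair 0 ` D \<subseteq> Rd.supp r" unfolding D_def using zeroP by auto
    then have "finite (Pair (0::int) ` D)" using Rd.finite_supp[OF rR(2)] finite_subset by blast
    then have finD: "finite D" by (rule finite_imageD) (simp add: inj_on_def)
    define m where "m = Min D"
    have "D \<noteq> {}" using neg unfolding D_def by blast
    then have mD: "m \<in> D" and m_le: "\<And>k. k \<in> D \<Longrightarrow> m \<le> k"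
      using finD unfolding m_def by auto
    let ?F = "insert (0, m) (Rd.supp r)"
    let ?f = "\<lambda>i. tcp r i \<odot>\<^bsub>L\<^esub> lcp z' ((n, a + m) - i)"
    have F: "finite ?F" "Rd.supp r \<subseteq> ?F" using Rd.finite_supp[OF rR(2)] by auto
    have "r \<odot>\<^bsub>L\<^esub> z' = \<zero>\<^bsub>L\<^esub>" using r annz' unfolding annR_def by blast
    then have "\<zero>\<^bsub>L\<^esub> = finsum L ?f ?F" using component_smult[OF rR(2) z'c F, of "(n, a + m)"] by simp
    also have "\<dots> = ?f (0, m)"
    proof (rule M.finsum_single)
      fix i :: "int \<times> int" assume i: "i \<noteq> (0, m)"
      obtain i1 k' where ik: "i = (i1, k')" by (cases i)
      consider "i1 \<noteq> 0" | "i1 = 0" "k' < m" | "i1 = 0" "k' > m" using i ik by fastforce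
      then show "?f i = \<zero>\<^bsub>L\<^esub>"
      proof cases
        case 1
        then show ?thesis using Rc_component(2)[OF rR(1), of i] ik z'c by simp
      next
        case 2
        then have "tcp r i \<in> P" using m_le[of k'] ik unfolding D_def by force
        then show ?thesis using compz Rd.component_in[OF rR(2)] by blast
      next
        case 3
        then have "a + m - k' \<notin> S" using a_le[of "a + m - k'"] by auto
        then have "lcp z' ((n, a + m) - i) = \<zero>\<^bsub>L\<^esub>" using ik 3 unfolding S_def by simp
        then show ?thesis using rR by simp
      qed
    qed (use F rR z'c in auto)
    also have "\<dots> = tcp r (0, m) \<odot>\<^bsub>L\<^esub> v" unfolding v_def by simp
    finally have "tcp r (0, m) \<in> P"
      using kill[OF Rc_component(1)[OF rR(1)] Rd.component_in[OF rR(2)]] by simp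
    then show False using mD unfolding D_def by simp
  qed
  have "annR v = P"
  proof (intro equalityI subsetI)
    fix r assume r: "r \<in> annR v"
    then have rR: "r \<in> Rc" "r \<in> carrier T" "r \<odot>\<^bsub>L\<^esub> v = \<zero>\<^bsub>L\<^esub>"
      using annR_sub Rc_props(6) unfolding annR_def by blast+
    have tP: "tcp r u \<in> P" for u
    proof (cases "fst u = 0")
      case True
      have "tcp r u \<odot>\<^bsub>L\<^esub> v = \<zero>\<^bsub>L\<^esub>"
        using component_smult_right[OF rR(2) vL, of "u + (n, a)"] rR(3) by simp
      moreover have "tcp r u \<in> T_deg (0, snd u)"
        using Rd.component_in[OF rR(2), of u] True by (cases u) auto
      ultimately show ?thesis using kill Rc_component(1)[OF rR(1)] by blast
    next
      case False then show ?thesis using Rc_component(2)[OF rR(1)] zeroP by simp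
    qed
    have e: "lcp (r \<odot>\<^bsub>L\<^esub> z') u = lcp \<zero>\<^bsub>L\<^esub> u" for u
      using component_smult[OF rR(2) z'c Rd.finite_supp[OF rR(2)] subset_refl, of u]
        compz[OF tP Rd.component_in[OF rR(2)]] by simp
    have "r \<odot>\<^bsub>L\<^esub> z' = \<zero>\<^bsub>L\<^esub>" by (rule Md.component_eqI[OF _ _ e]) (use rR z'c in auto)
    then show "r \<in> P" using annz' annR_iff[OF rR(1)] by blast
  next
    fix r assume r: "r \<in> P"
    have rR: "r \<in> Rc" "r \<in> carrier T" using r P(2) annR_sub Rc_props(6) by blast+
    have "tcp r u \<odot>\<^bsub>L\<^esub> v = \<zero>\<^bsub>L\<^esub>" for u
    proof (cases "fst u = 0")
      case True
      then have "tcp r u \<in> P" using Pk[OF r, of "snd u"] by (cases u) auto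
      then show ?thesis unfolding v_def using compz Rd.component_in[OF rR(2)] by blast
    next
      case False then show ?thesis using Rc_component(2)[OF rR(1)] vc by simp
    qed
    then have e: "lcp (r \<odot>\<^bsub>L\<^esub> v) u = lcp \<zero>\<^bsub>L\<^esub> u" for u
      using component_smult_right[OF rR(2) vL, of u] by simp
    have "r \<odot>\<^bsub>L\<^esub> v = \<zero>\<^bsub>L\<^esub>" by (rule Md.component_eqI[OF _ _ e]) (use rR vc in auto)
    then show "r \<in> annR v" using annR_iff[OF rR(1)] by blast
  qed
  then show ?thesis using w(1) unfolding v_def z'_def by blast
qed

section \<open>The subquotient attached to a prime\<close>

definition prime_kernel :: "'a set \<Rightarrow> 'm set" where
  "prime_kernel P = {z \<in> carrier L. \<forall>r\<in>P. r \<odot>\<^bsub>L\<^esub> z = \<zero>\<^bsub>L\<^esub>}"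

text \<open>For prime \<open>P\<close>, the kernel of the localisation of \<open>L\<close> at
  \<open>P\<close>.\<close>

definition prime_torsion :: "'a set \<Rightarrow> 'm set" where
  "prime_torsion P = {z \<in> carrier L. \<exists>r \<in> Rc - P. r \<odot>\<^bsub>L\<^esub> z = \<zero>\<^bsub>L\<^esub>}"

text \<open>Membership in the kernel means \<open>P \<subseteq> annR z\<close>, absence from the
  torsion means \<open>annR z \<subseteq> P\<close>. The v-number at \<open>P\<close> thus becomes
  an initial degree.\<close>

lemma nonzero_at_prime:
  assumes "P \<subseteq> Rc"
  shows "nonzero_at (prime_kernel P) (prime_torsion P) n l \<longleftrightarrow> (\<exists>z \<in> L_deg (n, l). annR z = P)"
  using assms Md.summand_carrier
  unfolding nonzero_at_def prime_kernel_def prime_torsion_def annR_def by blast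

lemma stable_prime_kernel:
  assumes "P \<subseteq> Rc"
  shows "stable L gens (prime_kernel P)"
proof (rule stableI)
  fix g z assume g: "g \<in> gens" and z: "z \<in> prime_kernel P"
  then have c: "g \<in> carrier T" "z \<in> carrier L" using gens_carrier unfolding prime_kernel_def by auto
  have "r \<odot>\<^bsub>L\<^esub> (g \<odot>\<^bsub>L\<^esub> z) = \<zero>\<^bsub>L\<^esub>" if "r \<in> P" for r
    using smult_left_commute[of r g z] that z c assms Rc_props(6) unfolding prime_kernel_def by auto
  then show "g \<odot>\<^bsub>L\<^esub> z \<in> prime_kernel P" using c unfolding prime_kernel_def by simp
qed (use assms Rc_props(6) in \<open>auto simp: prime_kernel_def smult_r_distr smult_r_minus subset_iff\<close>)

text \<open>Primality enters through \<open>\<one>\<close> and through products of multipliers: a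
  sum is killed by the product of the two multipliers, which still lies outside
  \<open>P\<close>.\<close>

lemma stable_prime_torsion:
  assumes P: "prime_like P"
  shows "stable L gens (prime_torsion P)"
proof (rule stableI)
  have "\<one> \<in> Rc - P" using P Rc_props unfolding prime_like_def by blast
  then show "\<zero>\<^bsub>L\<^esub> \<in> prime_torsion P" unfolding prime_torsion_def by force
next
  fix a b assume "a \<in> prime_torsion P" "b \<in> prime_torsion P"
  then obtain r s where rs: "r \<in> Rc - P" "s \<in> Rc - P" "r \<odot>\<^bsub>L\<^esub> a = \<zero>\<^bsub>L\<^esub>" "s \<odot>\<^bsub>L\<^esub> b = \<zero>\<^bsub>L\<^esub>"
    and c: "a \<in> carrier L" "b \<in> carrier L" unfolding prime_torsion_def by blast
  have rc: "r \<in> carrier T" "s \<in> carrier T" using rs Rc_props(6) by auto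
  have "r \<otimes> s \<in> Rc - P" using rs P Rc_props(4) unfolding prime_like_def by blast
  moreover have "(r \<otimes> s) \<odot>\<^bsub>L\<^esub> (a \<oplus>\<^bsub>L\<^esub> b) = \<zero>\<^bsub>L\<^esub>"
    using rs c rc by (simp add: smult_r_distr smult_assoc1 smult_left_commute[of r s a])
  ultimately show "a \<oplus>\<^bsub>L\<^esub> b \<in> prime_torsion P" using c unfolding prime_torsion_def by blast
next
  fix a assume "a \<in> prime_torsion P"
  then show "\<ominus>\<^bsub>L\<^esub> a \<in> prime_torsion P"
    unfolding prime_torsion_def using Rc_props(6) by (auto simp: smult_r_minus intro!: bexI)
next
  fix g a assume g: "g \<in> gens" and "a \<in> prime_torsion P"
  then obtain r where r: "r \<in> Rc - P" "r \<odot>\<^bsub>L\<^esub> a = \<zero>\<^bsub>L\<^esub>" and c: "a \<in> carrier L" unfolding prime_torsion_def by blast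
  have gc: "g \<in> carrier T" using g gens_carrier by blast
  have "r \<odot>\<^bsub>L\<^esub> (g \<odot>\<^bsub>L\<^esub> a) = \<zero>\<^bsub>L\<^esub>"
    using smult_left_commute[of r g a] r c gc Rc_props(6) by auto
  then show "g \<odot>\<^bsub>L\<^esub> a \<in> prime_torsion P" using c gc r unfolding prime_torsion_def by auto
qed (auto simp: prime_torsion_def)

text \<open>Nilpotency on \<open>L\<close> passes to subquotients. Hence the slope of a prime is
  some \<open>ydeg j\<close> with \<open>j\<close> at least the least index for
  \<open>L\<close>.\<close>

lemma non_nilpotent_subset:
  assumes "K \<subseteq> carrier L" "\<zero>\<^bsub>L\<^esub> \<in> N"
  shows "non_nilpotent K N \<subseteq> non_nilpotent (carrier L) {\<zero>\<^bsub>L\<^esub>}"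
proof -
  have "nilpotent_on K N j" if nil: "nilpotent_on (carrier L) {\<zero>\<^bsub>L\<^esub>} j" for j
  proof -
    obtain k :: nat where "\<forall>u. \<forall>z \<in> carrier L \<inter> L_deg u. (y j [^] k) \<odot>\<^bsub>L\<^esub> z \<in> {\<zero>\<^bsub>L\<^esub>}"
      using nil unfolding nilpotent_on_def by blast
    then have "\<forall>u. \<forall>z \<in> K \<inter> L_deg u. (y j [^] k) \<odot>\<^bsub>L\<^esub> z \<in> N" using assms by fastforce
    then show ?thesis unfolding nilpotent_on_def by blast
  qed
  then show ?thesis unfolding non_nilpotent_def by blast
qed

text \<open>Taken over the whole of \<open>L\<close>, so that one set contains the associated primes
  of all strands.\<close>

definition assoc_primes :: "'a set set" where
  "assoc_primes = {P. prime_like P \<and> (\<exists>z \<in> carrier L. annR z = P)}"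

text \<open>Choosing an element outside \<open>P\<close> from each ideal and multiplying them gives
  a common element outside \<open>P\<close>.\<close>

lemma avoid_prime:
  assumes "finite F" "\<And>q. q \<in> F \<Longrightarrow> stable (regular_module T) Rc q \<and> q \<subseteq> Rc \<and> \<not> q \<subseteq> P" "prime_like P"
  shows "\<exists>r\<in>Rc. (\<forall>q\<in>F. r \<in> q) \<and> r \<notin> P"
  using assms(1,2)
proof (induction F)
  case empty
  then show ?case using assms(3) Rc_props(2) unfolding prime_like_def by blast
next
  case (insert q F)
  then obtain r where r: "r \<in> Rc" "\<forall>q\<in>F. r \<in> q" "r \<notin> P" by auto
  obtain s where s: "s \<in> q" "s \<in> Rc" "s \<notin> P" using insert.prems by blast
  have "r \<otimes> s \<in> q'" if "q' \<in> insert q F" for q'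
  proof -
    have st: "stable (regular_module T) Rc q'" using that insert.prems by blast
    show ?thesis
    proof (cases "q' = q")
      case True then show ?thesis using stableD(5)[OF st r(1)] s by simp
    next
      case False
      then have "s \<otimes> r \<in> q'" using that stableD(5)[OF st s(2)] r by auto
      then show ?thesis using m_comm[of r s] r s Rc_props(6) by simp
    qed
  qed
  moreover have "r \<otimes> s \<in> Rc" "r \<otimes> s \<notin> P" using r s assms(3) Rc_props(4) unfolding prime_like_def by blast+
  ultimately show ?case by blast
qed

text \<open>Infinitely many such primes could be enumerated so that none contains an earlier one.
  The elements killed by the intersection of the first primes form an increasing chain of
  \<open>T\<close>-submodules; where it stops, the next prime would contain that
  intersection.\<close>

lemma finite_assoc_primes: "finite assoc_primes"
proof (rule ccontr)
  assume inf: "\<not> finite assoc_primes"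
  have st: "stable (regular_module T) Rc p" "p \<subseteq> Rc" "prime_like p" if "p \<in> assoc_primes" for p
    using that stable_annR annR_sub unfolding assoc_primes_def by blast+
  \<comment> \<open>Adding a prime maximal among the remaining ones preserves the invariant that no
    chosen prime lies inside an unchosen one.\<close>
  define I where "I F \<longleftrightarrow> finite F \<and> F \<subseteq> assoc_primes \<and> (\<forall>q\<in>F. \<forall>p\<in>assoc_primes - F. \<not> q \<subseteq> p)" for F
  have step: "\<exists>F'. I F' \<and> (\<exists>p\<in>assoc_primes - F. F' = insert p F)" if F: "I F" for F
  proof -
    have "assoc_primes - F \<noteq> {}" using inf F unfolding I_def by (metis Diff_eq_empty_iff finite_subset)
    then obtain p where p: "p \<in> assoc_primes - F" "\<forall>p'\<in>assoc_primes - F. p \<subseteq> p' \<longrightarrow> p' = p"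
      using acc_on_maximal[OF acc_Rc, of "assoc_primes - F"] st by auto
    then have "I (insert p F)" using F unfolding I_def by blast
    then show ?thesis using p by blast
  qed
  have "I {}" unfolding I_def by simp
  then obtain f where f: "\<And>i::nat. I (f i)" "\<And>i. \<exists>p\<in>assoc_primes - f i. f (Suc i) = insert p (f i)"
    using dependent_nat_choice[of "\<lambda>_. I" "\<lambda>_ F F'. \<exists>p\<in>assoc_primes - F. F' = insert p F"] step by metis
  define U where "U i = {z \<in> carrier L. \<forall>r\<in>Rc. (\<forall>q\<in>f i. r \<in> q) \<longrightarrow> r \<odot>\<^bsub>L\<^esub> z = \<zero>\<^bsub>L\<^esub>}" for i
  have U_eq: "U i = prime_kernel {r\<in>Rc. \<forall>q\<in>f i. r \<in> q}" for i
    unfolding U_def prime_kernel_def by auto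
  have U_st: "stable L gens (U i)" for i unfolding U_eq by (rule stable_prime_kernel) blast
  have U_c: "U i \<subseteq> carrier L" for i unfolding U_def by blast
  have U_mono: "U i \<subseteq> U (Suc i)" for i
  proof -
    have "f i \<subseteq> f (Suc i)" using f(2)[of i] by blast
    then show ?thesis unfolding U_def by blast
  qed
  obtain k where k: "\<forall>m\<ge>k. U m = U k"
    using acc_onD[where f = U, OF acc_L U_st U_c U_mono] ..
  obtain p where p: "p \<in> assoc_primes - f k" "f (Suc k) = insert p (f k)" using f(2) by blast
  obtain z where z: "z \<in> carrier L" "annR z = p" using p(1) unfolding assoc_primes_def by blast
  have "z \<in> U (Suc k)" unfolding U_def p(2) using z unfolding annR_def by auto
  then have zU: "z \<in> U k" using k le_SucI[OF order_refl, of k] by blast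
  have "\<exists>r\<in>Rc. (\<forall>q\<in>f k. r \<in> q) \<and> r \<notin> p"
  proof (rule avoid_prime)
    show "finite (f k)" using f(1) unfolding I_def by blast
    show "stable (regular_module T) Rc q \<and> q \<subseteq> Rc \<and> \<not> q \<subseteq> p" if "q \<in> f k" for q
      using that f(1)[of k] p(1) st[of q] unfolding I_def by blast
    show "prime_like p" using st p(1) by blast
  qed
  then obtain r where r: "r \<in> Rc" "\<forall>q\<in>f k. r \<in> q" "r \<notin> p" by blast
  then have "r \<odot>\<^bsub>L\<^esub> z = \<zero>\<^bsub>L\<^esub>" using zU unfolding U_def by blast
  then show False using r z annR_iff by blast
qed

text \<open>A maximal annihilator among nonzero multiples of \<open>z1\<close> is prime, and if
  powers of \<open>y j\<close> do not change the annihilator of \<open>z1\<close>, they do not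
  change those of its multiples either. One prime thus occurs along a whole line of slope
  \<open>ydeg j\<close>.\<close>

lemma persistent_prime:
  assumes j: "j \<in> non_nilpotent (carrier L) {\<zero>\<^bsub>L\<^esub>}"
  obtains P n l where "prime_like P" "P \<subseteq> Rc"
    "\<And>k. \<exists>z \<in> L_deg (n + int k, l + ydeg j * int k). annR z = P"
proof -
  have j': "j \<in> {1..c}" using j unfolding non_nilpotent_def by blast
  note yc = y_carrier[OF j']
  obtain u z where z: "z \<in> carrier L \<inter> L_deg u" "\<And>k::nat. (y j [^] k) \<odot>\<^bsub>L\<^esub> z \<notin> {\<zero>\<^bsub>L\<^esub>}"
    using persistent_element[OF stable_zero[OF gens_carrier(1)] j] by blast
  have zc: "z \<in> carrier L" using z by blast
  \<comment> \<open>These annihilators increase and stop in the Noetherian ring \<open>Rc\<close>;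
    from \<open>z1\<close> on, powers of \<open>y j\<close> no longer enlarge them.\<close>
  define I where "I k = annR ((y j [^] k) \<odot>\<^bsub>L\<^esub> z)" for k :: nat
  have I_st: "stable (regular_module T) Rc (I k)" for k unfolding I_def by (rule stable_annR) (use zc yc in auto)
  have I_sub: "I k \<subseteq> Rc" for k unfolding I_def by (rule annR_sub)
  have I_le: "I k \<subseteq> I (Suc k)" for k
    unfolding I_def using annR_mono[OF yc, of "(y j [^] k) \<odot>\<^bsub>L\<^esub> z"] smult_pow_add[OF j' zc, of 1 k] zc yc by simp
  obtain k1 where k1: "\<forall>k\<ge>k1. I k = I k1"
    using acc_onD[where f = I, OF acc_Rc I_st I_sub I_le] ..
  define z1 where "z1 = (y j [^] k1) \<odot>\<^bsub>L\<^esub> z"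
  obtain n1 l1 where z1: "z1 \<in> L_deg (n1, l1)"
    using pow_degree[OF j' stable_carrier[OF gens_carrier(1)], of z "fst u" "snd u" k1] z unfolding z1_def by auto
  have z1c: "z1 \<in> carrier L" using z1 Md.summand_carrier by blast
  have ann1: "annR ((y j [^] k) \<odot>\<^bsub>L\<^esub> z1) = annR z1" for k :: nat
  proof -
    have "annR ((y j [^] k) \<odot>\<^bsub>L\<^esub> z1) = I (k + k1)" unfolding I_def z1_def smult_pow_add[OF j' zc] ..
    also have "\<dots> = I k1" using k1 le_add2 by blast
    finally show ?thesis unfolding I_def z1_def .
  qed
  define F where "F = {annR (r \<odot>\<^bsub>L\<^esub> z1) | r. r \<in> Rc \<and> r \<odot>\<^bsub>L\<^esub> z1 \<noteq> \<zero>\<^bsub>L\<^esub>}"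
  have "\<one> \<odot>\<^bsub>L\<^esub> z1 \<noteq> \<zero>\<^bsub>L\<^esub>" using z(2)[of k1] z1c unfolding z1_def by simp
  then have "F \<noteq> {}" unfolding F_def using Rc_props(2) by blast
  moreover have "stable (regular_module T) Rc Q \<and> Q \<subseteq> Rc" if "Q \<in> F" for Q
    using that stable_annR annR_sub z1c Rc_props(6) unfolding F_def by blast
  ultimately obtain P where P: "P \<in> F" "\<forall>Q\<in>F. P \<subseteq> Q \<longrightarrow> Q = P"
    using acc_on_maximal[OF acc_Rc, of F] by auto
  then obtain r where r: "r \<in> Rc" "r \<odot>\<^bsub>L\<^esub> z1 \<noteq> \<zero>\<^bsub>L\<^esub>" "P = annR (r \<odot>\<^bsub>L\<^esub> z1)" unfolding F_def by blast
  have rc: "r \<odot>\<^bsub>L\<^esub> z1 \<in> carrier L" using r z1c Rc_props(6) by auto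
  have prime: "prime_like P"
    unfolding prime_like_def
  proof (intro conjI ballI impI)
    show "\<one> \<notin> P" using annR_one[OF rc] r by simp
    fix a b assume ab: "a \<in> Rc" "b \<in> Rc" "a \<otimes> b \<in> P"
    have "a \<in> P" if b: "b \<notin> P"
    proof -
      have e: "(b \<otimes> r) \<odot>\<^bsub>L\<^esub> z1 = b \<odot>\<^bsub>L\<^esub> (r \<odot>\<^bsub>L\<^esub> z1)" using ab r Rc_props(6) z1c by (simp add: smult_assoc1)
      have "b \<odot>\<^bsub>L\<^esub> (r \<odot>\<^bsub>L\<^esub> z1) \<noteq> \<zero>\<^bsub>L\<^esub>" using b annR_iff[OF ab(2)] r(3) by blast
      then have "annR (b \<odot>\<^bsub>L\<^esub> (r \<odot>\<^bsub>L\<^esub> z1)) \<in> F" unfolding F_def using e Rc_props(4)[OF ab(2) r(1)] by force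
      moreover have "P \<subseteq> annR (b \<odot>\<^bsub>L\<^esub> (r \<odot>\<^bsub>L\<^esub> z1))" using annR_mono[of b] ab Rc_props(6) rc r(3) by simp
      ultimately have "annR (b \<odot>\<^bsub>L\<^esub> (r \<odot>\<^bsub>L\<^esub> z1)) = P" using P(2) by blast
      then show ?thesis using annR_smult[OF ab(1,2) rc] ab(3) r(3) by blast
    qed
    then show "a \<in> P \<or> b \<in> P" by blast
  qed
  have "r \<odot>\<^bsub>L\<^esub> z1 \<in> slice n1" using slice_smult[OF r(1)] homogeneous_in_slice[OF z1] by blast
  then obtain w l where w: "w \<in> Rc" "annR (lcp (w \<odot>\<^bsub>L\<^esub> (r \<odot>\<^bsub>L\<^esub> z1)) (n1, l)) = P"
    using homogeneous_part[OF prime r(3)[symmetric]] by blast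
  \<comment> \<open>\<open>z1\<close> is homogeneous, so the chosen component of
    \<open>(w \<otimes> r) \<odot> z1\<close> is \<open>z1\<close> times a single component of
    \<open>w \<otimes> r\<close>.\<close>
  define s where "s = tcp (w \<otimes> r) ((n1, l) - (n1, l1))"
  have wr: "w \<otimes> r \<in> Rc" "w \<otimes> r \<in> carrier T" using w r Rc_props(4,6) by auto
  have s: "s \<in> Rc" "s \<in> T_deg ((n1, l) - (n1, l1))" unfolding s_def using Rc_component(1) Rd.component_in wr by auto
  have sc: "s \<in> carrier T" using s Rc_props(6) by blast
  have "w \<odot>\<^bsub>L\<^esub> (r \<odot>\<^bsub>L\<^esub> z1) = (w \<otimes> r) \<odot>\<^bsub>L\<^esub> z1" using w r Rc_props(6) z1c by (simp add: smult_assoc1)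
  then have "lcp (w \<odot>\<^bsub>L\<^esub> (r \<odot>\<^bsub>L\<^esub> z1)) (n1, l) = s \<odot>\<^bsub>L\<^esub> z1"
    using component_smult_right[OF wr(2) z1, of "(n1, l)"] unfolding s_def by simp
  then have annP: "annR (s \<odot>\<^bsub>L\<^esub> z1) = P" using w(2) by simp
  have sL: "s \<odot>\<^bsub>L\<^esub> z1 \<in> L_deg (n1, l)" using smult_degree[OF s(2) z1] by simp
  have "\<exists>z \<in> L_deg (n1 + int k, l + ydeg j * int k). annR z = P" for k
  proof (rule bexI)
    show "(y j [^] k) \<odot>\<^bsub>L\<^esub> (s \<odot>\<^bsub>L\<^esub> z1) \<in> L_deg (n1 + int k, l + ydeg j * int k)"
      using pow_degree[OF j' stable_carrier[OF gens_carrier(1)], of "s \<odot>\<^bsub>L\<^esub> z1" n1 l k] sL sc z1c by simp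
    have e: "(y j [^] k) \<odot>\<^bsub>L\<^esub> (s \<odot>\<^bsub>L\<^esub> z1) = s \<odot>\<^bsub>L\<^esub> ((y j [^] k) \<odot>\<^bsub>L\<^esub> z1)"
      using smult_left_commute sc yc z1c by simp
    \<comment> \<open>\<open>t\<close> kills the product exactly when \<open>t \<otimes> s\<close>
      kills a power of \<open>y j\<close> times \<open>z1\<close>, which by \<open>ann1\<close>
      means that it kills \<open>z1\<close>.\<close>
    have "t \<in> annR (s \<odot>\<^bsub>L\<^esub> ((y j [^] k) \<odot>\<^bsub>L\<^esub> z1)) \<longleftrightarrow> t \<in> annR (s \<odot>\<^bsub>L\<^esub> z1)" if "t \<in> Rc" for t
      using annR_smult[OF that s(1)] z1c yc ann1 by simp
    then show "annR ((y j [^] k) \<odot>\<^bsub>L\<^esub> (s \<odot>\<^bsub>L\<^esub> z1)) = P"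
      unfolding e using annR_sub annP by blast
  qed
  then show thesis using that[OF prime] r(3) annR_sub by blast
qed

end

section \<open>Asymptotic linearity of v-numbers\<close>

lemma INF_int_least:
  assumes "m \<in> S" "\<And>l. l \<in> S \<Longrightarrow> m \<le> l"
  shows "(INF l\<in>S. ereal (real_of_int l)) = ereal (real_of_int m)"
  by (rule antisym) (use assms in \<open>auto intro!: INF_greatest intro: INF_lower2\<close>)

lemma ex_eventually_conj_at_top_int:
  fixes A B :: "int \<Rightarrow> bool"
  assumes "\<forall>\<^sub>F n in at_top. A n" "\<forall>\<^sub>F n in at_top. B n"
  shows "\<exists>n. A n \<and> B n"
  using eventually_happens[OF eventually_conj[OF assms]] by simp

section \<open>From strands to subquotients, and eventual linearity\<close>

context bigraded_module
begin

abbreviation "Rr \<equiv> T\<lparr>carrier := Rc\<rparr>"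
abbreviation "st n \<equiv> strand L L_deg n"
abbreviation "J \<equiv> non_nilpotent (carrier L) {\<zero>\<^bsub>L\<^esub>}"
abbreviation "Jp P \<equiv> non_nilpotent (prime_kernel P) (prime_torsion P)"
abbreviation "nz P \<equiv> nonzero_at (prime_kernel P) (prime_torsion P)"

lemma elem_ann_strand: "elem_ann Rr (st n) z = annR z"
  unfolding elem_ann_def annR_def strand_eq by simp

lemma primeideal_annR:
  assumes z: "z \<in> carrier L"
  shows "primeideal (annR z) Rr \<longleftrightarrow> prime_like (annR z)"
proof
  interpret R': cring Rr by (rule cring_Rc)
  {
    assume "primeideal (annR z) Rr"
    then interpret primeideal "annR z" Rr .
    have "\<one> \<notin> annR z" using one_imp_carrier I_notcarr by auto
    then show "prime_like (annR z)" unfolding prime_like_def using I_prime by simp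
  }
  {
    assume p: "prime_like (annR z)"
    note s = stableD[OF stable_annR[OF z], simplified]
    have inv: "\<ominus>\<^bsub>Rr\<^esub> a = \<ominus> a" if "a \<in> Rc" for a
    proof -
      have "\<ominus> a \<oplus> a = \<zero>" using ring_simprules(9)[OF Rc_props(6)[OF that]] .
      then show ?thesis using that Rc_props(5) R'.minus_equality[of "\<ominus> a" a] by simp
    qed
    show "primeideal (annR z) Rr"
    proof (rule primeidealI)
      show "ideal (annR z) Rr"
      proof (rule idealI)
        show "subgroup (annR z) (add_monoid Rr)"
        proof (rule R'.add.subgroupI)
          show "annR z \<noteq> {}" using s(2) by blast
          show "\<ominus>\<^bsub>Rr\<^esub> a \<in> annR z" if "a \<in> annR z" for a
            using s(4)[OF that] inv[OF subsetD[OF annR_sub that]] by simp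
        qed (use annR_sub s in auto)
        fix a b assume ab: "a \<in> annR z" "b \<in> carrier Rr"
        then show "b \<otimes>\<^bsub>Rr\<^esub> a \<in> annR z" using s(5) by simp
        then show "a \<otimes>\<^bsub>Rr\<^esub> b \<in> annR z" using m_comm[of a b] ab s(6) Rc_props(6) by simp
      qed (rule R'.ring_axioms)
      show "carrier Rr \<noteq> annR z" using p Rc_props(2) unfolding prime_like_def by auto
    qed (use p R'.is_cring in \<open>auto simp: prime_like_def\<close>)
  }
qed

text \<open>\<open>homogeneous_part\<close> replaces the arbitrary element of the strand by a
  homogeneous one, so being associated becomes nonvanishing of a subquotient in first degree
  \<open>n\<close>.\<close>

lemma Ass_strand: "P \<in> Ass Rr (st n) \<longleftrightarrow> P \<in> assoc_primes \<and> (\<exists>l. nz P n l)"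
proof
  assume "P \<in> Ass Rr (st n)"
  then obtain z where P: "primeideal P Rr" and z: "z \<in> slice n" "P = annR z"
    unfolding Ass_def elem_ann_strand by (auto simp: strand_eq)
  have zc: "z \<in> carrier L" using z unfolding slice_def by blast
  have pr: "prime_like P" using P primeideal_annR[OF zc] z by simp
  then obtain w l where w: "w \<in> Rc" "annR (lcp (w \<odot>\<^bsub>L\<^esub> z) (n, l)) = P"
    using homogeneous_part[OF pr z(2)[symmetric] z(1)] by blast
  have "lcp (w \<odot>\<^bsub>L\<^esub> z) (n, l) \<in> L_deg (n, l)" using w Rc_props(6) zc by (intro Md.component_in) auto
  then have "nz P n l" using nonzero_at_prime[of P] annR_sub z w by auto
  then show "P \<in> assoc_primes \<and> (\<exists>l. nz P n l)" using pr z zc unfolding assoc_primes_def by blast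
next
  assume "P \<in> assoc_primes \<and> (\<exists>l. nz P n l)"
  then obtain l where pr: "prime_like P" and "P \<subseteq> Rc" and "nz P n l"
    unfolding assoc_primes_def using annR_sub by blast
  then obtain z where z: "z \<in> L_deg (n, l)" "annR z = P" using nonzero_at_prime by blast
  have zc: "z \<in> carrier L" using z Md.summand_carrier by blast
  have "primeideal P Rr" using primeideal_annR[OF zc] pr z by simp
  then show "P \<in> Ass Rr (st n)"
    unfolding Ass_def elem_ann_strand using homogeneous_in_slice[OF z(1)] z(2) by (auto simp: strand_eq)
qed

lemma v_number_at_strand:
  assumes "P \<in> assoc_primes"
  shows "v_number_at Rr (st n) (\<lambda>l. L_deg (n, l)) P = (INF l\<in>{l. nz P n l}. ereal (real_of_int l))"
proof -
  have "P \<subseteq> Rc" using assms annR_sub unfolding assoc_primes_def by blast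
  then have "{l. \<exists>z\<in>L_deg (n, l). P = elem_ann Rr (st n) z} = {l. nz P n l}"
    unfolding elem_ann_strand nonzero_at_prime[OF \<open>P \<subseteq> Rc\<close>] by blast
  then show ?thesis unfolding v_number_at_def by simp
qed

lemma nonzero_at_carrier: "nonzero_at (carrier L) {\<zero>\<^bsub>L\<^esub>} n l \<longleftrightarrow> L_deg (n, l) \<noteq> {\<zero>\<^bsub>L\<^esub>}"
  unfolding nonzero_at_def using Md.summand_carrier Md.summand_zero by blast

lemma slice_trivial_iff: "slice n = {\<zero>\<^bsub>L\<^esub>} \<longleftrightarrow> (\<forall>l. \<not> nonzero_at (carrier L) {\<zero>\<^bsub>L\<^esub>} n l)"
proof
  assume s: "slice n = {\<zero>\<^bsub>L\<^esub>}"
  show "\<forall>l. \<not> nonzero_at (carrier L) {\<zero>\<^bsub>L\<^esub>} n l"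
    unfolding nonzero_at_def using homogeneous_in_slice s by blast
next
  assume nz: "\<forall>l. \<not> nonzero_at (carrier L) {\<zero>\<^bsub>L\<^esub>} n l"
  have "z = \<zero>\<^bsub>L\<^esub>" if z: "z \<in> slice n" for z
  proof (rule Md.component_eqI)
    show zc: "z \<in> carrier L" using z unfolding slice_def by blast
    show "lcp z u = lcp \<zero>\<^bsub>L\<^esub> u" for u
    proof (cases "fst u = n")
      case True
      then have "L_deg u = {\<zero>\<^bsub>L\<^esub>}" using nz nonzero_at_carrier[of n "snd u"] by auto
      then show ?thesis using Md.component_in[OF zc, of u] by simp
    next
      case False then show ?thesis using z unfolding slice_def by (simp del: split_paired_All)
    qed
  qed simp
  moreover have "\<zero>\<^bsub>L\<^esub> \<in> slice n" unfolding slice_def by simp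
  ultimately show "slice n = {\<zero>\<^bsub>L\<^esub>}" by blast
qed

text \<open>Elements are finite sums of homogeneous ones, so one power killing all homogeneous
  elements kills \<open>L\<close>. This identifies \<open>\<delta>\<close> with the least element of
  \<open>J\<close>.\<close>

lemma radical_ann_iff:
  assumes j: "j \<in> {1..c}"
  shows "y j \<in> radical T (module_ann T L) \<longleftrightarrow> nilpotent_on (carrier L) {\<zero>\<^bsub>L\<^esub>} j"
proof
  assume "y j \<in> radical T (module_ann T L)"
  then obtain k :: nat where "y j [^] k \<in> module_ann T L" unfolding radical_def by blast
  then show "nilpotent_on (carrier L) {\<zero>\<^bsub>L\<^esub>} j" unfolding module_ann_def nilpotent_on_def by blast
next
  assume "nilpotent_on (carrier L) {\<zero>\<^bsub>L\<^esub>} j"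
  then obtain k :: nat where k: "\<And>u z. z \<in> carrier L \<inter> L_deg u \<Longrightarrow> (y j [^] k) \<odot>\<^bsub>L\<^esub> z = \<zero>\<^bsub>L\<^esub>"
    unfolding nilpotent_on_def by blast
  have yk: "y j [^] k \<in> carrier T" using y_carrier[OF j] by simp
  have "(y j [^] k) \<odot>\<^bsub>L\<^esub> z = \<zero>\<^bsub>L\<^esub>" if z: "z \<in> carrier L" for z
  proof -
    have "(y j [^] k) \<odot>\<^bsub>L\<^esub> z = (y j [^] k) \<odot>\<^bsub>L\<^esub> finsum L (lcp z) (Md.supp z)"
      using Md.sum_component[OF z] by simp
    also have "\<dots> = finsum L (\<lambda>i. (y j [^] k) \<odot>\<^bsub>L\<^esub> lcp z i) (Md.supp z)"
      by (rule finsum_smult_ldistr) (use Md.finite_supp[OF z] yk z in auto)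
    also have "\<dots> = \<zero>\<^bsub>L\<^esub>"
      by (rule M.finsum_eq_zero) (rule k, use Md.component_in[OF z] Md.component_carrier[OF z] in blast)
    finally show ?thesis .
  qed
  then show "y j \<in> radical T (module_ann T L)"
    unfolding radical_def module_ann_def using yk y_carrier[OF j] by blast
qed

lemma delta_eq:
  assumes "J \<noteq> {}"
  shows "(INF j\<in>{j \<in> {1..c}. y j \<notin> radical T (module_ann T L)}. enat j) = enat (Min J)"
proof -
  have "{j \<in> {1..c}. y j \<notin> radical T (module_ann T L)} = J"
    unfolding non_nilpotent_def using radical_ann_iff by blast
  moreover have "(INF j\<in>J. enat j) = enat (Min J)"
  proof (rule antisym)
    show "(INF j\<in>J. enat j) \<le> enat (Min J)"
      by (rule INF_lower) (rule Min_in[OF finite_non_nilpotent assms])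
    show "enat (Min J) \<le> (INF j\<in>J. enat j)"
      by (rule INF_greatest) (simp add: finite_non_nilpotent)
  qed
  ultimately show ?thesis by simp
qed

lemma Jp_subset: "Jp P \<subseteq> J" if "prime_like P"
  by (rule non_nilpotent_subset)
    (use stableD(2)[OF stable_prime_torsion[OF that]] in \<open>auto simp: prime_kernel_def\<close>)

lemma J_range: "J \<subseteq> {1..c}"
  unfolding non_nilpotent_def by blast

text \<open>Provides the admissible range of the slope of \<open>P\<close>, and the fact that no
  slope is smaller than that of the initial degree.\<close>

lemma ydeg_Min_le:
  assumes "prime_like P" "Jp P \<noteq> {}"
  shows "Min J \<le> Min (Jp P)" "Min (Jp P) \<in> {1..c}" "ydeg (Min J) \<le> ydeg (Min (Jp P))"
proof -
  have "Min (Jp P) \<in> Jp P" using finite_non_nilpotent assms by simp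
  then have "Min (Jp P) \<in> J" using Jp_subset[OF assms(1)] by blast
  then show le: "Min J \<le> Min (Jp P)" and r: "Min (Jp P) \<in> {1..c}"
    using J_range finite_non_nilpotent by (auto intro: Min_le)
  have "Min J \<in> J" using \<open>Min (Jp P) \<in> J\<close> finite_non_nilpotent by (intro Min_in) auto
  then have "1 \<le> Min J" using J_range by auto
  then show "ydeg (Min J) \<le> ydeg (Min (Jp P))" using ydeg_mono le r by auto
qed

lemma eventually_not_Ass:
  assumes P: "P \<in> assoc_primes" "Jp P = {}"
  shows "\<forall>\<^sub>F n in at_top. P \<notin> Ass Rr (st n)"
proof -
  have "prime_like P" "P \<subseteq> Rc" using P annR_sub unfolding assoc_primes_def by blast+
  then have "\<forall>\<^sub>F n in at_top. \<forall>l. \<not> nz P n l"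
    using eventually_zero stable_prime_kernel stable_prime_torsion P(2) by blast
  then show ?thesis by eventually_elim (simp add: Ass_strand)
qed

text \<open>Together with \<open>eventually_not_Ass\<close> a dichotomy: each prime is associated
  with all large strands or with none, according to \<open>Jp P\<close>.\<close>

lemma eventually_v_number_at:
  assumes P: "P \<in> assoc_primes" "Jp P \<noteq> {}"
  shows "\<exists>b. \<forall>\<^sub>F n in at_top. P \<in> Ass Rr (st n) \<and>
    v_number_at Rr (st n) (\<lambda>l. L_deg (n, l)) P = ereal (real_of_int (ydeg (Min (Jp P)) * n + b))"
proof -
  have P': "prime_like P" "P \<subseteq> Rc" using P annR_sub unfolding assoc_primes_def by blast+
  obtain b where "\<forall>\<^sub>F n in at_top. nz P n (ydeg (Min (Jp P)) * n + b) \<and>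
      (\<forall>l < ydeg (Min (Jp P)) * n + b. \<not> nz P n l)"
    using eventually_least_degree[OF stable_prime_kernel[OF P'(2)] stable_prime_torsion[OF P'(1)] P(2)]
    by blast
  then have "\<forall>\<^sub>F n in at_top. P \<in> Ass Rr (st n) \<and>
    v_number_at Rr (st n) (\<lambda>l. L_deg (n, l)) P = ereal (real_of_int (ydeg (Min (Jp P)) * n + b))"
  proof eventually_elim
    case (elim n)
    have "(INF l\<in>{l. nz P n l}. ereal (real_of_int l)) = ereal (real_of_int (ydeg (Min (Jp P)) * n + b))"
      by (rule INF_int_least) (use elim in \<open>auto simp: not_less[symmetric]\<close>)
    then show ?case using elim P(1) v_number_at_strand[OF P(1)] by (auto simp: Ass_strand)
  qed
  then show ?thesis by blast
qed

text \<open>The line of slope \<open>ydeg (Min J)\<close> from \<open>persistent_prime\<close> stays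
  on or above the least degree for \<open>P\<close>, so the slope of \<open>P\<close> cannot be
  larger; \<open>ydeg_Min_le\<close> gives the converse.\<close>

lemma minimal_slope_prime:
  assumes "J \<noteq> {}"
  obtains P where "P \<in> assoc_primes" "Jp P \<noteq> {}" "ydeg (Min (Jp P)) = ydeg (Min J)"
proof -
  let ?D = "ydeg (Min J)"
  have "Min J \<in> J" using assms finite_non_nilpotent by simp
  then obtain P n0 l0 where P: "prime_like P" "P \<subseteq> Rc"
    and z: "\<And>k. \<exists>z \<in> L_deg (n0 + int k, l0 + ?D * int k). annR z = P"
    using persistent_prime by blast
  have nzP: "nz P n (l0 + ?D * (n - n0))" if "n \<ge> n0" for n
    using z[of "nat (n - n0)"] that nonzero_at_prime[OF P(2)] by simp
  have "\<exists>z\<in>carrier L. annR z = P" using z[of 0] Md.summand_carrier by blast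
  then have PA: "P \<in> assoc_primes" using P unfolding assoc_primes_def by blast
  have ge: "\<forall>\<^sub>F n in at_top. n \<ge> n0" by (rule eventually_ge_at_top)
  have ne: "Jp P \<noteq> {}"
  proof
    assume "Jp P = {}"
    from ex_eventually_conj_at_top_int[OF eventually_not_Ass[OF PA this] ge]
    show False using nzP PA Ass_strand by blast
  qed
  let ?a = "ydeg (Min (Jp P))"
  obtain b where b: "\<forall>\<^sub>F n in at_top. nz P n (?a * n + b) \<and> (\<forall>l < ?a * n + b. \<not> nz P n l)"
    using eventually_least_degree[OF stable_prime_kernel[OF P(2)] stable_prime_torsion[OF P(1)] ne] by blast
  have "\<not> ?D < ?a"
  proof
    assume less: "?D < ?a"
    \<comment> \<open>As \<open>?a - ?D\<close> is at least \<open>1\<close>, any nonnegative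
      \<open>n\<close> beyond \<open>l0 - ?D * n0 - b\<close> puts the line of slope
      \<open>?D\<close> strictly below the supposed minimum.\<close>
    obtain n where n: "\<forall>l < ?a * n + b. \<not> nz P n l" "n \<ge> max n0 (max 0 (l0 - ?D * n0 - b + 1))"
      using ex_eventually_conj_at_top_int[OF b eventually_ge_at_top] by blast
    have "?a * n + b \<le> l0 + ?D * (n - n0)" using n nzP[of n] by (meson max.bounded_iff not_le)
    then have "(?a - ?D) * n \<le> l0 - ?D * n0 - b" by (simp add: algebra_simps)
    moreover have "1 * n \<le> (?a - ?D) * n" by (rule mult_right_mono) (use less n in auto)
    ultimately show False using n(2) by simp
  qed
  then have "?a = ?D" using ydeg_Min_le(3)[OF P(1) ne] by simp
  then show thesis using that PA ne by blast
qed

text \<open>A minimum of finitely many eventually linear functions: the smallest slope decides, and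
  the constants decide among equal slopes.\<close>

lemma eventually_v_number:
  assumes "J \<noteq> {}"
  shows "\<exists>b2. \<forall>\<^sub>F n in at_top. v_number Rr (st n) (\<lambda>l. L_deg (n, l)) = ereal (real_of_int (ydeg (Min J) * n + b2))"
proof -
  let ?D = "ydeg (Min J)"
  let ?v = "\<lambda>n. v_number_at Rr (st n) (\<lambda>l. L_deg (n, l))"
  define A1 where "A1 = {P \<in> assoc_primes. Jp P \<noteq> {}}"
  define a where "a P = ydeg (Min (Jp P))" for P
  have fin: "finite A1" using finite_assoc_primes unfolding A1_def by simp
  have "\<forall>P\<in>A1. \<exists>b. \<forall>\<^sub>F n in at_top. P \<in> Ass Rr (st n) \<and> ?v n P = ereal (real_of_int (a P * n + b))"
    unfolding A1_def a_def using eventually_v_number_at by blast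
  from bchoice[OF this] obtain b where b: "\<forall>P\<in>A1.
    \<forall>\<^sub>F n in at_top. P \<in> Ass Rr (st n) \<and> ?v n P = ereal (real_of_int (a P * n + b P))" ..
  have ev1: "\<forall>\<^sub>F n in at_top. \<forall>P\<in>A1. P \<in> Ass Rr (st n) \<and> ?v n P = ereal (real_of_int (a P * n + b P))"
    by (rule eventually_ball_finite[OF fin]) (rule b)
  have ev2: "\<forall>\<^sub>F n in at_top. \<forall>P\<in>assoc_primes - A1. P \<notin> Ass Rr (st n)"
    by (rule eventually_ball_finite) (use finite_assoc_primes eventually_not_Ass in \<open>auto simp: A1_def\<close>)
  define A2 where "A2 = {P \<in> A1. a P = ?D}"
  have fin2: "finite A2" using fin unfolding A2_def by simp
  obtain P0 where "P0 \<in> A2" using minimal_slope_prime[OF assms] unfolding A2_def A1_def a_def by blast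
  define b2 where "b2 = Min (b ` A2)"
  have "b2 \<in> b ` A2" unfolding b2_def using fin2 \<open>P0 \<in> A2\<close> by (intro Min_in) auto
  then obtain P2 where P2: "P2 \<in> A2" "b P2 = b2" by blast
  \<comment> \<open>Slopes being integers, a steeper line gains at least \<open>n\<close> over slope
    \<open>?D\<close>, which eventually outweighs the difference of constants.\<close>
  have "\<forall>\<^sub>F n in at_top. \<forall>P\<in>A1. ?D * n + b2 \<le> a P * n + b P"
  proof (rule eventually_ball_finite[OF fin], intro ballI)
    fix P assume P: "P \<in> A1"
    have ge: "?D \<le> a P" using P ydeg_Min_le(3) unfolding A1_def a_def assoc_primes_def by blast
    show "\<forall>\<^sub>F n in at_top. ?D * n + b2 \<le> a P * n + b P"
    proof (cases "a P = ?D")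
      case True
      then have "b2 \<le> b P" unfolding b2_def using P fin2 by (intro Min_le) (auto simp: A2_def)
      then show ?thesis using True by simp
    next
      case False
      have "\<forall>\<^sub>F n in at_top. n \<ge> max 0 (b2 - b P)" by (rule eventually_ge_at_top)
      then show ?thesis
      proof eventually_elim
        case (elim n)
        have "1 * n \<le> (a P - ?D) * n" by (rule mult_right_mono) (use ge False elim in auto)
        then show ?case using elim by (simp add: algebra_simps)
      qed
    qed
  qed
  with ev1 ev2 have "\<forall>\<^sub>F n in at_top. v_number Rr (st n) (\<lambda>l. L_deg (n, l)) = ereal (real_of_int (?D * n + b2))"
  proof eventually_elim
    case (elim n)
    have Ass: "Ass Rr (st n) = A1"
    proof
      show "Ass Rr (st n) \<subseteq> A1" using elim(2) Ass_strand by blast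
      show "A1 \<subseteq> Ass Rr (st n)" using elim(1) by blast
    qed
    have P2A: "P2 \<in> A1" "a P2 = ?D" using P2 unfolding A2_def by auto
    have "(INF P\<in>A1. ?v n P) = ereal (real_of_int (?D * n + b2))"
    proof (rule antisym)
      have "?v n P2 = ereal (real_of_int (?D * n + b2))" using elim(1) P2A P2(2) by simp
      then show "(INF P\<in>A1. ?v n P) \<le> ereal (real_of_int (?D * n + b2))" using INF_lower[OF P2A(1)] by metis
      show "ereal (real_of_int (?D * n + b2)) \<le> (INF P\<in>A1. ?v n P)"
      proof (rule INF_greatest)
        fix P assume P: "P \<in> A1"
        then have "?v n P = ereal (real_of_int (a P * n + b P))" using elim(1) by blast
        moreover have "?D * n + b2 \<le> a P * n + b P" using elim(3) P by blast
        ultimately show "ereal (real_of_int (?D * n + b2)) \<le> ?v n P"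
          by (metis ereal_less_eq(3) of_int_le_iff)
      qed
    qed
    then show ?case unfolding v_number_def Ass .
  qed
  then show ?thesis by blast
qed

lemma eventually_indeg:
  assumes "J \<noteq> {}"
  shows "\<exists>b1. \<forall>\<^sub>F n in at_top. slice n \<noteq> {\<zero>\<^bsub>L\<^esub>} \<and>
    indeg (st n) (\<lambda>l. L_deg (n, l)) = ereal (real_of_int (ydeg (Min J) * n + b1))"
proof -
  let ?D = "ydeg (Min J)"
  let ?nz = "nonzero_at (carrier L) {\<zero>\<^bsub>L\<^esub>}"
  obtain b where "\<forall>\<^sub>F n in at_top. ?nz n (?D * n + b) \<and> (\<forall>l < ?D * n + b. \<not> ?nz n l)"
    using eventually_least_degree[OF stable_carrier[OF gens_carrier(1)] stable_zero[OF gens_carrier(1)] assms]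
    by blast
  then have "\<forall>\<^sub>F n in at_top. slice n \<noteq> {\<zero>\<^bsub>L\<^esub>} \<and>
    indeg (st n) (\<lambda>l. L_deg (n, l)) = ereal (real_of_int (?D * n + b))"
  proof eventually_elim
    case (elim n)
    have "(INF l\<in>{l. ?nz n l}. ereal (real_of_int l)) = ereal (real_of_int (?D * n + b))"
      by (rule INF_int_least) (use elim in \<open>auto simp: not_less[symmetric]\<close>)
    moreover have "{l. ?nz n l} = {l. L_deg (n, l) \<noteq> {\<zero>\<^bsub>st n\<^esub>}}"
      unfolding nonzero_at_carrier by (simp add: strand_eq)
    ultimately show ?case using elim slice_trivial_iff unfolding indeg_def by auto
  qed
  then show ?thesis by blast
qed

end

theorem theorem2p8:
  fixes T :: "('a, 'r) ring_scheme" and T_deg :: "int \<times> int \<Rightarrow> 'a set"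
    and L :: "('a, 'm, 'n) module_scheme" and L_deg :: "int \<times> int \<Rightarrow> 'm set"
    and R :: "('a, 'r) ring_scheme"
    and d c :: nat and x y :: "nat \<Rightarrow> 'a" and xdeg ydeg :: "nat \<Rightarrow> int" and \<delta> :: enat
  assumes "graded_cring T T_deg"
    and "noetherian_ring (T\<lparr>carrier := T_deg (0, 0)\<rparr>)"
    and "\<And>i. i \<in> {1..d} \<Longrightarrow> x i \<in> T_deg (0, xdeg i)"
    and "\<And>i. i \<in> {1..d} \<Longrightarrow> xdeg i \<ge> 1"
    and "\<And>j. j \<in> {1..c} \<Longrightarrow> y j \<in> T_deg (1, ydeg j)"
    and "\<And>j. j \<in> {1..c} \<Longrightarrow> ydeg j \<ge> 0"
    and "\<And>i j. 1 \<le> i \<Longrightarrow> i \<le> j \<Longrightarrow> j \<le> c \<Longrightarrow> ydeg i \<le> ydeg j"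
    and "carrier T = generate_ring T (T_deg (0, 0) \<union> x ` {1..d} \<union> y ` {1..c})"
    and "graded_module T T_deg L L_deg"
    and "finitely_generated_module T L"
    and \<delta>_def: "\<delta> = (INF j\<in>{j \<in> {1..c}. y j \<notin> radical T (module_ann T L)}. enat j)"
    and R_def: "R = T\<lparr>carrier := generate_ring T (T_deg (0, 0) \<union> x ` {1..d})\<rparr>"
  shows "(\<forall>n. graded_module R (\<lambda>l. carrier R \<inter> T_deg (0, l)) (strand L L_deg n) (\<lambda>l. L_deg (n, l))) \<and>
    ((\<forall>\<^sub>F n in at_top. carrier (strand L L_deg n) = {\<zero>\<^bsub>L\<^esub>}) \<or>
     (\<forall>\<^sub>F n in at_top. carrier (strand L L_deg n) \<noteq> {\<zero>\<^bsub>L\<^esub>})) \<and>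
    ((\<forall>\<^sub>F n in at_top. carrier (strand L L_deg n) \<noteq> {\<zero>\<^bsub>L\<^esub>}) \<longrightarrow>
      \<delta> \<noteq> \<infinity> \<and>
      (\<exists>(a :: 'a set \<Rightarrow> int) (b :: 'a set \<Rightarrow> int) (b1 :: int) (b2 :: int).
        (\<forall>\<^sub>F n in at_top. indeg (strand L L_deg n) (\<lambda>l. L_deg (n, l)) =
           ereal (real_of_int (ydeg (the_enat \<delta>) * n + b1))) \<and>
        (\<forall>P. (\<forall>\<^sub>F n in at_top. P \<in> Ass R (strand L L_deg n)) \<longrightarrow>
           a P \<in> {ydeg j | j. \<delta> \<le> enat j \<and> j \<le> c} \<and>
           (\<forall>\<^sub>F n in at_top. v_number_at R (strand L L_deg n) (\<lambda>l. L_deg (n, l)) P =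
              ereal (real_of_int (a P * n + b P)))) \<and>
        (\<forall>\<^sub>F n in at_top. v_number R (strand L L_deg n) (\<lambda>l. L_deg (n, l)) =
           ereal (real_of_int (ydeg (the_enat \<delta>) * n + b2)))))"
proof -
  interpret bigraded_module T T_deg L L_deg d c x y xdeg ydeg
    by (rule bigraded_module.intro[OF assms(9) bigraded_module_axioms.intro[OF assms(2-8,10)]])
  let ?S = "strand L L_deg"
  have R: "R = T\<lparr>carrier := Rc\<rparr>" unfolding R_def Rc_def ..
  have cS: "carrier (?S n) = slice n" for n by (simp add: strand_eq)
  have zero: "\<forall>\<^sub>F n in at_top. slice n = {\<zero>\<^bsub>L\<^esub>}" if "J = {}"
    using eventually_zero[OF stable_carrier[OF gens_carrier(1)] stable_zero[OF gens_carrier(1)] that]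
    by (simp add: slice_trivial_iff)
  have nonzero: "\<forall>\<^sub>F n in at_top. slice n \<noteq> {\<zero>\<^bsub>L\<^esub>}" if "J \<noteq> {}"
    using eventually_indeg[OF that] unfolding eventually_conj_iff by blast
  have graded: "graded_module R (\<lambda>l. carrier R \<inter> T_deg (0, l)) (?S n) (\<lambda>l. L_deg (n, l))" for n
    using graded_module_strand unfolding R by simp
  have main: "\<delta> \<noteq> \<infinity> \<and>
      (\<exists>(a :: 'a set \<Rightarrow> int) (b :: 'a set \<Rightarrow> int) (b1 :: int) (b2 :: int).
        (\<forall>\<^sub>F n in at_top. indeg (?S n) (\<lambda>l. L_deg (n, l)) =
           ereal (real_of_int (ydeg (the_enat \<delta>) * n + b1))) \<and>
        (\<forall>P. (\<forall>\<^sub>F n in at_top. P \<in> Ass R (?S n)) \<longrightarrow>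
           a P \<in> {ydeg j | j. \<delta> \<le> enat j \<and> j \<le> c} \<and>
           (\<forall>\<^sub>F n in at_top. v_number_at R (?S n) (\<lambda>l. L_deg (n, l)) P =
              ereal (real_of_int (a P * n + b P)))) \<and>
        (\<forall>\<^sub>F n in at_top. v_number R (?S n) (\<lambda>l. L_deg (n, l)) =
           ereal (real_of_int (ydeg (the_enat \<delta>) * n + b2))))"
    if ev: "\<forall>\<^sub>F n in at_top. slice n \<noteq> {\<zero>\<^bsub>L\<^esub>}"
  proof -
    \<comment> \<open>Otherwise large strands would be both zero and nonzero.\<close>
    have ne: "J \<noteq> {}" using ex_eventually_conj_at_top_int[OF ev zero] by blast
    have \<delta>: "\<delta> = enat (Min J)" unfolding \<delta>_def by (rule delta_eq[OF ne])
    obtain b1 where b1: "\<forall>\<^sub>F n in at_top. indeg (?S n) (\<lambda>l. L_deg (n, l)) =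
        ereal (real_of_int (ydeg (Min J) * n + b1))"
      using eventually_indeg[OF ne] unfolding eventually_conj_iff by blast
    obtain b2 where b2: "\<forall>\<^sub>F n in at_top. v_number R (?S n) (\<lambda>l. L_deg (n, l)) =
        ereal (real_of_int (ydeg (Min J) * n + b2))"
      using eventually_v_number[OF ne] unfolding R by blast
    \<comment> \<open>Slope and constant are functions on all sets \<open>P\<close>, obtained by
      choice from pointwise existence; the condition is vacuous for sets that are not eventually
      associated.\<close>
    define Q where "Q P a b \<longleftrightarrow> (\<forall>\<^sub>F n in at_top. P \<in> Ass R (?S n)) \<longrightarrow>
        a \<in> {ydeg j | j. \<delta> \<le> enat j \<and> j \<le> c} \<and>
        (\<forall>\<^sub>F n in at_top. v_number_at R (?S n) (\<lambda>l. L_deg (n, l)) P = ereal (real_of_int (a * n + b)))"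
      for P and a b :: int
    have "\<exists>a b. Q P a b" for P
    proof (cases "\<forall>\<^sub>F n in at_top. P \<in> Ass R (?S n)")
      case True
      then obtain n where "P \<in> Ass R (?S n)" using eventually_happens by fastforce
      then have P: "P \<in> assoc_primes" unfolding R Ass_strand by blast
      then have pr: "prime_like P" unfolding assoc_primes_def by blast
      have neP: "Jp P \<noteq> {}"
        using ex_eventually_conj_at_top_int[OF True eventually_not_Ass[OF P, folded R]] by blast
      obtain b where "\<forall>\<^sub>F n in at_top. v_number_at R (?S n) (\<lambda>l. L_deg (n, l)) P =
          ereal (real_of_int (ydeg (Min (Jp P)) * n + b))"
        using eventually_v_number_at[OF P neP] unfolding R eventually_conj_iff by blast
      moreover have "ydeg (Min (Jp P)) \<in> {ydeg j | j. \<delta> \<le> enat j \<and> j \<le> c}"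
        using ydeg_Min_le(1,2)[OF pr neP] unfolding \<delta> by auto
      ultimately show ?thesis unfolding Q_def by blast
    qed (auto simp: Q_def)
    then obtain a where "\<forall>P. \<exists>b. Q P (a P) b" using choice[of "\<lambda>P a. \<exists>b. Q P a b"] by blast
    then obtain b where "\<forall>P. Q P (a P) (b P)" using choice[of "\<lambda>P. Q P (a P)"] by blast
    then have ab: "Q P (a P) (b P)" for P by blast
    show ?thesis
      by (intro conjI exI[of _ a] exI[of _ b] exI[of _ b1] exI[of _ b2] allI ab[unfolded Q_def])
        (use b1 b2 \<delta> in simp_all)
  qed
  show ?thesis
    unfolding cS using graded zero nonzero main by blast
qed

end
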